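(* Let $G$ be a compact Lie group which acts smoothly and freely on a smooth manifold $M$. Suppose that $(X,\mathcal{S})$, $X\subset M$, is a Whitney stratified subset such that $X$ is $G$-invariant and the induced action of $G$ on $X$ is compatible with the stratification $\mathcal{S}$. Then $(X/G,\mathcal{S}/G)$, $X/G\subset M/G$, is a Whitney stratified subset of the smooth manifold $M/G$, where $\mathcal{S}/G=\{S/G \mid S\in\mathcal{S}\}$.
   Context: A stratification $\mathcal{S}$ of a separable, locally compact Hausdorff space $X$ over a poset $P$ is a partition $\mathcal{S}=\{S_i\mid i\in P\}$ of $X$ into nonempty locally closed subspaces (the strata) such that (S1) $\mathcal{S}$ is locally finite; (S2) every $S_i$ is a smooth manifold; (S3) $S_i\cap\overline{S}_j\neq\varnothing$ if and only if $S_i\subset\overline{S}_j$, and this is the case if and only if $i\le j$. Let $X$ be a closed subset of a smooth manifold $M$ of dimension $n$, stratified by $\mathcal{S}$ such that the strata are smooth submanifolds of $M$. Let $R\neq S$ be strata with $R\subset\overline{S}$ and $x\in R$. The pair $(R,S)$ is Whitney (B)-regular at $x$ if there is a smooth chart $\chi:U\to\mathbb{R}^n$ of $M$ around $x$ such that: whenever $(x_k)$ is a sequence in $R\cap U$ and $(y_k)$ a sequence in $S\cap U$ with $x_k\to x$, $y_k\to x$, such that the lines through the origin spanned by $\chi(y_k)-\chi(x_k)$ converge in $\mathbb{R}\mathbb{P}^{n-1}$ to a line $\ell$ and the tangent planes of $\chi(S\cap U)$ at $\chi(y_k)$, translated to the origin, converge in the Grassmannian of $(\dim S)$-planes in $\mathbb{R}^n$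 to $\tau$, then $\ell\subset\tau$. The pair $(X,\mathcal{S})$ is a Whitney stratified subset of $M$ if (B)-regularity holds for all such pairs $(R,S)$ at all points of $R$. An action of $G$ on $X$ is compatible with $\mathcal{S}$ if every stratum $S$ is $G$-invariant and the induced action $G\times S\to S$ is smooth. Since $G$ is compact and acts smoothly and freely, $M/G$ is a smooth manifold (with the unique smooth structure making $M\to M/G$ a smooth submersion), and $X/G$ is a closed subset of $M/G$. *)

theory Defs
  imports "HOL-Analysis.Analysis" "HOL-Algebra.Group_Action"
begin

section \<open>Smooth maps between subsets of Euclidean spaces\<close>

primrec Ck_on :: "nat \<Rightarrow> ('a::euclidean_space \<Rightarrow> 'b::euclidean_space) \<Rightarrow> 'a set \<Rightarrow> bool" where
  "Ck_on 0 f S \<longleftrightarrow> continuous_on S f"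
| "Ck_on (Suc k) f S \<longleftrightarrow>
     (\<forall>x\<in>S. f differentiable (at x)) \<and>
     (\<forall>v. Ck_on k (\<lambda>x. frechet_derivative f (at x) v) S)"

text \<open>
  \<open>Ck_on\<close> is only meaningful on open sets. On an arbitrary set, smooth means locally extendable to
  a smooth map on an open set of the ambient space; for relatively open subsets of a linear
  subspace \<open>E\<close> this is ordinary smoothness on an open subset of the vector space \<open>E\<close>.
\<close>

definition smooth_on :: "('a::euclidean_space \<Rightarrow> 'b::euclidean_space) \<Rightarrow> 'a set \<Rightarrow> bool" where
  "smooth_on f S \<longleftrightarrow>
     (\<forall>x\<in>S. \<exists>V g. open V \<and> x \<in> V \<and> (\<forall>k. Ck_on k g V) \<and> (\<forall>y\<in>V \<inter> S. g y = f y))"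


section \<open>Smooth manifolds\<close>

text \<open>
  The Euclidean space in which the charts of an \<open>n\<close>-dimensional manifold take their values is an
  \<open>n\<close>-dimensional linear subspace \<open>model\<close> of a type of class \<open>euclidean_space\<close>, rather than that
  type itself. Strata and orbit spaces have dimensions that are not given by a type,
  and \<open>n = 0\<close> must be allowed (\<open>DIM('e)\<close> is never \<open>0\<close>; finite groups are Lie groups).
  The atlas is not required to be maximal; the maximal atlas is \<open>smooth_charts\<close>.
\<close>

type_synonym ('a, 'e) chart = "'a set \<times> ('a \<Rightarrow> 'e)"

record ('a, 'e) manifold =
  mtop :: "'a topology"
  model :: "'e set"
  atlas :: "('a, 'e) chart set"

abbreviation points :: "('a, 'e) manifold \<Rightarrow> 'a set" where
  "points M \<equiv> topspace (mtop M)"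

abbreviation mdim :: "('a, 'e::euclidean_space) manifold \<Rightarrow> nat" where
  "mdim M \<equiv> dim (model M)"

definition chart_on :: "'a topology \<Rightarrow> 'e::euclidean_space set \<Rightarrow> ('a, 'e) chart \<Rightarrow> bool" where
  "chart_on T E = (\<lambda>(U, \<phi>).
     openin T U \<and> openin (top_of_set E) (\<phi> ` U) \<and>
     homeomorphic_map (subtopology T U) (top_of_set (\<phi> ` U)) \<phi>)"

definition local_rep :: "('a, 'e) chart \<Rightarrow> ('b, 'f) chart \<Rightarrow> ('a \<Rightarrow> 'b) \<Rightarrow> 'e \<Rightarrow> 'f" where
  "local_rep c d f = snd d \<circ> f \<circ> inv_into (fst c) (snd c)"

definition local_dom :: "('a, 'e) chart \<Rightarrow> ('b, 'f) chart \<Rightarrow> ('a \<Rightarrow> 'b) \<Rightarrow> 'e set" where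
  "local_dom c d f = snd c ` {x \<in> fst c. f x \<in> fst d}"

definition compatible_charts ::
    "('a, 'e::euclidean_space) chart \<Rightarrow> ('a, 'e) chart \<Rightarrow> bool" where
  "compatible_charts c d \<longleftrightarrow>
     smooth_on (local_rep c d id) (local_dom c d id) \<and>
     smooth_on (local_rep d c id) (local_dom d c id)"

definition smooth_manifold :: "('a, 'e::euclidean_space) manifold \<Rightarrow> bool" where
  "smooth_manifold M \<longleftrightarrow>
     Hausdorff_space (mtop M) \<and> second_countable (mtop M) \<and> subspace (model M) \<and>
     (\<forall>c\<in>atlas M. chart_on (mtop M) (model M) c) \<and>
     points M = \<Union>(fst ` atlas M) \<and>
     (\<forall>c\<in>atlas M. \<forall>d\<in>atlas M. compatible_charts c d)"

definition smooth_charts :: "('a, 'e::euclidean_space) manifold \<Rightarrow> ('a, 'e) chart set" where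
  "smooth_charts M =
     {c. chart_on (mtop M) (model M) c \<and> (\<forall>d\<in>atlas M. compatible_charts c d)}"

definition smooth_map ::
    "('a, 'e::euclidean_space) manifold \<Rightarrow> ('b, 'f::euclidean_space) manifold \<Rightarrow> ('a \<Rightarrow> 'b) \<Rightarrow> bool"
  where
  "smooth_map M N f \<longleftrightarrow>
     continuous_map (mtop M) (mtop N) f \<and>
     (\<forall>c\<in>atlas M. \<forall>d\<in>atlas N. smooth_on (local_rep c d f) (local_dom c d f))"

text \<open>
  The derivative \<open>D\<close> of a local representative within the open subset \<open>local_dom c d f\<close> of
  \<open>model M\<close> is a linear map on the whole type \<open>'e\<close>, of which only the restriction to
  \<open>model M\<close> is determined; that restriction is the differential of \<open>f\<close> at \<open>p\<close> in charts.
\<close>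

definition smooth_immersion ::
    "('a, 'e::euclidean_space) manifold \<Rightarrow> ('b, 'f::euclidean_space) manifold \<Rightarrow> ('a \<Rightarrow> 'b) \<Rightarrow> bool"
  where
  "smooth_immersion M N f \<longleftrightarrow>
     smooth_map M N f \<and>
     (\<forall>c\<in>atlas M. \<forall>d\<in>atlas N. \<forall>p\<in>fst c. f p \<in> fst d \<longrightarrow>
        (\<exists>D. (local_rep c d f has_derivative D) (at (snd c p) within local_dom c d f) \<and>
             inj_on D (model M)))"

definition smooth_submersion ::
    "('a, 'e::euclidean_space) manifold \<Rightarrow> ('b, 'f::euclidean_space) manifold \<Rightarrow> ('a \<Rightarrow> 'b) \<Rightarrow> bool"
  where
  "smooth_submersion M N f \<longleftrightarrow>
     smooth_map M N f \<and>
     (\<forall>c\<in>atlas M. \<forall>d\<in>atlas N. \<forall>p\<in>fst c. f p \<in> fst d \<longrightarrow>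
        (\<exists>D. (local_rep c d f has_derivative D) (at (snd c p) within local_dom c d f) \<and>
             D ` model M = model N))"

definition product_manifold ::
    "('a, 'e) manifold \<Rightarrow> ('b, 'f) manifold \<Rightarrow> ('a \<times> 'b, 'e \<times> 'f) manifold" where
  "product_manifold M N =
     \<lparr>mtop = prod_topology (mtop M) (mtop N),
      model = model M \<times> model N,
      atlas = {(U \<times> V, map_prod \<phi> \<psi>) | U \<phi> V \<psi>. (U, \<phi>) \<in> atlas M \<and> (V, \<psi>) \<in> atlas N}\<rparr>"

text \<open>Submanifolds are embedded: they carry the subspace topology.\<close>

definition submanifold ::
    "('a, 'e::euclidean_space) manifold \<Rightarrow> ('a, 'e) manifold \<Rightarrow> bool" where
  "submanifold M N \<longleftrightarrow>
     smooth_manifold N \<and> points N \<subseteq> points M \<and>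
     mtop N = subtopology (mtop M) (points N) \<and> smooth_immersion N M id"


section \<open>Stratified spaces\<close>

text \<open>
  \<open>S i\<close> is the stratum with index \<open>i\<close>, as a smooth manifold. The poset is a subset \<open>P\<close> of an
  ordered type.
\<close>

definition stratification ::
    "'a topology \<Rightarrow> 'i::order set \<Rightarrow> ('i \<Rightarrow> ('a, 'e::euclidean_space) manifold) \<Rightarrow> bool" where
  "stratification X P S \<longleftrightarrow>
     separable_space X \<and> locally_compact_space X \<and> Hausdorff_space X \<and>
     (\<Union>i\<in>P. points (S i)) = topspace X \<and>
     (\<forall>i\<in>P. \<forall>j\<in>P. i \<noteq> j \<longrightarrow> points (S i) \<inter> points (S j) = {}) \<and>
     (\<forall>i\<in>P. points (S i) \<noteq> {} \<and>
        (\<exists>U C. openin X U \<and> closedin X C \<and> points (S i) = U \<inter> C) \<and>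
        mtop (S i) = subtopology X (points (S i))) \<and>
     locally_finite_in X ((\<lambda>i. points (S i)) ` P) \<and>
     (\<forall>i\<in>P. smooth_manifold (S i)) \<and>
     (\<forall>i\<in>P. \<forall>j\<in>P.
        (points (S i) \<inter> X closure_of points (S j) \<noteq> {} \<longleftrightarrow>
           points (S i) \<subseteq> X closure_of points (S j)) \<and>
        (points (S i) \<subseteq> X closure_of points (S j) \<longleftrightarrow> i \<le> j))"


section \<open>Whitney's condition (B)\<close>

text \<open>
  The Grassmannian of \<open>k\<close>-dimensional linear subspaces of \<open>E\<close>, topologized by identifying a subspace
  with the orthogonal projection onto it, which is \<open>closest_point L\<close>. The topology on functions is that
  of pointwise convergence, which on linear maps is the norm topology.
  For \<open>k = 1\<close> this is the projective space of \<open>E\<close>.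
\<close>

definition Grassmannian :: "nat \<Rightarrow> 'e::euclidean_space set \<Rightarrow> 'e set topology" where
  "Grassmannian k E =
     pullback_topology {L. subspace L \<and> L \<subseteq> E \<and> dim L = k} closest_point euclidean"

text \<open>The tangent space at \<open>z\<close>, translated to the origin, of a submanifold \<open>A\<close> of a Euclidean space.\<close>

definition tangent_space :: "'e::euclidean_space set \<Rightarrow> 'e \<Rightarrow> 'e set" where
  "tangent_space A z =
     {v. \<exists>\<gamma> e. e > 0 \<and> smooth_on \<gamma> {-e<..<e::real} \<and> \<gamma> ` {-e<..<e} \<subseteq> A \<and>
           \<gamma> 0 = z \<and> (\<gamma> has_vector_derivative v) (at 0)}"

definition whitney_B_regular_at ::
    "('a, 'e::euclidean_space) manifold \<Rightarrow> ('a, 'e) manifold \<Rightarrow> ('a, 'e) manifold \<Rightarrow> 'a \<Rightarrow> bool"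
  where
  "whitney_B_regular_at M R S x \<longleftrightarrow>
     (\<exists>(U, \<phi>)\<in>smooth_charts M. x \<in> U \<and>
        (\<forall>xs ys l \<tau>.
           (\<forall>k. xs k \<in> points R \<inter> U) \<and> (\<forall>k. ys k \<in> points S \<inter> U) \<and>
           limitin (mtop M) xs x sequentially \<and> limitin (mtop M) ys x sequentially \<and>
           limitin (Grassmannian 1 (model M))
             (\<lambda>k. span {\<phi> (ys k) - \<phi> (xs k)}) l sequentially \<and>
           limitin (Grassmannian (mdim S) (model M))
             (\<lambda>k. tangent_space (\<phi> ` (points S \<inter> U)) (\<phi> (ys k))) \<tau> sequentially
           \<longrightarrow> l \<subseteq> \<tau>))"

definition whitney_stratified_subset ::
    "('a, 'e::euclidean_space) manifold \<Rightarrow> 'a set \<Rightarrow> 'i::order set \<Rightarrow>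
     ('i \<Rightarrow> ('a, 'e) manifold) \<Rightarrow> bool" where
  "whitney_stratified_subset M X P S \<longleftrightarrow>
     smooth_manifold M \<and> closedin (mtop M) X \<and>
     stratification (subtopology (mtop M) X) P S \<and>
     (\<forall>i\<in>P. submanifold M (S i)) \<and>
     (\<forall>i\<in>P. \<forall>j\<in>P. i \<noteq> j \<and> points (S i) \<subseteq> mtop M closure_of points (S j) \<longrightarrow>
        (\<forall>x\<in>points (S i). whitney_B_regular_at M (S i) (S j) x))"


section \<open>Lie groups, smooth actions and orbit spaces\<close>

definition Lie_group :: "('g, 'm) monoid_scheme \<Rightarrow> ('g, 'f::euclidean_space) manifold \<Rightarrow> bool" where
  "Lie_group G L \<longleftrightarrow>
     group G \<and> smooth_manifold L \<and> points L = carrier G \<and>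
     smooth_map (product_manifold L L) L (\<lambda>(a, b). a \<otimes>\<^bsub>G\<^esub> b) \<and>
     smooth_map L L (\<lambda>a. inv\<^bsub>G\<^esub> a)"

definition smooth_action ::
    "('g, 'm) monoid_scheme \<Rightarrow> ('g, 'f::euclidean_space) manifold \<Rightarrow>
     ('a, 'e::euclidean_space) manifold \<Rightarrow> ('g \<Rightarrow> 'a \<Rightarrow> 'a) \<Rightarrow> bool" where
  "smooth_action G L M \<alpha> \<longleftrightarrow>
     group_action G (points M) \<alpha> \<and> smooth_map (product_manifold L M) M (\<lambda>(g, x). \<alpha> g x)"

definition free_action :: "('g, 'm) monoid_scheme \<Rightarrow> 'a set \<Rightarrow> ('g \<Rightarrow> 'a \<Rightarrow> 'a) \<Rightarrow> bool" where
  "free_action G A \<alpha> \<longleftrightarrow> (\<forall>x\<in>A. stabilizer G \<alpha> x = {\<one>\<^bsub>G\<^esub>})"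

definition invariant_set :: "('g, 'm) monoid_scheme \<Rightarrow> 'a set \<Rightarrow> ('g \<Rightarrow> 'a \<Rightarrow> 'a) \<Rightarrow> bool" where
  "invariant_set G A \<alpha> \<longleftrightarrow> (\<forall>g\<in>carrier G. \<alpha> g ` A \<subseteq> A)"

definition compatible_action ::
    "('g, 'm) monoid_scheme \<Rightarrow> ('g, 'f::euclidean_space) manifold \<Rightarrow> 'i set \<Rightarrow>
     ('i \<Rightarrow> ('a, 'e::euclidean_space) manifold) \<Rightarrow> ('g \<Rightarrow> 'a \<Rightarrow> 'a) \<Rightarrow> bool" where
  "compatible_action G L P S \<alpha> \<longleftrightarrow>
     (\<forall>i\<in>P. invariant_set G (points (S i)) \<alpha> \<and>
        smooth_map (product_manifold L (S i)) (S i) (\<lambda>(g, x). \<alpha> g x))"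

text \<open>
  \<open>Q\<close> is the manifold \<open>M/G\<close>: its points are the orbits of points of \<open>M\<close>, it has the quotient topology,
  and its smooth structure makes the projection \<open>M \<rightarrow> M/G\<close> a smooth submersion. As \<open>Q\<close> includes a choice
  of atlas, it is unique only up to the identity being a diffeomorphism.
\<close>

definition quotient_manifold ::
    "('g, 'm) monoid_scheme \<Rightarrow> ('g \<Rightarrow> 'a \<Rightarrow> 'a) \<Rightarrow> ('a, 'e::euclidean_space) manifold \<Rightarrow>
     ('a set, 'e) manifold \<Rightarrow> bool" where
  "quotient_manifold G \<alpha> M Q \<longleftrightarrow>
     smooth_manifold Q \<and> points Q = orbits G (points M) \<alpha> \<and>
     quotient_map (mtop M) (mtop Q) (orbit G \<alpha>) \<and> smooth_submersion M Q (orbit G \<alpha>)"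

end

theory Submission
  imports Defs
begin

text \<open>
  The orbit maps are injective, so somewhere, and hence by equivariance everywhere, their derivatives
  are injective. The inverse function theorem and the compactness of \<open>G\<close> then give slices: through
  every \<open>x\<close>, and in every chart \<open>\<chi>\<close> at \<open>x\<close>, the map \<open>n \<mapsto> \<chi>\<^sup>-\<^sup>1 (\<chi> x + B n)\<close> on a small neighbourhood
  of \<open>0\<close> meets each nearby orbit exactly once, where the image of the linear map \<open>B\<close> is a complement of
  the tangent space of the orbit. Slices are the inverse charts of \<open>M/G\<close>, for every admissible choice
  of smooth structure on \<open>M/G\<close>.

  For condition (B) take the slice in the very chart \<open>\<chi>\<close> in which (B) holds upstairs. Lifting sequences
  along the slice turns secants of \<open>M/G\<close> into their images under \<open>B\<close>, and the tangent spaces of a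
  stratum upstairs converge to \<open>B \<tau> + K\<close>, where \<open>\<tau>\<close> is the limit downstairs and \<open>K\<close> is the tangent
  space of the orbit. So (B) gives \<open>B l \<subseteq> B \<tau> + K\<close>, that is \<open>l \<subseteq> \<tau>\<close>. This never uses that (B) is
  independent of the chart.
\<close>

section \<open>Calculus of smooth maps\<close>

text \<open>Strata carry smooth structures of their own, and \<open>M/G\<close> and each
  \<open>S/G\<close> may be any manifolds that satisfy \<open>quotient_manifold\<close>, whose
  definition states neither an atlas nor a dimension. Therefore free actions are treated once, for
  an abstract manifold, and the results are applied to \<open>M\<close> and to every stratum
  separately. The quotients are compared only afterwards, through local sections of the submersions
  and through the fact that the kernel of the projection is the tangent space of the orbit.

  No Lie algebra and no exponential map occur; a chart of \<open>G\<close> at the identity takes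
  their place. Compactness of \<open>G\<close> makes the orbit relation closed, which yields the
  Hausdorff property of the orbit space and keeps group elements far from the identity from
  returning a small slice to itself.

  Condition (B) upstairs presupposes that the tangent spaces of the stratum converge, and this has
  to be derived from convergence downstairs. It holds since these spaces contain vectors tending to
  each element of \<open>B \<tau> + K\<close>, and since \<open>dim (S/G) + dim G = dim S\<close>
  makes the dimensions agree.\<close>

lemma Ck_on_mono: "Ck_on k f S \<Longrightarrow> T \<subseteq> S \<Longrightarrow> Ck_on k f T"
  by (induction k arbitrary: f) (auto intro: continuous_on_subset)

text \<open>Openness of \<open>S\<close> matters because derivatives are taken along the full filter
  \<open>at x\<close>, so the maps have to agree on a neighbourhood of \<open>x\<close>.\<close>

lemma Ck_on_cong:
  assumes "open S" "\<And>x. x \<in> S \<Longrightarrow> f x = g x"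
  shows "Ck_on k f S \<longleftrightarrow> Ck_on k g S"
  using assms(2)
proof (induction k arbitrary: f g)
  case 0
  then show ?case by (auto cong: continuous_on_cong)
next
  case (Suc k)
  have *: "(f has_derivative D) (at x) \<longleftrightarrow> (g has_derivative D) (at x)" if "x \<in> S" for D x
    by (metis Suc.prems assms(1) has_derivative_transform_within_open that)
  then have "frechet_derivative f (at x) = frechet_derivative g (at x)" if "x \<in> S" for x
    using that by (simp add: frechet_derivative_def)
  then have "Ck_on k (\<lambda>x. frechet_derivative f (at x) v) S \<longleftrightarrow>
        Ck_on k (\<lambda>x. frechet_derivative g (at x) v) S" for v
    by (intro Suc.IH) auto
  with * show ?case by (auto simp: differentiable_def)
qed

lemma Ck_on_imp_continuous_on: "Ck_on k f S \<Longrightarrow> continuous_on S f"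
  by (cases k)
    (auto simp: differentiable_imp_continuous_within continuous_at_imp_continuous_on)

text \<open>The successor clause mentions no lower order; lower orders come back because
  differentiability yields continuity at the bottom of the recursion.\<close>

lemma Ck_on_SucD: "Ck_on (Suc k) f S \<Longrightarrow> Ck_on k f S"
proof (induction k arbitrary: f)
  case 0
  then show ?case using Ck_on_imp_continuous_on by fastforce
qed simp

text \<open>Lets an explicitly computed derivative \<open>D\<close> take the place of
  \<open>frechet_derivative\<close>, so that each closure property reduces to its differentiation
  rule and an induction.\<close>

lemma Ck_on_SucI:
  assumes "open S" "\<And>x. x \<in> S \<Longrightarrow> (f has_derivative D x) (at x)" "\<And>v. Ck_on k (\<lambda>x. D x v) S"
  shows "Ck_on (Suc k) f S"
proof -
  have "frechet_derivative f (at x) = D x" if "x \<in> S" for x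
    using assms(2) frechet_derivative_at that by metis
  then have "Ck_on k (\<lambda>x. frechet_derivative f (at x) v) S" for v
    using Ck_on_cong[of S "\<lambda>x. frechet_derivative f (at x) v" "\<lambda>x. D x v"] assms by auto
  then show ?thesis using assms by (auto simp: differentiable_def)
qed

lemma Ck_on_SucD_has_derivative:
  assumes "Ck_on (Suc k) f S" "x \<in> S"
  shows "(f has_derivative frechet_derivative f (at x)) (at x)"
  using assms by (simp add: frechet_derivative_works)

lemma Ck_on_const: "open S \<Longrightarrow> Ck_on k (\<lambda>x. c) S"
proof (induction k arbitrary: c)
  case (Suc k)
  show ?case by (rule Ck_on_SucI[where D = "\<lambda>_ _. 0"]) (use Suc in auto)
qed simp

lemma Ck_on_linear: "open S \<Longrightarrow> bounded_linear f \<Longrightarrow> Ck_on k f S"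
proof (cases k)
  case (Suc j)
  assume "open S" "bounded_linear f"
  then show ?thesis unfolding Suc
    by (intro Ck_on_SucI[where D = "\<lambda>_. f"]) (auto simp: Ck_on_const bounded_linear_imp_has_derivative)
qed (auto intro: linear_continuous_on)

lemma Ck_on_add:
  "open S \<Longrightarrow> Ck_on k f S \<Longrightarrow> Ck_on k g S \<Longrightarrow> Ck_on k (\<lambda>x. f x + g x) S"
proof (induction k arbitrary: f g)
  case 0
  then show ?case by (simp add: continuous_on_add)
next
  case (Suc k)
  show ?case
    by (rule Ck_on_SucI[where D = "\<lambda>x v. frechet_derivative f (at x) v + frechet_derivative g (at x) v"])
      (use Suc Ck_on_SucD_has_derivative in \<open>auto intro!: has_derivative_add simp: frechet_derivative_works\<close>)
qed

lemma Ck_on_sum: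
  "open S \<Longrightarrow> (\<And>i. i \<in> I \<Longrightarrow> Ck_on k (f i) S) \<Longrightarrow> Ck_on k (\<lambda>x. \<Sum>i\<in>I. f i x) S"
  by (induction I rule: infinite_finite_induct) (auto intro: Ck_on_const Ck_on_add)

lemma Ck_on_linear_compose:
  "open S \<Longrightarrow> bounded_linear L \<Longrightarrow> Ck_on k f S \<Longrightarrow> Ck_on k (\<lambda>x. L (f x)) S"
proof (induction k arbitrary: f)
  case 0
  then show ?case unfolding Ck_on.simps by (blast intro: bounded_linear.continuous_on)
next
  case (Suc k)
  show ?case
    by (rule Ck_on_SucI[where D = "\<lambda>x v. L (frechet_derivative f (at x) v)"])
      (use Suc Ck_on_SucD_has_derivative[OF Suc.prems(3)] in
        \<open>auto simp: bounded_linear.has_derivative[OF Suc.prems(2)]\<close>)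
qed

lemma Ck_on_scaleR:
  fixes f :: "'a::euclidean_space \<Rightarrow> real" and g :: "'a \<Rightarrow> 'b::euclidean_space"
  shows "open S \<Longrightarrow> Ck_on k f S \<Longrightarrow> Ck_on k g S \<Longrightarrow> Ck_on k (\<lambda>x. f x *\<^sub>R g x) S"
proof (induction k arbitrary: f g)
  case 0
  then show ?case by (simp add: continuous_on_scaleR)
next
  case (Suc k)
  note fg = Suc.prems(2,3)[THEN Ck_on_SucD]
  show ?case
  proof (rule Ck_on_SucI)
    show "((\<lambda>x. f x *\<^sub>R g x) has_derivative
        (\<lambda>v. f x *\<^sub>R frechet_derivative g (at x) v + frechet_derivative f (at x) v *\<^sub>R g x)) (at x)"
      if "x \<in> S" for x
      using that Suc.prems by (auto intro!: has_derivative_scaleR simp: frechet_derivative_works)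
    show "Ck_on k (\<lambda>x. f x *\<^sub>R frechet_derivative g (at x) v + frechet_derivative f (at x) v *\<^sub>R g x) S" for v
      using Suc fg by (intro Ck_on_add Suc.IH) (auto simp del: Ck_on.simps(2), auto)
  qed fact
qed

lemma linear_eq_sum_Basis:
  assumes "linear f"
  shows "f v = (\<Sum>b\<in>Basis. (v \<bullet> b) *\<^sub>R f b)"
proof -
  have "f v = f (\<Sum>b\<in>Basis. (v \<bullet> b) *\<^sub>R b)" by (simp only: euclidean_representation)
  then show ?thesis by (simp only: linear_sum[OF assms] linear_cmul[OF assms])
qed

text \<open>The derivative \<open>Dg (f x) (Df x v)\<close> depends on \<open>x\<close> through the
  linear map and through its argument. Expanding the argument in \<open>Basis\<close> gives a sum of
  products of functions of class \<open>k\<close>; the factors \<open>Dg (f x) b\<close> fall under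
  the induction hypothesis, which is why \<open>g\<close> is generalized.\<close>

lemma Ck_on_compose:
  assumes "open S" "open T" "f ` S \<subseteq> T" "Ck_on k f S" "Ck_on k g T"
  shows "Ck_on k (\<lambda>x. g (f x)) S"
  using assms(4,5)
proof (induction k arbitrary: g)
  case 0
  then show ?case using continuous_on_compose2[OF _ _ assms(3)] by auto
next
  case (Suc k)
  have fT: "f x \<in> T" if "x \<in> S" for x using that assms(3) by auto
  have lin: "linear (frechet_derivative g (at (f x)))" if "x \<in> S" for x
    using Suc.prems(2) fT[OF that] by (auto intro!: linear_frechet_derivative)
  show ?case
  proof (rule Ck_on_SucI)
    show "((\<lambda>x. g (f x)) has_derivative
        (\<lambda>v. frechet_derivative g (at (f x)) (frechet_derivative f (at x) v))) (at x)" if "x \<in> S" for x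
      using diff_chain_at[OF Ck_on_SucD_has_derivative[OF Suc.prems(1) that]
          Ck_on_SucD_has_derivative[OF Suc.prems(2) fT[OF that]]]
      by (simp add: o_def)
    fix v
    have "Ck_on k (\<lambda>x. \<Sum>b\<in>Basis. (frechet_derivative f (at x) v \<bullet> b) *\<^sub>R frechet_derivative g (at (f x)) b) S"
    proof (rule Ck_on_sum[OF assms(1)], rule Ck_on_scaleR[OF assms(1)])
      have "Ck_on k (\<lambda>x. frechet_derivative f (at x) v) S" using Suc.prems(1) by simp
      then show "Ck_on k (\<lambda>x. frechet_derivative f (at x) v \<bullet> b) S" for b
        by (rule Ck_on_linear_compose[OF assms(1) bounded_linear_inner_left])
      show "Ck_on k (\<lambda>x. frechet_derivative g (at (f x)) b) S" for b
        using Suc.prems(2) by (intro Suc.IH Ck_on_SucD[OF Suc.prems(1)]) simp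
    qed
    then show "Ck_on k (\<lambda>x. frechet_derivative g (at (f x)) (frechet_derivative f (at x) v)) S"
      by (subst Ck_on_cong[OF assms(1)]) (simp_all only: linear_eq_sum_Basis[OF lin, symmetric])
  qed fact
qed

lemma Ck_on_Pair:
  assumes "open S" "Ck_on k f S" "Ck_on k g S"
  shows "Ck_on k (\<lambda>x. (f x, g x)) S"
proof -
  have "Ck_on k (\<lambda>x. (f x, 0) + (0, g x)) S"
    using assms by (intro Ck_on_add Ck_on_linear_compose[where L = "\<lambda>u. (u, 0)"]
        Ck_on_linear_compose[where L = "\<lambda>u. (0, u)"] bounded_linear_Pair) auto
  then show ?thesis by simp
qed

section \<open>Smooth maps on arbitrary subsets\<close>

lemma smooth_onE:
  assumes "smooth_on f S" "x \<in> S"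
  obtains V g where "open V" "x \<in> V" "\<And>k. Ck_on k g V" "\<And>y. y \<in> V \<Longrightarrow> y \<in> S \<Longrightarrow> g y = f y"
proof -
  from assms have "\<exists>V g. open V \<and> x \<in> V \<and> (\<forall>k. Ck_on k g V) \<and> (\<forall>y\<in>V \<inter> S. g y = f y)"
    unfolding smooth_on_def by (rule bspec)
  then obtain V g where *: "open V" "x \<in> V" "\<forall>k. Ck_on k g V" "\<forall>y\<in>V \<inter> S. g y = f y"
    by (elim exE conjE)
  show ?thesis by (rule that[of V g]) (use * in simp_all)
qed

lemma smooth_onI:
  assumes "\<And>x. x \<in> S \<Longrightarrow>
    \<exists>V g. open V \<and> x \<in> V \<and> (\<forall>k. Ck_on k g V) \<and> (\<forall>y\<in>V \<inter> S. g y = f y)"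
  shows "smooth_on f S"
  unfolding smooth_on_def by (rule ballI) (rule assms)

lemma smooth_onI_open: "open S \<Longrightarrow> (\<And>k. Ck_on k f S) \<Longrightarrow> smooth_on f S"
  by (rule smooth_onI) blast

lemma smooth_on_subset:
  assumes "smooth_on f S" "T \<subseteq> S"
  shows "smooth_on f T"
proof (rule smooth_onI)
  fix x assume "x \<in> T"
  then obtain V g where "open V" "x \<in> V" "\<And>k. Ck_on k g V" "\<And>y. y \<in> V \<Longrightarrow> y \<in> S \<Longrightarrow> g y = f y"
    using smooth_onE[OF assms(1)] assms(2) by blast
  then show "\<exists>V g. open V \<and> x \<in> V \<and> (\<forall>k. Ck_on k g V) \<and> (\<forall>y\<in>V \<inter> T. g y = f y)"
    using assms(2) by blast
qed

lemma smooth_on_cong: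
  assumes "smooth_on f S" "\<And>x. x \<in> S \<Longrightarrow> g x = f x"
  shows "smooth_on g S"
proof (rule smooth_onI)
  fix x assume "x \<in> S"
  then obtain V h where "open V" "x \<in> V" "\<And>k. Ck_on k h V" "\<And>y. y \<in> V \<Longrightarrow> y \<in> S \<Longrightarrow> h y = f y"
    using smooth_onE[OF assms(1)] by blast
  then show "\<exists>V h. open V \<and> x \<in> V \<and> (\<forall>k. Ck_on k h V) \<and> (\<forall>y\<in>V \<inter> S. h y = g y)"
    using assms(2) by (intro exI[of _ V] exI[of _ h]) simp
qed

lemma smooth_on_local:
  assumes "\<And>x. x \<in> S \<Longrightarrow> \<exists>T. openin (top_of_set S) T \<and> x \<in> T \<and> smooth_on f T"
  shows "smooth_on f S"
proof (rule smooth_onI)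
  fix x assume x: "x \<in> S"
  obtain T where T: "openin (top_of_set S) T" "x \<in> T" "smooth_on f T"
    using assms[OF x] by blast
  obtain W where W: "open W" "T = S \<inter> W" using T(1) by (auto simp: openin_open)
  obtain V g where "open V" "x \<in> V" "\<And>k. Ck_on k g V" "\<And>y. y \<in> V \<Longrightarrow> y \<in> T \<Longrightarrow> g y = f y"
    using smooth_onE[OF T(3,2)] by blast
  then show "\<exists>V g. open V \<and> x \<in> V \<and> (\<forall>k. Ck_on k g V) \<and> (\<forall>y\<in>V \<inter> S. g y = f y)"
    using W T by (intro exI[of _ "V \<inter> W"] exI[of _ g]) (auto intro: Ck_on_mono)
qed

lemma smooth_on_compose:
  assumes "smooth_on f S" "smooth_on g T" "f ` S \<subseteq> T"
  shows "smooth_on (\<lambda>x. g (f x)) S"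
proof (rule smooth_onI)
  fix x assume x: "x \<in> S"
  obtain V f' where f: "open V" "x \<in> V" "\<And>k. Ck_on k f' V" "\<And>y. y \<in> V \<inter> S \<Longrightarrow> f' y = f y"
    using smooth_onE[OF assms(1) x] by (metis Int_iff)
  obtain W g' where g: "open W" "f x \<in> W" "\<And>k. Ck_on k g' W" "\<And>y. y \<in> W \<inter> T \<Longrightarrow> g' y = g y"
    using smooth_onE[OF assms(2), of "f x"] assms(3) x by (metis Int_iff image_subset_iff)
  have op: "open (V \<inter> f' -` W)"
    using Ck_on_imp_continuous_on[OF f(3)] f(1) g(1) continuous_on_open_vimage by (metis inf_commute)
  show "\<exists>V h. open V \<and> x \<in> V \<and> (\<forall>k. Ck_on k h V) \<and> (\<forall>y\<in>V \<inter> S. h y = g (f y))"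
  proof (intro exI conjI allI ballI)
    show "Ck_on k (\<lambda>x. g' (f' x)) (V \<inter> f' -` W)" for k
      by (rule Ck_on_compose[OF op g(1)]) (auto intro: Ck_on_mono[OF f(3)] g(3))
    show "x \<in> V \<inter> f' -` W" using f x g by auto
    show "g' (f' y) = g (f y)" if "y \<in> V \<inter> f' -` W \<inter> S" for y
      using that f(4)[of y] g(4)[of "f y"] assms(3) by auto
  qed fact
qed

lemma smooth_on_Pair:
  assumes "smooth_on f S" "smooth_on g S"
  shows "smooth_on (\<lambda>x. (f x, g x)) S"
proof (rule smooth_onI)
  fix x assume x: "x \<in> S"
  obtain V f' where f: "open V" "x \<in> V" "\<And>k. Ck_on k f' V" "\<And>y. y \<in> V \<inter> S \<Longrightarrow> f' y = f y"
    using smooth_onE[OF assms(1) x] by (metis Int_iff)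
  obtain W g' where g: "open W" "x \<in> W" "\<And>k. Ck_on k g' W" "\<And>y. y \<in> W \<inter> S \<Longrightarrow> g' y = g y"
    using smooth_onE[OF assms(2) x] by (metis Int_iff)
  show "\<exists>V h. open V \<and> x \<in> V \<and> (\<forall>k. Ck_on k h V) \<and> (\<forall>y\<in>V \<inter> S. h y = (f y, g y))"
    using f g by (intro exI[of _ "V \<inter> W"] exI[of _ "\<lambda>x. (f' x, g' x)"])
      (auto intro!: Ck_on_Pair intro: Ck_on_mono)
qed

lemma smooth_on_linear: "linear f \<Longrightarrow> smooth_on f S"
  for f :: "'a::euclidean_space \<Rightarrow> 'b::euclidean_space"
  by (rule smooth_on_subset[OF smooth_onI_open[OF open_UNIV]])
    (auto intro: Ck_on_linear simp: linear_linear)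

lemma smooth_on_const: "smooth_on (\<lambda>x. c) S"
  by (rule smooth_on_subset[OF smooth_onI_open[OF open_UNIV]]) (auto intro: Ck_on_const)

lemma smooth_on_add:
  assumes "smooth_on f S" "smooth_on g S"
  shows "smooth_on (\<lambda>x. f x + g x) S"
  by (rule smooth_on_compose[OF smooth_on_Pair[OF assms] smooth_on_linear[of "\<lambda>p. fst p + snd p" UNIV], simplified])
    (auto intro!: linearI simp: algebra_simps)

lemma smooth_on_linear_compose:
  fixes L :: "'b::euclidean_space \<Rightarrow> 'c::euclidean_space"
  shows "smooth_on f S \<Longrightarrow> linear L \<Longrightarrow> smooth_on (\<lambda>x. L (f x)) S"
  using smooth_on_compose[OF _ smooth_on_linear[of L UNIV]] by auto

lemma smooth_on_compose_linear:
  fixes L :: "'b::euclidean_space \<Rightarrow> 'c::euclidean_space"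
  shows "smooth_on f S \<Longrightarrow> linear L \<Longrightarrow> L ` T \<subseteq> S \<Longrightarrow> smooth_on (\<lambda>x. f (L x)) T"
  using smooth_on_compose[OF smooth_on_linear[of L T]] by auto

lemma smooth_on_imp_continuous_on:
  assumes "smooth_on f S"
  shows "continuous_on S f"
  unfolding continuous_on_eq_continuous_within
proof
  fix x assume x: "x \<in> S"
  obtain V g where g: "open V" "x \<in> V" "\<And>k. Ck_on k g V" "\<And>y. y \<in> V \<inter> S \<Longrightarrow> g y = f y"
    using smooth_onE[OF assms x] by (metis Int_iff)
  have "continuous (at x within S) g"
    using Ck_on_imp_continuous_on[OF g(3)] g(1,2) continuous_at_imp_continuous_within continuous_on_eq_continuous_at by blast
  then show "continuous (at x within S) f"
    using g x by (smt (verit) IntI continuous_transform_within_openin openin_open_Int continuous_within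
        Lim_transform_within_open Int_iff)
qed

lemma smooth_on_imp_has_derivative:
  assumes "smooth_on f S" "x \<in> S"
  shows "\<exists>D. (f has_derivative D) (at x within S)"
proof -
  obtain V g where g: "open V" "x \<in> V" "\<And>k. Ck_on k g V" "\<And>y. y \<in> V \<inter> S \<Longrightarrow> g y = f y"
    using smooth_onE[OF assms] by (metis Int_iff)
  have "(g has_derivative frechet_derivative g (at x)) (at x within S)"
    using Ck_on_SucD_has_derivative[OF g(3) g(2)] has_derivative_at_withinI by blast
  moreover obtain e where e: "e > 0" "ball x e \<subseteq> V" using openE[OF g(1,2)] by blast
  moreover have "g y = f y" if "y \<in> S" "dist y x < e" for y
    using g(4)[of y] e that by (auto simp: dist_commute subset_iff)
  ultimately have "(f has_derivative frechet_derivative g (at x)) (at x within S)"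
    using has_derivative_transform_within[of g _ x S e f] assms(2) by blast
  then show ?thesis by blast
qed

text \<open>On an open set each local extension agrees with \<open>f\<close> on a neighbourhood, and
  \<open>Ck_on\<close> is a local property. Locality is proved for an arbitrary \<open>h\<close>,
  since the induction passes from a map to its directional derivatives.\<close>

lemma smooth_on_open_imp_Ck_on:
  assumes "smooth_on f S" "open S"
  shows "Ck_on k f S"
proof -
  have loc: "\<exists>V. open V \<and> x \<in> V \<and> V \<subseteq> S \<and> (\<forall>k. Ck_on k f V)" if x: "x \<in> S" for x
  proof -
    obtain V g where g: "open V" "x \<in> V" "\<And>k. Ck_on k g V" "\<And>y. y \<in> V \<inter> S \<Longrightarrow> g y = f y"
      using smooth_onE[OF assms(1) x] by (metis Int_iff)
    then have "Ck_on k f (V \<inter> S)" for k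
      using Ck_on_cong[of "V \<inter> S" g f k] assms(2) by (auto intro: Ck_on_mono)
    then show ?thesis using g assms(2) x by (intro exI[of _ "V \<inter> S"]) auto
  qed
  have "Ck_on k h S" if "\<And>x. x \<in> S \<Longrightarrow> \<exists>V. open V \<and> x \<in> V \<and> V \<subseteq> S \<and> (\<forall>k. Ck_on k h V)" for h
    using that
  proof (induction k arbitrary: h)
    case 0
    then show ?case
      by (simp, meson continuous_on_eq_continuous_at continuous_at_imp_continuous_on Ck_on_imp_continuous_on)
  next
    case (Suc k)
    have d: "h differentiable at x" if "x \<in> S" for x
      using Suc.prems[OF that] by (metis Ck_on.simps(2))
    have "Ck_on k (\<lambda>x. frechet_derivative h (at x) v) S" for v
      using Suc.prems by (intro Suc.IH) (metis Ck_on.simps(2))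
    with d show ?case by simp
  qed
  then show ?thesis using loc by blast
qed

section \<open>The inverse function theorem\<close>

text \<open>Where the scalar factor vanishes, the product is differentiable although the other
  factor is only continuous. This will produce the derivative of a family of inverse maps from its
  continuity.\<close>

lemma has_derivative_scaleR_vanishing:
  fixes r :: "'a::real_normed_vector \<Rightarrow> real" and b :: "'a \<Rightarrow> 'b::real_normed_vector"
  assumes r: "(r has_derivative r') (at x)" and [simp]: "r x = 0" and b: "continuous (at x) b"
  shows "((\<lambda>y. r y *\<^sub>R b y) has_derivative (\<lambda>h. r' h *\<^sub>R b x)) (at x)"
proof -
  have bl: "bounded_linear r'" using r by (rule has_derivative_bounded_linear)
  obtain K where K: "\<And>h. norm (r' h) \<le> norm h * K" using bounded_linear.bounded[OF bl] by blast
  have bt: "(b \<longlongrightarrow> b x) (at x)" using b by (simp add: continuous_at)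
  let ?e = "\<lambda>y. norm ((r y - r x) - r' (y - x)) / norm (y - x)"
  have "((\<lambda>y. ?e y * norm (b y) + K * norm (b y - b x)) \<longlongrightarrow> 0 * norm (b x) + K * norm (b x - b x)) (at x)"
    using r bt by (intro tendsto_intros) (auto simp: has_derivative_iff_norm)
  then have lim: "((\<lambda>y. ?e y * norm (b y) + K * norm (b y - b x)) \<longlongrightarrow> 0) (at x)" by simp
  have "norm ((r y *\<^sub>R b y - r x *\<^sub>R b x) - r' (y - x) *\<^sub>R b x) / norm (y - x)
      \<le> ?e y * norm (b y) + K * norm (b y - b x)" if "y \<noteq> x" for y
  proof -
    have "(r y *\<^sub>R b y - r x *\<^sub>R b x) - r' (y - x) *\<^sub>R b x
        = (r y - r x - r' (y - x)) *\<^sub>R b y + r' (y - x) *\<^sub>R (b y - b x)"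
      by (simp add: algebra_simps)
    then have "norm ((r y *\<^sub>R b y - r x *\<^sub>R b x) - r' (y - x) *\<^sub>R b x)
        \<le> norm (r y - r x - r' (y - x)) * norm (b y) + norm (r' (y - x)) * norm (b y - b x)"
      using norm_triangle_ineq[of "(r y - r x - r' (y - x)) *\<^sub>R b y" "r' (y - x) *\<^sub>R (b y - b x)"] by simp
    also have "\<dots> \<le> norm (r y - r x - r' (y - x)) * norm (b y) + (norm (y - x) * K) * norm (b y - b x)"
      using K[of "y - x"] by (intro add_left_mono mult_right_mono) auto
    finally show ?thesis using that by (simp add: field_simps)
  qed
  then have "((\<lambda>y. norm ((r y *\<^sub>R b y - r x *\<^sub>R b x) - r' (y - x) *\<^sub>R b x) / norm (y - x)) \<longlongrightarrow> 0) (at x)"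
    by (intro tendsto_sandwich[OF _ _ tendsto_const lim]) (auto simp: eventually_at_filter)
  then show ?thesis
    using bounded_linear_compose[OF bounded_linear_scaleR_left bl] by (simp add: has_derivative_iff_norm)
qed

text \<open>Inversion of linear maps is smooth. The uniform bound on the inverses first gives
  continuity; then the derivative is \<open>- B A' B\<close>, which is of class \<open>k\<close> as
  soon as \<open>A'\<close> and \<open>B\<close> are, so each induction step gains one
  order.\<close>

lemma Ck_on_inverse_family:
  fixes A B :: "'x::euclidean_space \<Rightarrow> 'a::euclidean_space \<Rightarrow> 'a"
  assumes V: "open V" and linB: "\<And>y. y \<in> V \<Longrightarrow> linear (B y)" and linA: "\<And>y. y \<in> V \<Longrightarrow> linear (A y)"
    and AB: "\<And>y w. y \<in> V \<Longrightarrow> A y (B y w) = w" and BA: "\<And>y w. y \<in> V \<Longrightarrow> B y (A y w) = w"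
    and bound: "\<And>y w. y \<in> V \<Longrightarrow> norm (B y w) \<le> C * norm w"
    and A: "\<And>c. Ck_on k (\<lambda>y. A y c) V"
  shows "Ck_on k (\<lambda>y. B y w) V"
  using A
proof (induction k arbitrary: w)
  case 0
  have "((\<lambda>y. B y w) \<longlongrightarrow> B y0 w) (at y0)" if y0: "y0 \<in> V" for y0
  proof -
    let ?u = "B y0 w"
    have "((\<lambda>y. A y ?u) \<longlongrightarrow> A y0 ?u) (at y0)"
      using 0 y0 V by (simp add: continuous_on_eq_continuous_at continuous_at)
    then have "((\<lambda>y. C * norm (A y ?u - A y0 ?u)) \<longlongrightarrow> C * norm (A y0 ?u - A y0 ?u)) (at y0)"
      by (intro tendsto_intros)
    then have lim: "((\<lambda>y. C * norm (A y ?u - A y0 ?u)) \<longlongrightarrow> 0) (at y0)" by simp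
    have "norm (B y w - ?u) \<le> C * norm (A y ?u - A y0 ?u)" if "y \<in> V" for y
    proof -
      \<comment> \<open>Since \<open>A y0 ?u = w\<close>, the change of the inverse is controlled by
        the change of \<open>A\<close> on the single vector \<open>?u\<close>.\<close>
      have "B y (w - A y ?u) = B y w - ?u" using that BA by (simp add: linear_diff[OF linB[OF that]])
      then show ?thesis using bound[OF that, of "w - A y ?u"] AB[OF y0] by (simp add: norm_minus_commute)
    qed
    then have "\<forall>\<^sub>F y in at y0. norm (B y w - ?u) \<le> C * norm (A y ?u - A y0 ?u)"
      using eventually_at_topological V y0 by blast
    from Lim_null_comparison[OF this lim] show ?thesis by (simp add: LIM_zero_iff)
  qed
  then show ?case using V by (simp add: continuous_on_eq_continuous_at continuous_at)
next
  case (Suc k)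
  have IH: "Ck_on k (\<lambda>y. B y w) V" for w
    using Suc.prems by (intro Suc.IH) (rule Ck_on_SucD)
  have contB: "continuous (at y) (\<lambda>y. B y w)" if "y \<in> V" for y w
    using Ck_on_imp_continuous_on[OF IH] V that by (simp add: continuous_on_eq_continuous_at)
  define E where "E c y = frechet_derivative (\<lambda>y. A y c) (at y)" for c y
  have E: "((\<lambda>y. A y c) has_derivative E c y) (at y)" if "y \<in> V" for c y
    unfolding E_def by (rule Ck_on_SucD_has_derivative[OF Suc.prems that])
  \<comment> \<open>The vector \<open>- B y (A' (B y w))\<close> in coordinates, where
    \<open>A'\<close> is the derivative of the family \<open>A\<close> in the direction
    \<open>h\<close>.\<close>
  define D where "D y h = - (\<Sum>b\<in>Basis. (\<Sum>c\<in>Basis. (B y w \<bullet> c) *\<^sub>R (E c y h \<bullet> b)) *\<^sub>R B y b)" for y h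
  show ?case
  proof (rule Ck_on_SucI[OF V])
    fix y0 assume y0: "y0 \<in> V"
    let ?u = "B y0 w"
    \<comment> \<open>As \<open>A y ?u - w\<close> vanishes at \<open>y0\<close>, its products with
      \<open>B y b\<close> can be differentiated knowing only that \<open>B\<close> is
      continuous.\<close>
    have eq: "B y w = ?u - (\<Sum>b\<in>Basis. ((A y ?u - w) \<bullet> b) *\<^sub>R B y b)" if "y \<in> V" for y
      using linear_eq_sum_Basis[OF linB[OF that], of "A y ?u - w"] BA[OF that]
      by (simp add: linear_diff[OF linB[OF that]] diff_eq_eq eq_diff_eq add.commute)
    have A_eq: "A y ?u = (\<Sum>c\<in>Basis. (?u \<bullet> c) *\<^sub>R A y c)" if "y \<in> V" for y
      by (rule linear_eq_sum_Basis[OF linA[OF that]])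
    have "((\<lambda>y. \<Sum>c\<in>Basis. (?u \<bullet> c) *\<^sub>R A y c) has_derivative (\<lambda>h. \<Sum>c\<in>Basis. (?u \<bullet> c) *\<^sub>R E c y0 h)) (at y0)"
      by (intro has_derivative_sum has_derivative_scaleR_right E y0)
    then have dA: "((\<lambda>y. A y ?u) has_derivative (\<lambda>h. \<Sum>c\<in>Basis. (?u \<bullet> c) *\<^sub>R E c y0 h)) (at y0)"
      by (rule has_derivative_transform_within_open[OF _ V y0]) (rule A_eq[symmetric])
    have dAb: "((\<lambda>y. (A y ?u - w) \<bullet> b) has_derivative (\<lambda>h. \<Sum>c\<in>Basis. (?u \<bullet> c) *\<^sub>R (E c y0 h \<bullet> b))) (at y0)" for b
      using has_derivative_inner_left[OF has_derivative_diff[OF dA has_derivative_const[of w]], of b]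
      by (simp add: inner_sum_left)
    have "((\<lambda>y. ((A y ?u - w) \<bullet> b) *\<^sub>R B y b) has_derivative
        (\<lambda>h. (\<Sum>c\<in>Basis. (?u \<bullet> c) *\<^sub>R (E c y0 h \<bullet> b)) *\<^sub>R B y0 b)) (at y0)" for b
      by (rule has_derivative_scaleR_vanishing[OF dAb _ contB[OF y0]]) (simp add: AB[OF y0])
    from has_derivative_diff[OF has_derivative_const[of ?u] has_derivative_sum[of Basis, OF this]]
    have "((\<lambda>y. ?u - (\<Sum>b\<in>Basis. ((A y ?u - w) \<bullet> b) *\<^sub>R B y b)) has_derivative D y0) (at y0)"
      by (simp add: D_def[abs_def])
    then show "((\<lambda>y. B y w) has_derivative D y0) (at y0)"
      by (rule has_derivative_transform_within_open[OF _ V y0]) (rule eq[symmetric])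
  next
    fix h
    have "Ck_on k (\<lambda>y. E c y h) V" for c
      using Suc.prems[of c] by (simp add: E_def)
    then have "Ck_on k (\<lambda>y. (B y w \<bullet> c) *\<^sub>R (E c y h \<bullet> b)) V" for b c
      using Ck_on_linear_compose[OF V bounded_linear_inner_left] IH
      by (intro Ck_on_scaleR[OF V]) auto
    then have "Ck_on k (\<lambda>y. (\<Sum>c\<in>Basis. (B y w \<bullet> c) *\<^sub>R (E c y h \<bullet> b)) *\<^sub>R B y b) V" for b
      by (intro Ck_on_scaleR[OF V _ IH] Ck_on_sum[OF V])
    then have "Ck_on k (\<lambda>y. \<Sum>b\<in>Basis. (\<Sum>c\<in>Basis. (B y w \<bullet> c) *\<^sub>R (E c y h \<bullet> b)) *\<^sub>R B y b) V"
      by (intro Ck_on_sum[OF V])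
    from Ck_on_linear_compose[OF V bounded_linear_minus[OF bounded_linear_ident] this]
    show "Ck_on k (\<lambda>y. D y h) V" by (simp add: D_def)
  qed
qed

text \<open>The theorem \<open>inverse_function_theorem\<close> gives a differentiable inverse
  \<open>g\<close> whose derivative \<open>G y\<close> inverts \<open>F (g y)\<close>. If
  \<open>g\<close> is of class \<open>k\<close>, so is \<open>F\<close> along \<open>g\<close>,
  hence so is the family \<open>G\<close> of inverses, hence \<open>g\<close> is of class
  \<open>k + 1\<close>. The estimates beforehand supply the uniform bound on
  \<open>G\<close>.\<close>

lemma smooth_inverse_function:
  fixes f :: "'a::euclidean_space \<Rightarrow> 'a"
  assumes S: "open S" "z \<in> S" and f: "\<And>k. Ck_on k f S"
    and D: "(f has_derivative D) (at z)" "inj D"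
  obtains U V g where "open U" "z \<in> U" "U \<subseteq> S" "open V" "f z \<in> V" "homeomorphism U V f g"
    "\<And>k. Ck_on k g V"
proof -
  define F where "F x = frechet_derivative f (at x)" for x
  have F: "(f has_derivative F x) (at x)" if "x \<in> S" for x
    unfolding F_def by (rule Ck_on_SucD_has_derivative[OF f that])
  have blF: "bounded_linear (F x)" if "x \<in> S" for x using F[OF that] by (rule has_derivative_bounded_linear)
  define f' where "f' x = Blinfun (F x)" for x
  have f'[simp]: "blinfun_apply (f' x) = F x" if "x \<in> S" for x
    using blF[OF that] by (simp add: f'_def bounded_linear_Blinfun_apply)
  have CkF: "Ck_on k (\<lambda>x. F x v) S" for k v
    using f[of "Suc k"] by (simp add: F_def)
  have contf': "continuous_on S f'"
    by (rule continuous_on_blinfun_componentwise)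
      (use Ck_on_imp_continuous_on[OF CkF[of 0]] in \<open>simp cong: continuous_on_cong\<close>)
  have Dz: "F z = D" using has_derivative_unique[OF F[OF S(2)] D(1)] .
  have "linear D" using D(1) has_derivative_linear by blast
  then obtain B where B: "B > 0" "\<And>x. norm x * B \<le> norm (D x)"
    using linear_inj_bounded_below_pos[OF _ D(2)] by (metis mult.commute)
  obtain d1 where d1: "d1 > 0" "ball z d1 \<subseteq> S" using openE[OF S] by blast
  \<comment> \<open>Staying within \<open>B / 2\<close> of the derivative at \<open>z\<close> costs
    half of the lower bound \<open>B\<close>; the other half survives on the whole ball.\<close>
  obtain d2 where d2: "d2 > 0" "\<And>x. x \<in> S \<Longrightarrow> dist x z < d2 \<Longrightarrow> dist (f' x) (f' z) < B / 2"
    using contf' S(2) B(1) unfolding continuous_on_iff by (metis half_gt_zero)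
  define S0 where "S0 = ball z (min d1 d2)"
  have S0: "open S0" "z \<in> S0" "S0 \<subseteq> S" using d1 d2(1) by (auto simp: S0_def)
  have lower: "norm v * (B / 2) \<le> norm (F x v)" if "x \<in> S0" for x v
  proof -
    have x: "x \<in> S" "dist x z < d2" using that S0(3) by (auto simp: S0_def dist_commute)
    have "norm (F x v - F z v) = norm (blinfun_apply (f' x - f' z) v)"
      using x S(2) by (simp add: blinfun.diff_left)
    also have "\<dots> \<le> norm (f' x - f' z) * norm v" by (rule norm_blinfun)
    also have "\<dots> \<le> B / 2 * norm v"
      using d2(2)[OF x] by (intro mult_right_mono) (auto simp: dist_norm)
    finally have "norm (F x v - F z v) \<le> B / 2 * norm v" .
    moreover have "norm (F z v) \<le> norm (F x v - F z v) + norm (F x v)"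
      using norm_triangle_ineq4[of "F x v - F z v" "F x v"] by simp
    ultimately show ?thesis using B(2)[of v] Dz by (simp add: algebra_simps)
  qed
  have "\<exists>g'. linear g' \<and> g' \<circ> D = id"
    using linear_injective_left_inverse[OF \<open>linear D\<close> D(2)] .
  then obtain g' where g': "linear g'" "g' \<circ> D = id" by blast
  have inv: "Blinfun g' o\<^sub>L f' z = id_blinfun"
    using g' Dz S(2) by (intro blinfun_eqI) (simp add: bounded_linear_Blinfun_apply linear_linear pointfree_idE)
  have derf: "(f has_derivative blinfun_apply (f' x)) (at x)" if "x \<in> S0" for x
    using F[of x] S0(3) that by auto
  obtain U V g G where UV: "open U" "U \<subseteq> S0" "z \<in> U" "open V" "f z \<in> V" "homeomorphism U V f g"
    and G: "\<And>y. y \<in> V \<Longrightarrow> (g has_derivative (G y)) (at y)"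
    "\<And>y. y \<in> V \<Longrightarrow> G y = Hilbert_Choice.inv (blinfun_apply (f'(g y)))"
    "\<And>y. y \<in> V \<Longrightarrow> bij (blinfun_apply (f'(g y)))"
    using inverse_function_theorem[OF S0(1) derf continuous_on_subset[OF contf' S0(3)] S0(2) inv]
    by blast
  have gU: "g y \<in> U" "g y \<in> S0" "g y \<in> S" if "y \<in> V" for y
    using UV(2,6) that S0(3) by (auto simp: homeomorphism_def)
  have FG: "F (g y) (G y w) = w" if "y \<in> V" for y w
    using G(2,3)[OF that] gU[OF that] by (simp add: bij_is_surj surj_f_inv_f)
  have GF: "G y (F (g y) w) = w" if "y \<in> V" for y w
    using G(2,3)[OF that] gU[OF that] by (simp add: bij_is_inj)
  have bound: "norm (G y w) \<le> (2 / B) * norm w" if "y \<in> V" for y w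
    using lower[OF gU(2)[OF that], of "G y w"] FG[OF that] B(1) by (simp add: field_simps)
  have "Ck_on k g V" for k
  proof (induction k)
    case 0
    then show ?case using UV(6) by (simp add: homeomorphism_def)
  next
    case (Suc k)
    have "Ck_on k (\<lambda>y. F (g y) c) V" for c
      using gU(3) by (intro Ck_on_compose[OF UV(4) S(1) _ Suc CkF]) auto
    moreover have "linear (G y)" if "y \<in> V" for y using G(1)[OF that] by (rule has_derivative_linear)
    moreover have "linear (F (g y))" if "y \<in> V" for y
      using F[OF gU(3)[OF that]] by (rule has_derivative_linear)
    ultimately have "Ck_on k (\<lambda>y. G y w) V" for w
      using Ck_on_inverse_family[OF UV(4), of G "\<lambda>y. F (g y)", OF _ _ FG GF bound] by blast
    then show ?case by (intro Ck_on_SucI[OF UV(4) G(1)])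
  qed
  then show ?thesis using that UV S0(3) by blast
qed

section \<open>Derivatives and inverse functions within linear subspaces\<close>

lemma at_within_openin:
  assumes "openin (top_of_set E) S" "z \<in> S"
  shows "at z within S = at z within E"
proof -
  obtain W where W: "open W" "S = E \<inter> W" using assms(1) by (auto simp: openin_open)
  show ?thesis by (rule at_within_nhd[OF _ W(1)]) (use W(2) assms(2) in auto)
qed

text \<open>A right inverse \<open>R\<close> of \<open>K\<close> has a range of full dimension in
  \<open>F\<close>, so it is onto \<open>F\<close> and inverts \<open>K\<close> from the left as
  well.\<close>

lemma linear_surj_on_imp_inj_on:
  fixes K :: "'a::euclidean_space \<Rightarrow> 'b::euclidean_space"
  assumes "linear K" "subspace F" "dim F \<le> dim (K ` F)"
  shows "inj_on K F"
proof -
  obtain R where R: "R ` UNIV \<subseteq> F" "linear R" "\<forall>v\<in>K ` F. K (R v) = v"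
    using linear_exists_right_inverse_on[OF assms(1,2)] by blast
  have sub: "subspace (K ` F)" using assms linear_subspace_image by blast
  have "inj_on R (K ` F)" using R(3) by (intro inj_on_inverseI[of _ K]) blast
  then have "dim (R ` (K ` F)) = dim (K ` F)"
    using R(2) sub by (intro dim_image_eq) (auto simp: span_eq_iff[THEN iffD2])
  moreover have "R ` (K ` F) \<subseteq> F" using R(1) by blast
  moreover have "subspace (R ` (K ` F))" using R(2) sub linear_subspace_image by blast
  ultimately have eq: "R ` (K ` F) = F" using assms(2,3) by (metis subspace_dim_equal)
  show ?thesis
  proof (rule inj_on_inverseI)
    fix v assume "v \<in> F"
    then obtain w where "w \<in> K ` F" "v = R w" using eq by blast
    then show "R (K v) = v" using R(3) by metis
  qed
qed

lemma linear_inj_on_imp_image_eq: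
  fixes K :: "'a::euclidean_space \<Rightarrow> 'b::euclidean_space"
  assumes "linear K" "subspace E" "subspace F" "inj_on K E" "K ` E \<subseteq> F" "dim F \<le> dim E"
  shows "K ` E = F"
proof (rule subspace_dim_equal)
  show "dim F \<le> dim (K ` E)"
    using assms dim_image_eq[OF assms(1), of E] by (simp add: span_eq_iff[THEN iffD2])
qed (use assms linear_subspace_image in auto)

text \<open>A derivative within \<open>E\<close> is pinned down on \<open>E\<close> alone, by
  difference quotients along lines in \<open>E\<close>; its values off \<open>E\<close> carry no
  information.\<close>

lemma has_derivative_within_subspace_lim:
  fixes f :: "'a::euclidean_space \<Rightarrow> 'b::euclidean_space"
  assumes f: "(f has_derivative D) (at z within E)" and E: "subspace E" "z \<in> E" "v \<in> E"
  shows "((\<lambda>t. (f (z + t *\<^sub>R v) - f z) /\<^sub>R t) \<longlongrightarrow> D v) (at 0)"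
proof -
  have "((\<lambda>t. z + t *\<^sub>R v) has_derivative (\<lambda>t. t *\<^sub>R v)) (at 0)"
    by (auto intro!: derivative_eq_intros)
  moreover have "range (\<lambda>t. z + t *\<^sub>R v) \<subseteq> E" using E by (auto intro!: subspace_add subspace_scale)
  then have "(f has_derivative D) (at (z + 0 *\<^sub>R v) within range (\<lambda>t. z + t *\<^sub>R v))"
    using has_derivative_subset[OF f] by simp
  ultimately have "((\<lambda>t. f (z + t *\<^sub>R v)) has_derivative (\<lambda>t. D (t *\<^sub>R v))) (at 0)"
    using diff_chain_within[of "\<lambda>t. z + t *\<^sub>R v" _ 0 UNIV f D] by (simp add: o_def)
  then have "((\<lambda>t. norm ((f (z + t *\<^sub>R v) - f z) - t *\<^sub>R D v) / norm t) \<longlongrightarrow> 0) (at 0)"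
    using has_derivative_linear[OF f] by (simp add: has_derivative_iff_norm linear_cmul)
  then have "((\<lambda>t. norm ((f (z + t *\<^sub>R v) - f z) /\<^sub>R t - D v)) \<longlongrightarrow> 0) (at 0)"
  proof (rule Lim_transform_within[where d = 1])
    fix t :: real assume "0 < dist t 0"
    then have "(f (z + t *\<^sub>R v) - f z) /\<^sub>R t - D v = ((f (z + t *\<^sub>R v) - f z) - t *\<^sub>R D v) /\<^sub>R t"
      by (simp add: scaleR_diff_right)
    then show "norm ((f (z + t *\<^sub>R v) - f z) - t *\<^sub>R D v) / norm t = norm ((f (z + t *\<^sub>R v) - f z) /\<^sub>R t - D v)"
      by (simp add: divide_inverse mult.commute)
  qed simp
  then show ?thesis by (simp add: tendsto_norm_zero_iff LIM_zero_iff)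
qed

lemma has_derivative_within_subspace_unique:
  fixes f :: "'a::euclidean_space \<Rightarrow> 'b::euclidean_space"
  assumes "(f has_derivative D) (at z within E)" "(f has_derivative D') (at z within E)"
    "subspace E" "z \<in> E" "v \<in> E"
  shows "D v = D' v"
  using has_derivative_within_subspace_lim[OF assms(1,3-5)] has_derivative_within_subspace_lim[OF assms(2-5)]
  by (rule tendsto_unique[rotated]) simp

text \<open>Difference quotients along \<open>E\<close> lie in \<open>F\<close>, and a linear
  subspace is closed.\<close>

lemma has_derivative_within_subspace_image:
  fixes f :: "'a::euclidean_space \<Rightarrow> 'b::euclidean_space"
  assumes f: "(f has_derivative D) (at z within E)" and E: "subspace E" and F: "subspace F"
    and S: "openin (top_of_set E) S" "z \<in> S" "f ` S \<subseteq> F"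
  shows "D ` E \<subseteq> F"
proof
  fix w assume "w \<in> D ` E"
  then obtain v where v: "v \<in> E" "w = D v" by blast
  obtain W where W: "open W" "S = E \<inter> W" using S(1) by (auto simp: openin_open)
  have z: "z \<in> E" "z \<in> W" using S(2) W by auto
  have "((\<lambda>t. z + t *\<^sub>R v) \<longlongrightarrow> z + 0 *\<^sub>R v) (at 0)" by (intro tendsto_intros)
  then have "\<forall>\<^sub>F t in at 0. z + t *\<^sub>R v \<in> W"
    using W(1) z(2) topological_tendstoD by force
  then have "\<forall>\<^sub>F t in at 0. (f (z + t *\<^sub>R v) - f z) /\<^sub>R t \<in> F"
  proof (rule eventually_mono)
    fix t assume "z + t *\<^sub>R v \<in> W"
    then have "z + t *\<^sub>R v \<in> S" using W(2) z v(1) E by (simp add: subspace_add subspace_scale)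
    then have "f (z + t *\<^sub>R v) \<in> F" "f z \<in> F" using S(2,3) by auto
    then show "(f (z + t *\<^sub>R v) - f z) /\<^sub>R t \<in> F" using F by (simp add: subspace_diff subspace_scale)
  qed
  then have "D v \<in> F"
    by (rule Lim_in_closed_set[OF closed_subspace[OF F] _ at_neq_bot
          has_derivative_within_subspace_lim[OF f E z(1) v(1)]])
  then show "w \<in> F" using v by simp
qed

lemma linear_projection_exists:
  fixes E :: "'a::euclidean_space set"
  assumes "subspace E"
  obtains P where "linear P" "range P \<subseteq> E" "\<And>x. x \<in> E \<Longrightarrow> P x = x"
  using linear_exists_left_inverse_on[OF linear_id assms] by auto

text \<open>The full-dimensional theorem is applied to \<open>h x = T (f (P x)) + (x - P x)\<close>,
  where \<open>P\<close> projects onto \<open>E\<close> and \<open>T\<close> maps \<open>F\<close>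
  isomorphically onto \<open>E\<close>. This \<open>h\<close> extends \<open>T \<circ> f\<close> and
  adds the component off \<open>E\<close> unchanged, so it is a local diffeomorphism of the ambient
  space that respects \<open>E\<close>.\<close>

lemma smooth_inverse_function_subspace:
  fixes f :: "'a::euclidean_space \<Rightarrow> 'b::euclidean_space"
  assumes E: "subspace E" and F: "subspace F" and dim: "dim E = dim F"
    and S: "openin (top_of_set E) S" "z \<in> S" and f: "smooth_on f S" "f ` S \<subseteq> F"
    and D: "(f has_derivative D) (at z within E)" "inj_on D E"
  obtains U V g where "openin (top_of_set E) U" "z \<in> U" "U \<subseteq> S"
    "openin (top_of_set F) V" "f z \<in> V" "f ` U \<subseteq> V" "g ` V \<subseteq> U"
    "\<And>u. u \<in> U \<Longrightarrow> g (f u) = u" "\<And>v. v \<in> V \<Longrightarrow> f (g v) = v" "smooth_on g V"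
proof -
  obtain T T' where T: "linear T" "linear T'" "T ` F = E" "T' ` E = F" "\<And>y. y \<in> F \<Longrightarrow> T' (T y) = y"
    by (rule isometries_subspaces[OF F E dim[symmetric]]) blast
  obtain P where P: "linear P" "range P \<subseteq> E" "\<And>x. x \<in> E \<Longrightarrow> P x = x"
    by (rule linear_projection_exists[OF E]) blast
  have SE: "S \<subseteq> E" using S(1) openin_imp_subset by blast
  have z: "z \<in> E" "P z = z" using S(2) SE P(3) by auto
  have DF: "D ` E \<subseteq> F" by (rule has_derivative_within_subspace_image[OF D(1) E F S f(2)])
  have linD: "linear D" using D(1) by (rule has_derivative_linear)
  define h where "h x = T (f (P x)) + (x - P x)" for x
  define S' where "S' = P -` S"
  obtain W where W: "open W" "S = E \<inter> W" using S(1) by (auto simp: openin_open)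
  have "S' = P -` W" using P(2) W(2) by (auto simp: S'_def)
  then have S': "open S'"
    using W(1) P(1) by (metis continuous_open_vimage linear_continuous_at linear_linear)
  have "smooth_on (\<lambda>x. T (f (P x))) S'"
    by (rule smooth_on_linear_compose[OF smooth_on_compose_linear[OF f(1) P(1)] T(1)]) (auto simp: S'_def)
  moreover have "linear (\<lambda>x. x - P x)" using linear_compose_sub[OF linear_ident P(1)] by simp
  ultimately have "smooth_on h S'"
    unfolding h_def using smooth_on_add smooth_on_linear by blast
  then have Ck: "Ck_on k h S'" for k by (rule smooth_on_open_imp_Ck_on[OF _ S'])
  have "(f has_derivative D) (at (P z) within range P)"
    using D(1) P(2) z(2) by (metis has_derivative_subset)
  then have "((\<lambda>x. f (P x)) has_derivative (\<lambda>x. D (P x))) (at z)"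
    using diff_chain_within[of P P z UNIV f D] linear_imp_has_derivative[OF P(1)] by (simp add: o_def)
  then have dh: "(h has_derivative (\<lambda>v. T (D (P v)) + (v - P v))) (at z)"
    unfolding h_def using P(1) T(1)
    by (intro has_derivative_add has_derivative_diff has_derivative_ident linear_imp_has_derivative
          bounded_linear.has_derivative[of T]) (auto simp: linear_linear)
  have linh: "linear (\<lambda>v. T (D (P v)) + (v - P v))" using dh by (rule has_derivative_linear)
  \<comment> \<open>A kernel vector equals \<open>P v - T (D (P v))\<close> and hence lies in
    \<open>E\<close>, where the map is \<open>T \<circ> D\<close>.\<close>
  have "inj (\<lambda>v. T (D (P v)) + (v - P v))"
  proof (rule linear_injective_0[OF linh, THEN iffD2], intro allI impI)
    fix v assume v: "T (D (P v)) + (v - P v) = 0"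
    have Pv: "P v \<in> E" "D (P v) \<in> F" using P(2) DF by auto
    then have "T (D (P v)) \<in> E" using T(3) by auto
    then have "P v - T (D (P v)) \<in> E" using E Pv(1) by (simp add: subspace_diff)
    moreover have "v = P v - T (D (P v))" using v by (simp add: algebra_simps add_eq_0_iff)
    ultimately have vE: "v \<in> E" by simp
    then have "T (D v) = 0" "D v \<in> F" using v P(3) DF by auto
    then have "D v = 0" using T(5) linear_0[OF T(2)] by metis
    then show "v = 0" using D(2) vE linear_0[OF linD] subspace_0[OF E] by (metis inj_onD)
  qed
  then obtain U0 V0 g0 where UV: "open U0" "z \<in> U0" "U0 \<subseteq> S'" "open V0" "h z \<in> V0" "homeomorphism U0 V0 h g0"
    and Ckg: "\<And>k. Ck_on k g0 V0"
    using smooth_inverse_function[OF S' _ Ck dh] z S(2) by (auto simp: S'_def)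
  have g0: "h (g0 y) = y" "g0 y \<in> U0" if "y \<in> V0" for y using UV(6) that by (auto simp: homeomorphism_def)
  have h0: "g0 (h x) = x" "h x \<in> V0" if "x \<in> U0" for x using UV(6) that by (auto simp: homeomorphism_def)
  have hE: "h u = T (f u)" if "u \<in> E" for u using that P(3) by (simp add: h_def)
  define U where "U = E \<inter> U0"
  define V where "V = F \<inter> T -` V0"
  have US: "U \<subseteq> S" using UV(3) P(3) by (auto simp: U_def S'_def)
  \<comment> \<open>The ambient inverse does not leave \<open>E\<close>: solving
    \<open>h ?x = T y\<close> for \<open>?x\<close> exhibits it as a combination of vectors of
    \<open>E\<close>.\<close>
  have gU: "g0 (T y) \<in> U" "f (g0 (T y)) = y" if "y \<in> V" for y
  proof -
    have y: "y \<in> F" "T y \<in> V0" "T y \<in> E" using that T(3) by (auto simp: V_def)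
    let ?x = "g0 (T y)"
    have x: "?x \<in> U0" "h ?x = T y" using g0[OF y(2)] by auto
    then have "P ?x \<in> S" using UV(3) by (auto simp: S'_def)
    then have Px: "P ?x \<in> E" "T (f (P ?x)) \<in> E" using f(2) SE T(3) by auto
    have "?x = T y - T (f (P ?x)) + P ?x" using x(2) by (simp add: h_def algebra_simps)
    then have xE: "?x \<in> E" using Px y(3) E by (metis subspace_add subspace_diff)
    then show "?x \<in> U" using x by (simp add: U_def)
    then have "f ?x \<in> F" using US f(2) by auto
    moreover have "T (f ?x) = T y" using hE[OF xE] x(2) by simp
    ultimately show "f ?x = y" using T(5) y(1) by metis
  qed
  have fU: "f u \<in> V" "g0 (T (f u)) = u" if "u \<in> U" for u
    using that US f(2) h0[of u] hE[of u] by (auto simp: U_def V_def)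
  show ?thesis
  proof (rule that[of U V "\<lambda>y. g0 (T y)"])
    show "openin (top_of_set E) U" using UV(1) by (auto simp: U_def)
    have "open (T -` V0)"
      using UV(4) T(1) by (metis continuous_open_vimage linear_continuous_at linear_linear)
    then show "openin (top_of_set F) V" by (auto simp: V_def)
    show "z \<in> U" using z UV(2) by (simp add: U_def)
    then show "f z \<in> V" using fU by simp
    show "smooth_on (\<lambda>y. g0 (T y)) V"
      by (rule smooth_on_compose_linear[OF smooth_onI_open[OF UV(4) Ckg] T(1)]) (auto simp: V_def)
  qed (use US fU gU in auto)
qed

text \<open>
  At a point of maximal rank, a kernel vector of the derivative would integrate to a curve on which
  \<open>f\<close> is constant (the constant rank theorem).
\<close>

lemma inj_on_imp_ex_inj_derivative:
  fixes f :: "'a::euclidean_space \<Rightarrow> 'b::euclidean_space"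
  assumes E: "subspace E" and S: "openin (top_of_set E) S" "S \<noteq> {}" and f: "smooth_on f S" "inj_on f S"
  obtains z D where "z \<in> S" "(f has_derivative D) (at z within E)" "inj_on D E"
proof -
  have SE: "S \<subseteq> E" using S(1) openin_imp_subset by blast
  have "\<exists>D. (f has_derivative D) (at z within E)" if "z \<in> S" for z
    using smooth_on_imp_has_derivative[OF f(1) that] at_within_openin[OF S(1) that] by simp
  then obtain Df where Df: "\<And>z. z \<in> S \<Longrightarrow> (f has_derivative Df z) (at z within E)" by metis
  have lin: "linear (Df z)" if "z \<in> S" for z using Df[OF that] by (rule has_derivative_linear)
  \<comment> \<open>Ranks are natural numbers bounded by \<open>dim E\<close>, so the largest one is
    attained.\<close>
  have "\<exists>z. z \<in> S \<and> (\<forall>y. y \<in> S \<longrightarrow> dim (Df y ` E) \<le> dim (Df z ` E))"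
    using S(2) lin dim_image_le
    by (intro ex_has_greatest_nat[where k = "SOME z. z \<in> S" and b = "Suc (dim E)"])
      (auto simp: some_in_eq less_Suc_eq_le)
  then obtain z where z: "z \<in> S" and max: "\<And>y. y \<in> S \<Longrightarrow> dim (Df y ` E) \<le> dim (Df z ` E)" by blast
  define D where "D = Df z"
  have D: "(f has_derivative D) (at z within E)" "linear D" using Df lin z by (auto simp: D_def)
  have "inj_on D E"
  proof (rule ccontr)
    assume "\<not> inj_on D E"
    then obtain q where q: "q \<in> E" "q \<noteq> 0" "D q = 0"
      using linear_inj_on_iff_eq_0[OF D(2) E] by blast
    obtain R where R: "range R \<subseteq> E" "linear R" "\<And>w. w \<in> D ` E \<Longrightarrow> D (R w) = w"
      using linear_exists_right_inverse_on[OF D(2) E] by blast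
    \<comment> \<open>\<open>R\<close> inverts \<open>D\<close> on its image, so the derivative of
      \<open>\<Phi>\<close> at \<open>z\<close> is the identity. Moreover
      \<open>D (\<Phi> u) = D (R (f u))\<close> on \<open>S\<close>: in the coordinate
      \<open>\<Phi>\<close>, the map \<open>D \<circ> R \<circ> f\<close> is the linear map
      \<open>D\<close>.\<close>
    define \<Phi> where "\<Phi> u = R (f u) + (u - R (D u))" for u
    have linRD: "linear (\<lambda>u. u - R (D u))"
      using linear_compose_sub[OF linear_ident linear_compose[OF D(2) R(2)]] by (simp add: o_def)
    have sm: "smooth_on \<Phi> S"
      unfolding \<Phi>_def
      by (rule smooth_on_add[OF smooth_on_linear_compose[OF f(1) R(2)] smooth_on_linear[OF linRD]])
    have dPhi: "(\<Phi> has_derivative (\<lambda>v. R (Df u v) + (v - R (D v)))) (at u within E)" if "u \<in> S" for u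
      unfolding \<Phi>_def using linRD R(2)
      by (intro has_derivative_add bounded_linear.has_derivative[OF _ Df[OF that]] linear_imp_has_derivative)
        (simp_all add: linear_linear)
    have injPhi: "inj_on (\<lambda>v. R (Df z v) + (v - R (D v))) E" by (simp add: D_def[symmetric])
    have PhiE: "\<Phi> ` S \<subseteq> E"
    proof
      fix y assume "y \<in> \<Phi> ` S"
      then obtain u where "u \<in> E" "y = R (f u) + (u - R (D u))" using SE by (auto simp: \<Phi>_def)
      moreover have "R w \<in> E" for w using R(1) by auto
      ultimately show "y \<in> E" using E by (simp add: subspace_add subspace_diff)
    qed
    obtain U V g where UV: "openin (top_of_set E) U" "z \<in> U" "U \<subseteq> S"
      "openin (top_of_set E) V" "\<Phi> z \<in> V" "\<Phi> ` U \<subseteq> V" "g ` V \<subseteq> U"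
      "\<And>u. u \<in> U \<Longrightarrow> g (\<Phi> u) = u" "\<And>v. v \<in> V \<Longrightarrow> \<Phi> (g v) = v" "smooth_on g V"
      by (rule smooth_inverse_function_subspace[OF E E refl S(1) z sm PhiE dPhi[OF z] injPhi]) (rule that)
    have VE: "V \<subseteq> E" using UV(4) openin_imp_subset by blast
    obtain W where W: "open W" "V = E \<inter> W" using UV(4) by (auto simp: openin_open)
    let ?yz = "\<Phi> z"
    have y0: "?yz \<in> E" "?yz \<in> W" using UV(5) W VE by auto
    have "((\<lambda>t::real. ?yz + t *\<^sub>R q) \<longlongrightarrow> ?yz + 0 *\<^sub>R q) (at 0)" by (intro tendsto_intros)
    then have "\<forall>\<^sub>F t::real in at 0. ?yz + t *\<^sub>R q \<in> W"
      using W(1) y0(2) topological_tendstoD by force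
    then obtain e where e: "e > 0" "\<And>t::real. t \<noteq> 0 \<Longrightarrow> \<bar>t\<bar> < e \<Longrightarrow> ?yz + t *\<^sub>R q \<in> W"
      by (auto simp: eventually_at)
    have inV: "?yz + t *\<^sub>R q \<in> V" if "\<bar>t\<bar> < e" for t
      using e(2)[of t] that W(2) y0 q(1) E by (cases "t = 0") (auto intro!: subspace_add subspace_scale)
    \<comment> \<open>In the coordinate \<open>\<Phi>\<close> the argument of \<open>f\<close> moves
      along the kernel direction \<open>q\<close>. If \<open>c\<close> is constant, then
      \<open>f\<close> identifies distinct points.\<close>
    define c where "c t = f (g (?yz + t *\<^sub>R q))" for t
    have dc: "(c has_derivative (\<lambda>t. 0)) (at t)" if t: "\<bar>t\<bar> < e" for t
    proof -
      let ?y = "?yz + t *\<^sub>R q"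
      have yV: "?y \<in> V" by (rule inV[OF t])
      then have gy: "g ?y \<in> U" "g ?y \<in> S" using UV(3,7) by auto
      obtain G where G: "(g has_derivative G) (at ?y within V)"
        using smooth_on_imp_has_derivative[OF UV(10) yV] by blast
      then have G': "(g has_derivative G) (at ?y within E)" using at_within_openin[OF UV(4) yV] by simp
      have linG: "linear G" using G by (rule has_derivative_linear)
      have GE: "G ` E \<subseteq> E"
        by (rule has_derivative_within_subspace_image[OF G' E E UV(4) yV]) (use UV(3,7) SE in auto)
      define Dg where "Dg = Df (g ?y)"
      have Dg: "(f has_derivative Dg) (at (g ?y) within E)" "linear Dg"
        using Df lin gy(2) by (auto simp: Dg_def)
      have gVE: "g ` V \<subseteq> E" using UV(3,7) SE by auto
      have "(\<Phi> \<circ> g has_derivative (\<lambda>v. R (Dg v) + (v - R (D v))) \<circ> G) (at ?y within V)"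
        by (rule diff_chain_within[OF G]) (use dPhi[OF gy(2)] gVE in \<open>auto simp: Dg_def intro: has_derivative_subset\<close>)
      then have "(id has_derivative (\<lambda>v. R (Dg v) + (v - R (D v))) \<circ> G) (at ?y within V)"
        by (rule has_derivative_transform[rotated 2]) (use UV(9) yV in auto)
      then have idD: "(id has_derivative (\<lambda>v. R (Dg v) + (v - R (D v))) \<circ> G) (at ?y within E)"
        using at_within_openin[OF UV(4) yV] by simp
      then have "R (Dg (G v)) + (G v - R (D (G v))) = v" if "v \<in> E" for v
        using has_derivative_within_subspace_unique[OF idD has_derivative_id E _ that] yV VE by auto
      then have "D (R (Dg (G v)) + (G v - R (D (G v)))) = D v" if "v \<in> E" for v
        using that by simp
      then have KD: "D (R (Dg (G v))) = D v" if "v \<in> E" for v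
        using that GE R(3) by (simp add: linear_add[OF D(2)] linear_diff[OF D(2)] image_subset_iff)
      have linK: "linear (\<lambda>w. D (R w))" using linear_compose[OF R(2) D(2)] by (simp add: o_def)
      have sub: "subspace (Dg ` E)" using Dg(2) E linear_subspace_image by blast
      \<comment> \<open>\<open>D \<circ> R\<close> maps the image of \<open>Dg\<close> onto a space
        that contains the image of \<open>D\<close>, whose dimension is maximal. Hence it is
        injective on the image of \<open>Dg\<close>, and \<open>D q = 0\<close> forces
        \<open>Dg (G q) = 0\<close>.\<close>
      have "D ` E \<subseteq> (\<lambda>w. D (R w)) ` (Dg ` E)" using KD GE by (force simp: image_iff)
      then have "dim (D ` E) \<le> dim ((\<lambda>w. D (R w)) ` (Dg ` E))" by (rule dim_subset)
      then have "dim (Dg ` E) \<le> dim ((\<lambda>w. D (R w)) ` (Dg ` E))"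
        using max[OF gy(2)] by (simp add: Dg_def D_def)
      then have inj: "inj_on (\<lambda>w. D (R w)) (Dg ` E)" by (rule linear_surj_on_imp_inj_on[OF linK sub])
      have "D (R (Dg (G q))) = D (R 0)" using KD[OF q(1)] q(3) linear_0[OF R(2)] linear_0[OF D(2)] by simp
      moreover have "Dg (G q) \<in> Dg ` E" "0 \<in> Dg ` E" using GE q(1) subspace_0[OF sub] by auto
      ultimately have zero: "Dg (G q) = 0" using inj by (metis (mono_tags, lifting) inj_onD)
      have "((\<lambda>t. ?yz + t *\<^sub>R q) has_derivative (\<lambda>s. s *\<^sub>R q)) (at t)"
        by (auto intro!: derivative_eq_intros)
      moreover have "(f \<circ> g has_derivative Dg \<circ> G) (at ?y within V)"
        by (rule diff_chain_within[OF G]) (use Dg(1) gVE in \<open>auto intro: has_derivative_subset\<close>)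
      then have "(f \<circ> g has_derivative Dg \<circ> G) (at ?y within range (\<lambda>t. ?yz + t *\<^sub>R q))"
        using at_within_openin[OF UV(4) yV] y0(1) q(1) E
        by (auto intro!: subspace_add subspace_scale elim!: has_derivative_subset)
      ultimately have "((f \<circ> g) \<circ> (\<lambda>t. ?yz + t *\<^sub>R q) has_derivative (Dg \<circ> G) \<circ> (\<lambda>s. s *\<^sub>R q)) (at t)"
        by (rule diff_chain_within[where s = UNIV])
      moreover have "(Dg \<circ> G) \<circ> (\<lambda>s. s *\<^sub>R q) = (\<lambda>s. 0)"
        using zero by (auto simp: linear_cmul[OF linG] linear_cmul[OF Dg(2)])
      ultimately show ?thesis by (simp add: c_def[abs_def] o_def)
    qed
    have "c 0 = c (e / 2)"
    proof (rule has_derivative_zero_unique_connected[OF open_ball[of "0::real" e]])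
      show "(c has_derivative (\<lambda>t. 0)) (at t)" if "t \<in> ball 0 e" for t using that dc by simp
    qed (use e(1) in auto)
    then have "f (g ?yz) = f (g (?yz + (e / 2) *\<^sub>R q))" by (simp add: c_def)
    moreover have in2: "?yz \<in> V" "?yz + (e / 2) *\<^sub>R q \<in> V" using inV[of 0] inV[of "e / 2"] e(1) by auto
    ultimately have "g ?yz = g (?yz + (e / 2) *\<^sub>R q)"
      using f(2) UV(3,7) by (auto dest!: inj_onD)
    then have "?yz = ?yz + (e / 2) *\<^sub>R q" using UV(9) in2 by metis
    then show False using e(1) q(2) by simp
  qed
  then show ?thesis using that z D(1) by blast
qed

section \<open>Smooth maps between manifolds\<close>

text \<open>
  Hausdorffness and second countability are left out, so that products need no topological lemmas.
\<close>

definition smooth_atlas :: "('a, 'e::euclidean_space) manifold \<Rightarrow> bool" where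
  "smooth_atlas M \<longleftrightarrow> subspace (model M) \<and> (\<forall>c\<in>atlas M. chart_on (mtop M) (model M) c) \<and>
     points M = \<Union>(fst ` atlas M) \<and> (\<forall>c\<in>atlas M. \<forall>d\<in>atlas M. compatible_charts c d)"

text \<open>One pair of charts witnesses smoothness on a neighbourhood of \<open>p\<close>; the map
  may be meaningless elsewhere. Local sections, inverse charts and slices are thus treated without
  forming open submanifolds.\<close>

definition smooth_near ::
    "('a, 'e::euclidean_space) manifold \<Rightarrow> ('b, 'f::euclidean_space) manifold \<Rightarrow> ('a \<Rightarrow> 'b) \<Rightarrow> 'a \<Rightarrow> bool"
  where
  "smooth_near M N f p \<longleftrightarrow>
     (\<exists>c\<in>smooth_charts M. \<exists>d\<in>smooth_charts N. \<exists>A. openin (mtop M) A \<and> p \<in> A \<and> A \<subseteq> fst c \<and>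
        f ` A \<subseteq> fst d \<and> smooth_on (local_rep c d f) (snd c ` A))"

text \<open>With model spaces as one-chart manifolds, charts, their inverses and local
  representatives become maps between manifolds, and one composition lemma covers them all.\<close>

definition eucl :: "'e::euclidean_space set \<Rightarrow> ('e, 'e) manifold" where
  "eucl E = \<lparr>mtop = top_of_set E, model = E, atlas = {(E, id)}\<rparr>"

lemma smooth_manifold_imp_smooth_atlas: "smooth_manifold M \<Longrightarrow> smooth_atlas M"
  by (simp add: smooth_manifold_def smooth_atlas_def)

section \<open>Charts and the maximal atlas\<close>

lemma chart_onD:
  assumes "chart_on T E c"
  shows "openin T (fst c)" "openin (top_of_set E) (snd c ` fst c)"
    "homeomorphic_map (subtopology T (fst c)) (top_of_set (snd c ` fst c)) (snd c)"
  using assms by (auto simp: chart_on_def)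

lemma chart_inj:
  assumes "chart_on T E c"
  shows "inj_on (snd c) (fst c)"
proof -
  have "topspace (subtopology T (fst c)) = fst c"
    using chart_onD(1)[OF assms] by (simp add: openin_subset inf.absorb2)
  then show ?thesis using chart_onD(3)[OF assms] by (simp add: homeomorphic_eq_everything_map)
qed

lemma chart_inv: "chart_on T E c \<Longrightarrow> x \<in> fst c \<Longrightarrow> inv_into (fst c) (snd c) (snd c x) = x"
  using chart_inj by (rule inv_into_f_f)

lemma chart_inv_subset:
  "chart_on T E c \<Longrightarrow> A \<subseteq> fst c \<Longrightarrow> x \<in> A \<Longrightarrow> inv_into (fst c) (snd c) (snd c x) = x"
  by (rule chart_inv) auto

lemma chart_image_open:
  assumes "chart_on T E c" "openin T A" "A \<subseteq> fst c"
  shows "openin (top_of_set E) (snd c ` A)"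
proof -
  have "openin (subtopology T (fst c)) A" using assms by (simp add: openin_subtopology) blast
  then have "openin (top_of_set (snd c ` fst c)) (snd c ` A)"
    using chart_onD(3)[OF assms(1)] homeomorphic_imp_open_map open_map_def by metis
  then show ?thesis using chart_onD(2)[OF assms(1)] openin_trans by metis
qed

lemma chart_preimage_open:
  assumes "chart_on T E c" "openin (top_of_set E) B"
  shows "openin T {x \<in> fst c. snd c x \<in> B}"
proof -
  have sub: "topspace (subtopology T (fst c)) = fst c"
    using chart_onD(1)[OF assms(1)] by (simp add: openin_subset inf.absorb2)
  have "openin (top_of_set (snd c ` fst c)) (snd c ` fst c \<inter> B)"
    by (rule openin_subset_trans[OF openin_Int[OF chart_onD(2)[OF assms(1)] assms(2)]])
      (use openin_imp_subset[OF chart_onD(2)[OF assms(1)]] in auto)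
  then have "openin (subtopology T (fst c)) {x \<in> fst c. snd c x \<in> snd c ` fst c \<inter> B}"
    using openin_continuous_map_preimage[OF homeomorphic_imp_continuous_map[OF chart_onD(3)[OF assms(1)]]] sub
    by metis
  moreover have "{x \<in> fst c. snd c x \<in> snd c ` fst c \<inter> B} = {x \<in> fst c. snd c x \<in> B}" by auto
  ultimately show ?thesis using chart_onD(1)[OF assms(1)] openin_trans_full by metis
qed

lemma smooth_charts_chart_on: "c \<in> smooth_charts M \<Longrightarrow> chart_on (mtop M) (model M) c"
  by (simp add: smooth_charts_def)

lemma atlas_subset_smooth_charts: "smooth_atlas M \<Longrightarrow> atlas M \<subseteq> smooth_charts M"
  by (auto simp: smooth_atlas_def smooth_charts_def)

lemma atlas_chart_at:
  assumes "smooth_atlas M" "p \<in> points M"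
  obtains c where "c \<in> atlas M" "c \<in> smooth_charts M" "p \<in> fst c"
  using assms atlas_subset_smooth_charts[OF assms(1)] unfolding smooth_atlas_def by blast

lemma chart_in_points: "c \<in> smooth_charts M \<Longrightarrow> fst c \<subseteq> points M"
  using smooth_charts_chart_on chart_onD(1) openin_subset by metis

lemma smooth_on_local_rep_compose:
  assumes "chart_on T E c" "chart_on T' E' d"
    "smooth_on (local_rep c d f) (snd c ` A)" "smooth_on (local_rep d e g) (snd d ` B)"
    "A \<subseteq> fst c" "f ` A \<subseteq> B" "B \<subseteq> fst d"
  shows "smooth_on (local_rep c e (g \<circ> f)) (snd c ` A)"
proof (rule smooth_on_cong[OF smooth_on_compose[OF assms(3,4)]])
  show "local_rep c d f ` (snd c ` A) \<subseteq> snd d ` B"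
    using assms(6) chart_inv_subset[OF assms(1,5)] by (auto simp: local_rep_def)
  fix z assume "z \<in> snd c ` A"
  then obtain x where x: "x \<in> A" "z = snd c x" by blast
  then have "f x \<in> B" using assms(6) by auto
  then show "local_rep c e (g \<circ> f) z = local_rep d e g (local_rep c d f z)"
    using x chart_inv_subset[OF assms(1,5)] chart_inv_subset[OF assms(2,7)] by (simp add: local_rep_def)
qed

text \<open>Two charts that are compatible with the atlas are compatible with each other: near a
  common point the transition map factors through an atlas chart.\<close>

lemma smooth_charts_compatible:
  assumes M: "smooth_atlas M" and c: "c \<in> smooth_charts M" "d \<in> smooth_charts M"
  shows "smooth_on (local_rep c d id) (local_dom c d id)"
proof (rule smooth_on_local)
  note cc = smooth_charts_chart_on[OF c(1)] and dd = smooth_charts_chart_on[OF c(2)]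
  fix z assume "z \<in> local_dom c d id"
  then obtain x where x: "x \<in> fst c" "x \<in> fst d" "z = snd c x" by (auto simp: local_dom_def)
  then have "x \<in> points M" using chart_in_points[OF c(1)] by auto
  then obtain e where e: "e \<in> atlas M" "e \<in> smooth_charts M" "x \<in> fst e"
    using atlas_chart_at[OF M] by blast
  note ee = smooth_charts_chart_on[OF e(2)]
  let ?A = "fst c \<inter> fst d \<inter> fst e"
  have A: "openin (mtop M) ?A" using cc dd ee chart_onD(1) by (metis openin_Int)
  have "openin (top_of_set (model M)) (snd c ` ?A)" by (rule chart_image_open[OF cc A]) auto
  moreover have "snd c ` ?A \<subseteq> local_dom c d id" by (auto simp: local_dom_def)
  moreover have "local_dom c d id \<subseteq> model M"
    using openin_imp_subset[OF chart_onD(2)[OF cc]] by (auto simp: local_dom_def)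
  ultimately have "openin (top_of_set (local_dom c d id)) (snd c ` ?A)"
    using openin_subset_trans by metis
  moreover have "smooth_on (local_rep c e id) (snd c ` ?A)"
    by (rule smooth_on_subset[of _ "local_dom c e id"])
      (use c(1) e(1) in \<open>auto simp: smooth_charts_def compatible_charts_def local_dom_def\<close>)
  moreover have "smooth_on (local_rep e d id) (snd e ` ?A)"
    by (rule smooth_on_subset[of _ "local_dom e d id"])
      (use c(2) e(1) in \<open>auto simp: smooth_charts_def compatible_charts_def local_dom_def\<close>)
  ultimately have "smooth_on (local_rep c d (id \<circ> id)) (snd c ` ?A)"
    by (intro smooth_on_local_rep_compose[OF cc ee]) auto
  then show "\<exists>T. openin (top_of_set (local_dom c d id)) T \<and> z \<in> T \<and> smooth_on (local_rep c d id) T"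
    using x e(3) \<open>openin (top_of_set (local_dom c d id)) (snd c ` ?A)\<close>
    by (intro exI[of _ "snd c ` ?A"]) auto
qed

text \<open>Continuity of a map is recovered here from smoothness of its local representative, by
  carrying open sets through both charts.\<close>

lemma local_rep_preimage_open:
  assumes c: "chart_on T E c" and d: "chart_on T' E' d" and A: "openin T A" "A \<subseteq> fst c" "f ` A \<subseteq> fst d"
    and f: "smooth_on (local_rep c d f) (snd c ` A)" and B: "openin T' B"
  shows "openin T {x \<in> A. f x \<in> B}"
proof -
  let ?B = "snd d ` (B \<inter> fst d)"
  have "openin (top_of_set E') ?B"
    by (rule chart_image_open[OF d]) (use B chart_onD(1)[OF d] in auto)
  moreover have "local_rep c d f \<in> snd c ` A \<rightarrow> E'"
    using A(3) chart_inv_subset[OF c A(2)] openin_imp_subset[OF chart_onD(2)[OF d]]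
    by (auto simp: local_rep_def image_subset_iff)
  ultimately have "openin (top_of_set (snd c ` A)) (snd c ` A \<inter> local_rep c d f -` ?B)"
    using smooth_on_imp_continuous_on[OF f] continuous_openin_preimage by blast
  then have "openin (top_of_set E) (snd c ` A \<inter> local_rep c d f -` ?B)"
    using chart_image_open[OF c A(1,2)] openin_trans by blast
  then have "openin T {x \<in> fst c. snd c x \<in> snd c ` A \<inter> local_rep c d f -` ?B}"
    by (rule chart_preimage_open[OF c])
  moreover have "{x \<in> fst c. snd c x \<in> snd c ` A \<inter> local_rep c d f -` ?B} = {x \<in> A. f x \<in> B}"
  proof -
    have "snd c x \<in> snd c ` A \<longleftrightarrow> x \<in> A" if "x \<in> fst c" for x
      using that A(2) chart_inj[OF c] by (auto dest: inj_onD)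
    moreover have "local_rep c d f (snd c x) \<in> ?B \<longleftrightarrow> f x \<in> B" if "x \<in> A" for x
    proof -
      have "local_rep c d f (snd c x) = snd d (f x)"
        using that A(2) chart_inv[OF c] by (auto simp: local_rep_def)
      then show ?thesis using that A(3) chart_inj[OF d] by (auto dest: inj_onD)
    qed
    ultimately show ?thesis using A(2) by auto
  qed
  ultimately show ?thesis by simp
qed

text \<open>The witnessing charts are exchanged for prescribed ones by transition maps on both
  sides, after shrinking to the preimage of the new target chart.\<close>

lemma smooth_near_charts:
  assumes M: "smooth_atlas M" and N: "smooth_atlas N" and f: "smooth_near M N f p"
    and c: "c \<in> smooth_charts M" "p \<in> fst c" and d: "d \<in> smooth_charts N" "f p \<in> fst d"
  obtains A where "openin (mtop M) A" "p \<in> A" "A \<subseteq> fst c" "f ` A \<subseteq> fst d"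
    "smooth_on (local_rep c d f) (snd c ` A)"
proof -
  obtain c0 d0 A0 where 0: "c0 \<in> smooth_charts M" "d0 \<in> smooth_charts N" "openin (mtop M) A0" "p \<in> A0"
    "A0 \<subseteq> fst c0" "f ` A0 \<subseteq> fst d0" "smooth_on (local_rep c0 d0 f) (snd c0 ` A0)"
    using f unfolding smooth_near_def by blast
  note cc = smooth_charts_chart_on[OF c(1)] and dd = smooth_charts_chart_on[OF d(1)]
    and cc0 = smooth_charts_chart_on[OF 0(1)] and dd0 = smooth_charts_chart_on[OF 0(2)]
  define A where "A = {x \<in> A0. f x \<in> fst d} \<inter> fst c"
  have "openin (mtop M) {x \<in> A0. f x \<in> fst d}"
    by (rule local_rep_preimage_open[OF cc0 dd0 0(3,5-7) chart_onD(1)[OF dd]])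
  then have A: "openin (mtop M) A" unfolding A_def using chart_onD(1)[OF cc] by (rule openin_Int)
  have "smooth_on (local_rep c c0 id) (snd c ` A)"
    by (rule smooth_on_subset[OF smooth_charts_compatible[OF M c(1) 0(1)]])
      (use 0(5) in \<open>auto simp: local_dom_def A_def\<close>)
  moreover have "smooth_on (local_rep c0 d0 f) (snd c0 ` A)"
    by (rule smooth_on_subset[OF 0(7)]) (auto simp: A_def)
  ultimately have "smooth_on (local_rep c d0 (f \<circ> id)) (snd c ` A)"
    by (rule smooth_on_local_rep_compose[OF cc cc0]) (use 0(5) in \<open>auto simp: A_def\<close>)
  moreover have "smooth_on (local_rep d0 d id) (snd d0 ` (fst d0 \<inter> fst d))"
    by (rule smooth_on_subset[OF smooth_charts_compatible[OF N 0(2) d(1)]])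
      (auto simp: local_dom_def)
  ultimately have "smooth_on (local_rep c d (id \<circ> (f \<circ> id))) (snd c ` A)"
    by (rule smooth_on_local_rep_compose[OF cc dd0]) (use 0(6) in \<open>auto simp: A_def\<close>)
  then show ?thesis using that[OF A] 0(4) c(2) d(2) by (auto simp: A_def)
qed

lemma smooth_near_neighbourhood:
  assumes "smooth_near M N f p"
  obtains A where "openin (mtop M) A" "p \<in> A" "f ` A \<subseteq> points N" "\<And>q. q \<in> A \<Longrightarrow> smooth_near M N f q"
    "\<And>B. openin (mtop N) B \<Longrightarrow> openin (mtop M) {x \<in> A. f x \<in> B}"
proof -
  obtain c d A where *: "c \<in> smooth_charts M" "d \<in> smooth_charts N" "openin (mtop M) A" "p \<in> A"
    "A \<subseteq> fst c" "f ` A \<subseteq> fst d" "smooth_on (local_rep c d f) (snd c ` A)"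
    using assms unfolding smooth_near_def by blast
  show ?thesis
  proof (rule that[of A])
    show "smooth_near M N f q" if "q \<in> A" for q using * that unfolding smooth_near_def by blast
    show "openin (mtop M) {x \<in> A. f x \<in> B}" if "openin (mtop N) B" for B
      by (rule local_rep_preimage_open[OF smooth_charts_chart_on[OF *(1)] smooth_charts_chart_on[OF *(2)] *(3,5-7) that])
    show "f ` A \<subseteq> points N" using *(6) chart_in_points[OF *(2)] by blast
  qed (use * in auto)
qed

lemma smooth_near_points:
  assumes "smooth_near M N f p"
  shows "p \<in> points M" "f p \<in> points N"
  using assms openin_subset by (elim smooth_near_neighbourhood; blast)+

lemma smooth_near_compose:
  assumes M: "smooth_atlas M" "smooth_atlas N" "smooth_atlas K"
    and f: "smooth_near M N f p" and g: "smooth_near N K g (f p)"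
  shows "smooth_near M K (g \<circ> f) p"
proof -
  obtain c d A where *: "c \<in> smooth_charts M" "d \<in> smooth_charts N" "openin (mtop M) A" "p \<in> A"
    "A \<subseteq> fst c" "f ` A \<subseteq> fst d" "smooth_on (local_rep c d f) (snd c ` A)"
    using f unfolding smooth_near_def by blast
  note cc = smooth_charts_chart_on[OF *(1)] and dd = smooth_charts_chart_on[OF *(2)]
  obtain e where e: "e \<in> smooth_charts K" "g (f p) \<in> fst e"
    using atlas_chart_at[OF M(3) smooth_near_points(2)[OF g]] by blast
  have "f p \<in> fst d" using * by auto
  then obtain B where B: "openin (mtop N) B" "f p \<in> B" "B \<subseteq> fst d" "g ` B \<subseteq> fst e"
    "smooth_on (local_rep d e g) (snd d ` B)"
    using smooth_near_charts[OF M(2,3) g *(2) _ e] by blast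
  let ?A = "{x \<in> A. f x \<in> B}"
  have "openin (mtop M) ?A" by (rule local_rep_preimage_open[OF cc dd *(3,5-7) B(1)])
  moreover have "smooth_on (local_rep c e (g \<circ> f)) (snd c ` ?A)"
    by (rule smooth_on_local_rep_compose[OF cc dd smooth_on_subset[OF *(7)] B(5)]) (use * B in auto)
  ultimately show ?thesis
    unfolding smooth_near_def using * B e
    by (intro bexI[of _ c] bexI[of _ e] exI[of _ ?A]) auto
qed

lemma smooth_near_cong:
  assumes M: "smooth_atlas M" and f: "smooth_near M N f p"
    and A: "openin (mtop M) A" "p \<in> A" "\<And>x. x \<in> A \<Longrightarrow> f x = g x"
  shows "smooth_near M N g p"
proof -
  obtain c d B where *: "c \<in> smooth_charts M" "d \<in> smooth_charts N" "openin (mtop M) B" "p \<in> B"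
    "B \<subseteq> fst c" "f ` B \<subseteq> fst d" "smooth_on (local_rep c d f) (snd c ` B)"
    using f unfolding smooth_near_def by blast
  note cc = smooth_charts_chart_on[OF *(1)]
  have "smooth_on (local_rep c d g) (snd c ` (A \<inter> B))"
  proof (rule smooth_on_cong[OF smooth_on_subset[OF *(7)]])
    fix z assume "z \<in> snd c ` (A \<inter> B)"
    then obtain x where "x \<in> A" "x \<in> B" "z = snd c x" by blast
    then show "local_rep c d g z = local_rep c d f z"
      using A(3) *(5) chart_inv[OF cc, of x] by (auto simp: local_rep_def)
  qed auto
  moreover have "g ` (A \<inter> B) \<subseteq> fst d" using A(3) *(6) by fastforce
  ultimately show ?thesis
    unfolding smooth_near_def using * A
    by (intro bexI[of _ c] bexI[of _ d] exI[of _ "A \<inter> B"]) auto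
qed

text \<open>Converts between the chart-wise definition and the pointwise notion used in the rest of
  the proof; continuity in the backward direction comes out of
  \<open>smooth_near_neighbourhood\<close>.\<close>

lemma smooth_map_iff_smooth_near:
  assumes M: "smooth_atlas M" and N: "smooth_atlas N"
  shows "smooth_map M N f \<longleftrightarrow> (\<forall>p\<in>points M. smooth_near M N f p)"
proof
  assume f: "smooth_map M N f"
  show "\<forall>p\<in>points M. smooth_near M N f p"
  proof
    fix p assume p: "p \<in> points M"
    have cont: "continuous_map (mtop M) (mtop N) f" using f by (simp add: smooth_map_def)
    obtain c where c: "c \<in> atlas M" "c \<in> smooth_charts M" "p \<in> fst c" using atlas_chart_at[OF M p] .
    have "f p \<in> points N" using cont p by (auto simp: continuous_map_def)
    then obtain d where d: "d \<in> atlas N" "d \<in> smooth_charts N" "f p \<in> fst d" using atlas_chart_at[OF N] by blast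
    note cc = smooth_charts_chart_on[OF c(2)] and dd = smooth_charts_chart_on[OF d(2)]
    let ?A = "{x \<in> points M. f x \<in> fst d} \<inter> fst c"
    have "openin (mtop M) ?A"
      using openin_continuous_map_preimage[OF cont chart_onD(1)[OF dd]] chart_onD(1)[OF cc] by (rule openin_Int)
    moreover have "smooth_on (local_rep c d f) (snd c ` ?A)"
      by (rule smooth_on_subset[of _ "local_dom c d f"])
        (use f c(1) d(1) in \<open>auto simp: smooth_map_def local_dom_def\<close>)
    ultimately show "smooth_near M N f p"
      unfolding smooth_near_def using c d p
      by (intro bexI[of _ c] bexI[of _ d] exI[of _ ?A]) auto
  qed
next
  assume f: "\<forall>p\<in>points M. smooth_near M N f p"
  have "continuous_map (mtop M) (mtop N) f"
    unfolding continuous_map_def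
  proof (intro conjI allI impI)
    show "f \<in> points M \<rightarrow> points N" using f by (auto intro: smooth_near_points(2))
    fix B assume B: "openin (mtop N) B"
    show "openin (mtop M) {x \<in> points M. f x \<in> B}"
    proof (subst openin_subopen, intro ballI)
      fix p assume "p \<in> {x \<in> points M. f x \<in> B}"
      then have p: "p \<in> points M" "f p \<in> B" by auto
      obtain A where "openin (mtop M) A" "p \<in> A" "openin (mtop M) {x \<in> A. f x \<in> B}"
        using smooth_near_neighbourhood[of M N f p] f p(1) B by metis
      then show "\<exists>T. openin (mtop M) T \<and> p \<in> T \<and> T \<subseteq> {x \<in> points M. f x \<in> B}"
        using p openin_subset by (intro exI[of _ "{x \<in> A. f x \<in> B}"]) blast
    qed
  qed
  moreover have "smooth_on (local_rep c d f) (local_dom c d f)" if "c \<in> atlas M" "d \<in> atlas N" for c d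
  proof (rule smooth_on_local)
    have cd: "c \<in> smooth_charts M" "d \<in> smooth_charts N"
      using that atlas_subset_smooth_charts M N by auto
    note cc = smooth_charts_chart_on[OF cd(1)]
    fix z assume "z \<in> local_dom c d f"
    then obtain p where p: "p \<in> fst c" "f p \<in> fst d" "z = snd c p" by (auto simp: local_dom_def)
    then have "p \<in> points M" using chart_in_points[OF cd(1)] by auto
    then have fp: "smooth_near M N f p" using f by blast
    obtain A where A: "openin (mtop M) A" "p \<in> A" "A \<subseteq> fst c" "f ` A \<subseteq> fst d"
      "smooth_on (local_rep c d f) (snd c ` A)"
      using smooth_near_charts[OF M N fp cd(1) p(1) cd(2) p(2)] .
    moreover have "openin (top_of_set (local_dom c d f)) (snd c ` A)"
    proof (rule openin_subset_trans[OF chart_image_open[OF cc A(1,3)]])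
      show "snd c ` A \<subseteq> local_dom c d f" using A by (auto simp: local_dom_def)
      show "local_dom c d f \<subseteq> model M"
        using openin_imp_subset[OF chart_onD(2)[OF cc]] by (auto simp: local_dom_def)
    qed
    ultimately show "\<exists>T. openin (top_of_set (local_dom c d f)) T \<and> z \<in> T \<and> smooth_on (local_rep c d f) T"
      using p(3) by blast
  qed
  ultimately show "smooth_map M N f" by (simp add: smooth_map_def)
qed

section \<open>Linear subspaces as manifolds, and derivatives in charts\<close>

lemma eucl_simps [simp]: "mtop (eucl E) = top_of_set E" "model (eucl E) = E" "atlas (eucl E) = {(E, id)}"
  by (simp_all add: eucl_def)

lemma local_rep_id_eucl: "z \<in> E \<Longrightarrow> local_rep (E, id) (F, id) f z = f z"
  using inv_into_f_f[of id E z] by (simp add: local_rep_def)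

lemma smooth_atlas_eucl: "subspace E \<Longrightarrow> smooth_atlas (eucl E)"
proof -
  have "smooth_on (local_rep (E, id) (E, id) id) (local_dom (E, id) (E, id) id)"
    by (rule smooth_on_cong[OF smooth_on_linear[OF linear_id]])
      (auto simp: local_dom_def local_rep_id_eucl)
  moreover have "homeomorphic_map (top_of_set E) (top_of_set (id ` E)) id"
    by (simp add: homeomorphic_map_id)
  ultimately show "subspace E \<Longrightarrow> ?thesis"
    by (simp add: smooth_atlas_def chart_on_def compatible_charts_def id_def subtopology_subtopology)
qed

lemma id_chart_eucl: "subspace E \<Longrightarrow> (E, id) \<in> smooth_charts (eucl E)"
  using atlas_subset_smooth_charts[OF smooth_atlas_eucl] by auto

lemma smooth_near_eucl:
  assumes E: "subspace E" and F: "subspace F"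
  shows "smooth_near (eucl E) (eucl F) f z \<longleftrightarrow>
    (\<exists>A. openin (top_of_set E) A \<and> z \<in> A \<and> f ` A \<subseteq> F \<and> smooth_on f A)"
proof
  assume f: "smooth_near (eucl E) (eucl F) f z"
  then have z: "z \<in> fst (E, id)" "f z \<in> fst (F, id)" using smooth_near_points[OF f] by auto
  obtain A where A: "openin (top_of_set E) A" "z \<in> A" "A \<subseteq> E" "f ` A \<subseteq> F"
    "smooth_on (local_rep (E, id) (F, id) f) A"
    by (rule smooth_near_charts[OF smooth_atlas_eucl[OF E] smooth_atlas_eucl[OF F] f
        id_chart_eucl[OF E] z(1) id_chart_eucl[OF F] z(2)]) (rule that, simp_all)
  have "smooth_on f A"
    by (rule smooth_on_cong[OF A(5)]) (use A(3) in \<open>auto simp: local_rep_id_eucl\<close>)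
  then show "\<exists>A. openin (top_of_set E) A \<and> z \<in> A \<and> f ` A \<subseteq> F \<and> smooth_on f A"
    using A by (intro exI[of _ A]) simp
next
  assume "\<exists>A. openin (top_of_set E) A \<and> z \<in> A \<and> f ` A \<subseteq> F \<and> smooth_on f A"
  then obtain A where A: "openin (top_of_set E) A" "z \<in> A" "f ` A \<subseteq> F" "smooth_on f A" by blast
  have AE: "A \<subseteq> E" using A(1) openin_imp_subset by blast
  have "smooth_on (local_rep (E, id) (F, id) f) A"
    by (rule smooth_on_cong[OF A(4)]) (use AE in \<open>auto simp: local_rep_id_eucl\<close>)
  then show "smooth_near (eucl E) (eucl F) f z"
    unfolding smooth_near_def using A AE id_chart_eucl[OF E] id_chart_eucl[OF F]
    by (intro bexI[of _ "(E, id)"] bexI[of _ "(F, id)"] exI[of _ A]) auto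
qed

lemma smooth_near_chart:
  assumes M: "smooth_atlas M" and c: "c \<in> smooth_charts M" "p \<in> fst c"
  shows "smooth_near M (eucl (model M)) (snd c) p"
proof -
  have E: "subspace (model M)" using M by (simp add: smooth_atlas_def)
  note cc = smooth_charts_chart_on[OF c(1)]
  have "smooth_on (local_rep c (model M, id) (snd c)) (snd c ` fst c)"
    by (rule smooth_on_cong[OF smooth_on_linear[OF linear_id]]) (auto simp: local_rep_def chart_inv[OF cc])
  then show ?thesis
    unfolding smooth_near_def
    using c id_chart_eucl[OF E] chart_onD(1)[OF cc] openin_imp_subset[OF chart_onD(2)[OF cc]]
    by (intro bexI[of _ c] bexI[of _ "(model M, id)"] exI[of _ "fst c"]) auto
qed

lemma smooth_near_inv_chart:
  assumes M: "smooth_atlas M" and c: "c \<in> smooth_charts M" "z \<in> snd c ` fst c"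
  shows "smooth_near (eucl (model M)) M (inv_into (fst c) (snd c)) z"
proof -
  have E: "subspace (model M)" using M by (simp add: smooth_atlas_def)
  note cc = smooth_charts_chart_on[OF c(1)]
  note sub = openin_imp_subset[OF chart_onD(2)[OF cc]]
  have "smooth_on (local_rep (model M, id) c (inv_into (fst c) (snd c))) (id ` (snd c ` fst c))"
  proof (rule smooth_on_cong[OF smooth_on_linear[OF linear_id]])
    fix z assume z: "z \<in> id ` (snd c ` fst c)"
    then have "inv_into (model M) id z = z" using sub inv_into_f_f[of id "model M" z] by auto
    then show "local_rep (model M, id) c (inv_into (fst c) (snd c)) z = id z"
      using z by (simp add: local_rep_def f_inv_into_f)
  qed
  then show ?thesis
    unfolding smooth_near_def
    using c id_chart_eucl[OF E] chart_onD(2)[OF cc] sub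
    by (intro bexI[of _ c] bexI[of _ "(model M, id)"] exI[of _ "snd c ` fst c"]) (auto simp: inv_into_into)
qed

lemma smooth_near_local_rep:
  assumes M: "smooth_atlas M" and N: "smooth_atlas N" and f: "smooth_near M N f p"
    and c: "c \<in> smooth_charts M" "p \<in> fst c" and d: "d \<in> smooth_charts N" "f p \<in> fst d"
  shows "smooth_near (eucl (model M)) (eucl (model N)) (local_rep c d f) (snd c p)"
proof -
  have E: "smooth_atlas (eucl (model M))" "smooth_atlas (eucl (model N))"
    using M N smooth_atlas_eucl by (auto simp: smooth_atlas_def)
  have p: "inv_into (fst c) (snd c) (snd c p) = p"
    using chart_inv[OF smooth_charts_chart_on[OF c(1)] c(2)] .
  show ?thesis
    unfolding local_rep_def
    by (rule smooth_near_compose[OF E(1) M E(2) smooth_near_inv_chart[OF M c(1)]],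
        use c(2) in simp, unfold p, rule smooth_near_compose[OF M N E(2) f smooth_near_chart[OF N d]])
qed

lemma smooth_near_eucl_derivative:
  assumes E: "subspace E" and F: "subspace F" and f: "smooth_near (eucl E) (eucl F) f z"
  obtains D where "linear D" "(f has_derivative D) (at z within E)" "D ` E \<subseteq> F"
proof -
  obtain A where A: "openin (top_of_set E) A" "z \<in> A" "f ` A \<subseteq> F" "smooth_on f A"
    using f smooth_near_eucl[OF E F] by blast
  obtain D where "(f has_derivative D) (at z within A)" using smooth_on_imp_has_derivative[OF A(4,2)] by blast
  then have D: "(f has_derivative D) (at z within E)" using at_within_openin[OF A(1,2)] by simp
  show ?thesis
    using that[OF has_derivative_linear[OF D] D has_derivative_within_subspace_image[OF D E F A(1-3)]] .
qed

lemma has_derivative_within_transform_openin: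
  assumes "(f has_derivative D) (at z within E)" "openin (top_of_set E) A" "z \<in> A"
    "\<And>x. x \<in> A \<Longrightarrow> f x = g x"
  shows "(g has_derivative D) (at z within E)"
proof -
  have "(f has_derivative D) (at z within A)" using assms(1) at_within_openin[OF assms(2,3)] by simp
  then have "(g has_derivative D) (at z within A)"
    by (rule has_derivative_transform[rotated 2]) (use assms in auto)
  then show ?thesis using at_within_openin[OF assms(2,3)] by simp
qed

lemma eucl_chain:
  assumes E: "subspace E" and F: "subspace F" and f: "smooth_near (eucl E) (eucl F) f z"
    and D: "(f has_derivative D) (at z within E)" and D': "(g has_derivative D') (at (f z) within F)"
  shows "(g \<circ> f has_derivative D' \<circ> D) (at z within E)"
proof -
  obtain A where A: "openin (top_of_set E) A" "z \<in> A" "f ` A \<subseteq> F" "smooth_on f A"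
    using f smooth_near_eucl[OF E F] by blast
  have "(f has_derivative D) (at z within A)" using D at_within_openin[OF A(1,2)] by simp
  moreover have "(g has_derivative D') (at (f z) within f ` A)" using D' A(3) by (rule has_derivative_subset)
  ultimately have "(g \<circ> f has_derivative D' \<circ> D) (at z within A)" by (rule diff_chain_within)
  then show ?thesis using at_within_openin[OF A(1,2)] by simp
qed

text \<open>The chain rule for \<open>g \<circ> f = id\<close>, compared on \<open>E\<close>, where
  derivatives are unique.\<close>

lemma eucl_left_inverse_derivative:
  assumes E: "subspace E" and F: "subspace F" and f: "smooth_near (eucl E) (eucl F) f z"
    and D: "(f has_derivative D) (at z within E)" and D': "(g has_derivative D') (at (f z) within F)"
    and A: "openin (top_of_set E) A" "z \<in> A" "\<And>x. x \<in> A \<Longrightarrow> g (f x) = x" and v: "v \<in> E"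
  shows "D' (D v) = v"
proof -
  have "((\<lambda>x. x) has_derivative D' \<circ> D) (at z within E)"
    by (rule has_derivative_within_transform_openin[OF eucl_chain[OF E F f D D'] A(1,2)]) (use A(3) in auto)
  moreover have "z \<in> E" using A(1,2) openin_imp_subset by blast
  ultimately show ?thesis
    using has_derivative_within_subspace_unique[OF _ has_derivative_ident E _ v, of "D' \<circ> D" z] by simp
qed

section \<open>Products of manifolds\<close>

lemma product_manifold_simps [simp]:
  "mtop (product_manifold M N) = prod_topology (mtop M) (mtop N)"
  "model (product_manifold M N) = model M \<times> model N"
  by (simp_all add: product_manifold_def)

lemma atlas_product_manifold:
  "atlas (product_manifold M N) = {(fst c \<times> fst d, map_prod (snd c) (snd d)) | c d. c \<in> atlas M \<and> d \<in> atlas N}"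
  by (auto simp: product_manifold_def)

lemma chart_on_product:
  assumes c: "chart_on T E c" and d: "chart_on T' F d"
  shows "chart_on (prod_topology T T') (E \<times> F) (fst c \<times> fst d, map_prod (snd c) (snd d))"
proof -
  have im: "map_prod (snd c) (snd d) ` (fst c \<times> fst d) = (snd c ` fst c) \<times> (snd d ` fst d)" by auto
  obtain c' d' where
    "homeomorphic_maps (subtopology T (fst c)) (top_of_set (snd c ` fst c)) (snd c) c'"
    "homeomorphic_maps (subtopology T' (fst d)) (top_of_set (snd d ` fst d)) (snd d) d'"
    using chart_onD(3)[OF c] chart_onD(3)[OF d] homeomorphic_map_maps by metis
  then have "homeomorphic_maps (prod_topology (subtopology T (fst c)) (subtopology T' (fst d)))
     (prod_topology (top_of_set (snd c ` fst c)) (top_of_set (snd d ` fst d)))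
     (\<lambda>(x,y). (snd c x, snd d y)) (\<lambda>(x,y). (c' x, d' y))"
    using homeomorphic_maps_prod by blast
  then have "homeomorphic_map (subtopology (prod_topology T T') (fst c \<times> fst d))
      (top_of_set ((snd c ` fst c) \<times> (snd d ` fst d))) (map_prod (snd c) (snd d))"
    unfolding homeomorphic_map_maps
    by (intro exI) (simp add: subtopology_Times map_prod_def)
  then show ?thesis
    using chart_onD[OF c] chart_onD[OF d] im
    by (auto simp: chart_on_def openin_prod_Times_iff openin_Times)
qed

lemma smooth_atlas_product:
  assumes M: "smooth_atlas M" and N: "smooth_atlas N"
  shows "smooth_atlas (product_manifold M N)"
proof -
  have sm: "smooth_on (local_rep (fst c \<times> fst c', map_prod (snd c) (snd c')) (fst d \<times> fst d', map_prod (snd d) (snd d')) id)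
      (local_dom (fst c \<times> fst c', map_prod (snd c) (snd c')) (fst d \<times> fst d', map_prod (snd d) (snd d')) id)"
    if "c \<in> atlas M" "d \<in> atlas M" "c' \<in> atlas N" "d' \<in> atlas N" for c d c' d'
  proof -
    have ch: "chart_on (mtop M) (model M) c" "chart_on (mtop N) (model N) c'"
      using that M N by (auto simp: smooth_atlas_def)
    have s: "smooth_on (local_rep c d id) (local_dom c d id)" "smooth_on (local_rep c' d' id) (local_dom c' d' id)"
      using that M N by (auto simp: smooth_atlas_def compatible_charts_def)
    let ?D = "local_dom (fst c \<times> fst c', map_prod (snd c) (snd c')) (fst d \<times> fst d', map_prod (snd d) (snd d')) id"
    have "smooth_on (\<lambda>x. (local_rep c d id (fst x), local_rep c' d' id (snd x))) ?D"
      by (intro smooth_on_Pair smooth_on_compose_linear[OF s(1) linear_fst] smooth_on_compose_linear[OF s(2) linear_snd])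
        (auto simp: local_dom_def)
    then show ?thesis
    proof (rule smooth_on_cong)
      fix x assume "x \<in> ?D"
      then obtain z w where "z \<in> fst c" "w \<in> fst c'" "x = (snd c z, snd c' w)" by (auto simp: local_dom_def)
      then show "local_rep (fst c \<times> fst c', map_prod (snd c) (snd c')) (fst d \<times> fst d', map_prod (snd d) (snd d')) id x
          = (local_rep c d id (fst x), local_rep c' d' id (snd x))"
        using chart_inv[OF chart_on_product[OF ch], of "(z, w)"] chart_inv[OF ch(1), of z]
          chart_inv[OF ch(2), of w]
        by (simp add: local_rep_def)
    qed
  qed
  have "points (product_manifold M N) = \<Union>(fst ` atlas (product_manifold M N))"
  proof -
    have "points M = \<Union>(fst ` atlas M)" "points N = \<Union>(fst ` atlas N)"
      using M N by (auto simp: smooth_atlas_def)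
    then have eq: "points (product_manifold M N) = \<Union>(fst ` atlas M) \<times> \<Union>(fst ` atlas N)" by simp
    show ?thesis
    proof (intro equalityI subsetI)
      fix x assume "x \<in> points (product_manifold M N)"
      then obtain c d where "c \<in> atlas M" "d \<in> atlas N" "x \<in> fst c \<times> fst d" unfolding eq by blast
      then have "(fst c \<times> fst d, map_prod (snd c) (snd d)) \<in> atlas (product_manifold M N)"
        "x \<in> fst (fst c \<times> fst d, map_prod (snd c) (snd d))"
        unfolding atlas_product_manifold by (blast, simp)
      then show "x \<in> \<Union>(fst ` atlas (product_manifold M N))" by blast
    next
      fix x assume "x \<in> \<Union>(fst ` atlas (product_manifold M N))"
      then obtain e where "e \<in> atlas (product_manifold M N)" "x \<in> fst e" by blast
      then obtain c d where "c \<in> atlas M" "d \<in> atlas N" "x \<in> fst c \<times> fst d"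
        unfolding atlas_product_manifold by auto
      then show "x \<in> points (product_manifold M N)" unfolding eq by blast
    qed
  qed
  moreover have "chart_on (mtop (product_manifold M N)) (model (product_manifold M N)) c"
    if c: "c \<in> atlas (product_manifold M N)" for c
  proof -
    obtain a b where "a \<in> atlas M" "b \<in> atlas N" "c = (fst a \<times> fst b, map_prod (snd a) (snd b))"
      using c unfolding atlas_product_manifold by blast
    then show ?thesis using M N chart_on_product[of "mtop M" "model M" a "mtop N" "model N" b]
      by (simp add: smooth_atlas_def)
  qed
  moreover have "compatible_charts c d"
    if c: "c \<in> atlas (product_manifold M N)" and d: "d \<in> atlas (product_manifold M N)" for c d
  proof -
    obtain a b where "a \<in> atlas M" "b \<in> atlas N" "c = (fst a \<times> fst b, map_prod (snd a) (snd b))"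
      using c unfolding atlas_product_manifold by blast
    moreover obtain a' b' where "a' \<in> atlas M" "b' \<in> atlas N" "d = (fst a' \<times> fst b', map_prod (snd a') (snd b'))"
      using d unfolding atlas_product_manifold by blast
    ultimately show ?thesis using sm by (simp add: compatible_charts_def)
  qed
  ultimately show ?thesis
    using M N unfolding smooth_atlas_def by (simp add: subspace_Times)
qed

lemma smooth_near_Pair:
  assumes M: "smooth_atlas M" "smooth_atlas N" "smooth_atlas K"
    and f: "smooth_near K M f p" and g: "smooth_near K N g p"
  shows "smooth_near K (product_manifold M N) (\<lambda>x. (f x, g x)) p"
proof -
  obtain c where c: "c \<in> smooth_charts K" "p \<in> fst c"
    using atlas_chart_at[OF M(3) smooth_near_points(1)[OF f]] by blast
  obtain d where d: "d \<in> atlas M" "d \<in> smooth_charts M" "f p \<in> fst d"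
    using atlas_chart_at[OF M(1) smooth_near_points(2)[OF f]] by blast
  obtain e where e: "e \<in> atlas N" "e \<in> smooth_charts N" "g p \<in> fst e"
    using atlas_chart_at[OF M(2) smooth_near_points(2)[OF g]] by blast
  obtain A where A: "openin (mtop K) A" "p \<in> A" "A \<subseteq> fst c" "f ` A \<subseteq> fst d"
    "smooth_on (local_rep c d f) (snd c ` A)"
    using smooth_near_charts[OF M(3,1) f c d(2,3)] .
  obtain B where B: "openin (mtop K) B" "p \<in> B" "B \<subseteq> fst c" "g ` B \<subseteq> fst e"
    "smooth_on (local_rep c e g) (snd c ` B)"
    using smooth_near_charts[OF M(3,2) g c e(2,3)] .
  let ?de = "(fst d \<times> fst e, map_prod (snd d) (snd e))"
  have "?de \<in> atlas (product_manifold M N)" using d e unfolding atlas_product_manifold by blast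
  then have de: "?de \<in> smooth_charts (product_manifold M N)"
    using atlas_subset_smooth_charts[OF smooth_atlas_product[OF M(1,2)]] by auto
  have "smooth_on (\<lambda>x. (local_rep c d f x, local_rep c e g x)) (snd c ` (A \<inter> B))"
    by (intro smooth_on_Pair smooth_on_subset[OF A(5)] smooth_on_subset[OF B(5)]) auto
  then have "smooth_on (local_rep c ?de (\<lambda>x. (f x, g x))) (snd c ` (A \<inter> B))"
    by (rule smooth_on_cong) (simp add: local_rep_def)
  then show ?thesis
    unfolding smooth_near_def using A B c de
    by (intro bexI[of _ c] bexI[of _ ?de] exI[of _ "A \<inter> B"]) auto
qed

lemma smooth_near_const:
  assumes M: "smooth_atlas M" "smooth_atlas N" "p \<in> points M" "q \<in> points N"
  shows "smooth_near M N (\<lambda>x. q) p"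
proof -
  obtain c where c: "c \<in> smooth_charts M" "p \<in> fst c" using atlas_chart_at[OF M(1,3)] by blast
  obtain d where d: "d \<in> smooth_charts N" "q \<in> fst d" using atlas_chart_at[OF M(2,4)] by blast
  have "smooth_on (local_rep c d (\<lambda>x. q)) (snd c ` fst c)"
    by (rule smooth_on_cong[OF smooth_on_const[of "snd d q"]]) (simp add: local_rep_def)
  then show ?thesis
    unfolding smooth_near_def using c d chart_onD(1)[OF smooth_charts_chart_on[OF c(1)]]
    by (intro bexI[of _ c] bexI[of _ d] exI[of _ "fst c"]) auto
qed

lemma smooth_near_id:
  assumes M: "smooth_atlas M" "p \<in> points M"
  shows "smooth_near M M (\<lambda>x. x) p"
proof -
  obtain c where c: "c \<in> smooth_charts M" "p \<in> fst c" using atlas_chart_at[OF M] by blast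
  note cc = smooth_charts_chart_on[OF c(1)]
  have "smooth_on (local_rep c c (\<lambda>x. x)) (snd c ` fst c)"
    by (rule smooth_on_cong[OF smooth_on_linear[OF linear_id]]) (auto simp: local_rep_def chart_inv[OF cc])
  then show ?thesis
    unfolding smooth_near_def using c chart_onD(1)[OF cc]
    by (intro bexI[of _ c] bexI[of _ c] exI[of _ "fst c"]) auto
qed

lemma smooth_on_if_smooth_near:
  assumes E: "subspace E" and F: "subspace F" and S: "openin (top_of_set E) S"
    and f: "\<And>z. z \<in> S \<Longrightarrow> smooth_near (eucl E) (eucl F) f z"
  shows "smooth_on f S"
proof (rule smooth_on_local)
  fix z assume z: "z \<in> S"
  then obtain A where A: "openin (top_of_set E) A" "z \<in> A" "f ` A \<subseteq> F" "smooth_on f A"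
    using f[OF z] smooth_near_eucl[OF E F] by blast
  have "openin (top_of_set S) (S \<inter> A)"
    using A(1) S openin_imp_subset[OF S] by (intro openin_subset_trans[of E "S \<inter> A" S]) auto
  then show "\<exists>T. openin (top_of_set S) T \<and> z \<in> T \<and> smooth_on f T"
    using A(2) z smooth_on_subset[OF A(4), of "S \<inter> A"] by blast
qed

section \<open>Affine maps and linear complements\<close>

lemma smooth_near_eucl_linear:
  assumes "subspace E" "subspace F" "linear f" "f ` E \<subseteq> F" "z \<in> E"
  shows "smooth_near (eucl E) (eucl F) f z"
  unfolding smooth_near_eucl[OF assms(1,2)]
  using assms smooth_on_linear[OF assms(3)] by (intro exI[of _ E]) auto

lemma smooth_near_eucl_affine:
  assumes "subspace E" "subspace F" "linear B" "B ` E \<subseteq> F" "p \<in> F" "z \<in> E"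
  shows "smooth_near (eucl E) (eucl F) (\<lambda>n. p + B n) z"
  unfolding smooth_near_eucl[OF assms(1,2)]
  using assms smooth_on_add[OF smooth_on_const smooth_on_linear[OF assms(3)]]
  by (intro exI[of _ E]) (auto intro: subspace_add)

lemma has_derivative_affine:
  fixes B :: "'a::euclidean_space \<Rightarrow> 'b::euclidean_space"
  assumes "linear B"
  shows "((\<lambda>n. p + B n) has_derivative B) (at z within E)"
proof -
  have "((\<lambda>n. p + B n) has_derivative (\<lambda>h. 0 + B h)) (at z within E)"
    by (intro has_derivative_add has_derivative_const linear_imp_has_derivative assms)
  then show ?thesis by simp
qed

lemma eucl_left_inverse_inj:
  assumes E: "subspace E" and F: "subspace F" and f: "smooth_near (eucl E) (eucl F) f z"
    and g: "smooth_near (eucl F) (eucl E) g (f z)"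
    and A: "openin (top_of_set E) A" "z \<in> A" "\<And>x. x \<in> A \<Longrightarrow> g (f x) = x"
    and D: "(f has_derivative D) (at z within E)"
  shows "inj_on D E"
proof -
  obtain D' where "(g has_derivative D') (at (f z) within F)"
    using smooth_near_eucl_derivative[OF F E g] by blast
  then have "D' (D v) = v" if "v \<in> E" for v
    using eucl_left_inverse_derivative[OF E F f D _ A that] by blast
  then show ?thesis by (rule inj_on_inverseI)
qed

text \<open>The orthogonal complement of \<open>K\<close> in \<open>E\<close> has the dimension of
  \<open>E'\<close>, so an isometry identifies the two. In the application \<open>E'\<close> is the
  model of the orbit space, which is fixed beforehand and has no given position in
  \<open>E\<close>.\<close>

lemma ex_linear_complement:
  fixes E E' K :: "'a::euclidean_space set"
  assumes "subspace E" "subspace E'" "subspace K" "K \<subseteq> E" "dim E' + dim K = dim E"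
  obtains B where "linear B" "B ` E' \<subseteq> E" "inj_on B E'" "K \<inter> B ` E' = {0}"
proof -
  let ?C = "{y \<in> E. \<forall>x\<in>K. orthogonal x y}"
  have C: "subspace ?C"
    using assms(1) by (auto simp: subspace_def orthogonal_clauses)
  have "dim E' = dim ?C" using dim_subspace_orthogonal_to_vectors[OF assms(3,1,4)] assms(5) by simp
  then obtain B B' where B: "linear B" "linear B'" "B ` E' = ?C" "\<And>x. x \<in> E' \<Longrightarrow> B' (B x) = x"
    by (rule isometries_subspaces[OF assms(2) C]) blast
  have "inj_on B E'" using B(4) by (rule inj_on_inverseI)
  moreover have "K \<inter> B ` E' = {0}"
    using B(3) subspace_0[OF C] subspace_0[OF assms(3)] orthogonal_self by auto
  ultimately show ?thesis using that B by blast
qed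

section \<open>Free actions of compact Lie groups\<close>

text \<open>
  Unlike \<open>group_action\<close>, the locale does not require the maps \<open>\<alpha> g\<close> to be extensional, so that it also
  applies to the strata.
\<close>

locale free_compact_action =
  fixes G :: "('g, 'm) monoid_scheme" (structure)
    and L :: "('g, 'f::euclidean_space) manifold"
    and M :: "('a, 'e::euclidean_space) manifold"
    and \<alpha> :: "'g \<Rightarrow> 'a \<Rightarrow> 'a"
  assumes Lie_group: "Lie_group G L" and compact: "compact_space (mtop L)"
    and manifold: "smooth_manifold M"
    and act_closed [simp]: "g \<in> carrier G \<Longrightarrow> x \<in> points M \<Longrightarrow> \<alpha> g x \<in> points M"
    and act_one [simp]: "x \<in> points M \<Longrightarrow> \<alpha> \<one> x = x"
    and act_mult: "g \<in> carrier G \<Longrightarrow> h \<in> carrier G \<Longrightarrow> x \<in> points M \<Longrightarrow> \<alpha> (g \<otimes> h) x = \<alpha> g (\<alpha> h x)"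
    and free: "g \<in> carrier G \<Longrightarrow> x \<in> points M \<Longrightarrow> \<alpha> g x = x \<Longrightarrow> g = \<one>"
    and smooth: "smooth_map (product_manifold L M) M (\<lambda>(g, x). \<alpha> g x)"
begin

section \<open>Group laws and smoothness of the action\<close>

sublocale group G using Lie_group by (simp add: Lie_group_def)

lemma points_L: "points L = carrier G" using Lie_group by (simp add: Lie_group_def)

lemma atlas_L: "smooth_atlas L"
  using Lie_group smooth_manifold_imp_smooth_atlas by (auto simp: Lie_group_def)

lemma atlas_M: "smooth_atlas M" using manifold by (rule smooth_manifold_imp_smooth_atlas)

lemma subspace_models: "subspace (model L)" "subspace (model M)"
  using atlas_L atlas_M by (auto simp: smooth_atlas_def)

lemma act_inv [simp]:
  assumes "g \<in> carrier G" "x \<in> points M"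
  shows "\<alpha> (inv g) (\<alpha> g x) = x" "\<alpha> g (\<alpha> (inv g) x) = x"
  using assms act_mult[of "inv g" g x] act_mult[of g "inv g" x] by auto

lemma act_eq_imp:
  assumes "g \<in> carrier G" "h \<in> carrier G" "x \<in> points M" "\<alpha> g x = \<alpha> h x"
  shows "g = h"
proof -
  have "\<alpha> (inv h \<otimes> g) x = x" using assms by (simp add: act_mult)
  then have "inv h \<otimes> g = \<one>" using assms free by blast
  then have "inv g = inv h" using assms inv_equality[of "inv h" g] by simp
  then have "inv (inv g) = inv (inv h)" by simp
  then show ?thesis using assms by simp
qed

lemma orbit_act [simp]: "g \<in> carrier G \<Longrightarrow> x \<in> points M \<Longrightarrow> orbit G \<alpha> (\<alpha> g x) = orbit G \<alpha> x"
proof (intro equalityI subsetI)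
  fix y assume g: "g \<in> carrier G" "x \<in> points M"
  show "y \<in> orbit G \<alpha> x" if y: "y \<in> orbit G \<alpha> (\<alpha> g x)"
  proof -
    obtain h where "h \<in> carrier G" "y = \<alpha> h (\<alpha> g x)" using y by (auto simp: orbit_def)
    then have "y = \<alpha> (h \<otimes> g) x" "h \<otimes> g \<in> carrier G" using g by (auto simp: act_mult)
    then show ?thesis unfolding orbit_def by blast
  qed
  show "y \<in> orbit G \<alpha> (\<alpha> g x)" if y: "y \<in> orbit G \<alpha> x"
  proof -
    obtain h where h: "h \<in> carrier G" "y = \<alpha> h x" using y by (auto simp: orbit_def)
    then have "y = \<alpha> (h \<otimes> inv g) (\<alpha> g x)" "h \<otimes> inv g \<in> carrier G"
      using g act_mult[of h "inv g" "\<alpha> g x"] by auto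
    then show ?thesis unfolding orbit_def by blast
  qed
qed

lemma orbit_refl: "x \<in> points M \<Longrightarrow> x \<in> orbit G \<alpha> x"
  unfolding orbit_def using act_one one_closed by (metis (mono_tags, lifting) mem_Collect_eq)

lemma orbit_eq_iff:
  assumes "x \<in> points M" "y \<in> points M"
  shows "orbit G \<alpha> x = orbit G \<alpha> y \<longleftrightarrow> (\<exists>g\<in>carrier G. y = \<alpha> g x)"
proof
  assume "orbit G \<alpha> x = orbit G \<alpha> y"
  then have "y \<in> orbit G \<alpha> x" using orbit_refl[OF assms(2)] by simp
  then show "\<exists>g\<in>carrier G. y = \<alpha> g x" by (auto simp: orbit_def)
qed (use assms in auto)

lemma continuous_act: "continuous_map (prod_topology (mtop L) (mtop M)) (mtop M) (\<lambda>(g, x). \<alpha> g x)"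
  using smooth by (simp add: smooth_map_def)

lemma smooth_near_act:
  assumes K: "smooth_atlas K" and f: "smooth_near K L f p" and h: "smooth_near K M h p"
  shows "smooth_near K M (\<lambda>q. \<alpha> (f q) (h q)) p"
proof -
  note LM = smooth_atlas_product[OF atlas_L atlas_M]
  have "(f p, h p) \<in> points (product_manifold L M)"
    using smooth_near_points[OF f] smooth_near_points[OF h] by simp
  then have "smooth_near (product_manifold L M) M (\<lambda>(g, x). \<alpha> g x) (f p, h p)"
    using smooth smooth_map_iff_smooth_near[OF LM atlas_M] by blast
  from smooth_near_compose[OF K LM atlas_M smooth_near_Pair[OF atlas_L atlas_M K f h] this]
  show ?thesis by (simp add: o_def)
qed

lemma smooth_near_act_fixed:
  assumes "g \<in> carrier G" "x \<in> points M"
  shows "smooth_near M M (\<alpha> g) x"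
  using smooth_near_act[OF atlas_M smooth_near_const[OF atlas_M atlas_L assms(2)] smooth_near_id[OF atlas_M assms(2)]]
    assms(1) points_L by simp

lemma smooth_near_mult_fixed:
  assumes "g \<in> carrier G" "h \<in> carrier G"
  shows "smooth_near L L (\<lambda>h. g \<otimes> h) h"
proof -
  note LL = smooth_atlas_product[OF atlas_L atlas_L]
  have "smooth_map (product_manifold L L) L (\<lambda>(a, b). a \<otimes> b)" using Lie_group by (simp add: Lie_group_def)
  then have "smooth_near (product_manifold L L) L (\<lambda>(a, b). a \<otimes> b) (g, h)"
    using smooth_map_iff_smooth_near[OF LL atlas_L] assms points_L by simp
  moreover have "smooth_near L (product_manifold L L) (\<lambda>h. (g, h)) h"
    using assms points_L
    by (intro smooth_near_Pair[OF atlas_L atlas_L atlas_L] smooth_near_const smooth_near_id atlas_L) auto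
  ultimately show ?thesis
    using smooth_near_compose[OF atlas_L LL atlas_L, of "\<lambda>h. (g, h)" h "\<lambda>(a, b). a \<otimes> b"] by (simp add: o_def)
qed

lemma open_act_image:
  assumes "openin (mtop M) A" "g \<in> carrier G"
  shows "openin (mtop M) (\<alpha> g ` A)"
proof -
  have A: "A \<subseteq> points M" using assms(1) by (rule openin_subset)
  have "smooth_map M M (\<alpha> (inv g))"
    unfolding smooth_map_iff_smooth_near[OF atlas_M atlas_M] using smooth_near_act_fixed assms(2) by simp
  then have "openin (mtop M) {x \<in> points M. \<alpha> (inv g) x \<in> A}"
    using assms(1) openin_continuous_map_preimage by (auto simp: smooth_map_def)
  moreover have "{x \<in> points M. \<alpha> (inv g) x \<in> A} = \<alpha> g ` A"
  proof (intro equalityI subsetI)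
    fix x assume "x \<in> {x \<in> points M. \<alpha> (inv g) x \<in> A}"
    then show "x \<in> \<alpha> g ` A" using act_inv(2)[OF assms(2), of x] by (metis (mono_tags, lifting) imageI mem_Collect_eq)
  next
    fix x assume "x \<in> \<alpha> g ` A"
    then show "x \<in> {x \<in> points M. \<alpha> (inv g) x \<in> A}" using A assms(2) by auto
  qed
  ultimately show ?thesis by simp
qed

text \<open>The triples with \<open>\<alpha> g x = y\<close> form a closed set because
  \<open>M\<close> is Hausdorff, and projecting away the compact factor is a closed map. With all of
  \<open>G\<close> for \<open>C\<close> this separates orbits; with the complement of a
  neighbourhood of the identity it yields slices.\<close>

lemma closed_orbit_relation:
  assumes "closedin (mtop L) C"
  shows "closedin (prod_topology (mtop M) (mtop M)) {(x, y). x \<in> points M \<and> y \<in> points M \<and> (\<exists>g\<in>C. \<alpha> g x = y)}"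
proof -
  let ?MM = "prod_topology (mtop M) (mtop M)"
  let ?P = "prod_topology (mtop L) ?MM"
  have C: "C \<subseteq> carrier G" using closedin_subset[OF assms] points_L by simp
  have "continuous_map ?P (prod_topology (mtop L) (mtop M)) (\<lambda>p. (fst p, fst (snd p)))"
    by (intro continuous_map_pairedI continuous_map_fst continuous_map_compose[OF continuous_map_snd continuous_map_fst, unfolded o_def])
  from continuous_map_compose[OF this continuous_act]
  have 1: "continuous_map ?P (mtop M) (\<lambda>p. \<alpha> (fst p) (fst (snd p)))" by (simp add: o_def)
  have 2: "continuous_map ?P (mtop M) (\<lambda>p. snd (snd p))"
    by (rule continuous_map_compose[OF continuous_map_snd continuous_map_snd, unfolded o_def])
  have "Hausdorff_space (mtop M)" using manifold by (simp add: smooth_manifold_def)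
  then have "closedin ?P {p \<in> topspace ?P. \<alpha> (fst p) (fst (snd p)) = snd (snd p)}"
    using 1 2 by (rule closedin_continuous_maps_eq)
  moreover have "closedin ?P {p \<in> topspace ?P. fst p \<in> C}"
    by (rule closedin_continuous_map_preimage[OF continuous_map_fst assms])
  ultimately have cl: "closedin ?P ({p \<in> topspace ?P. \<alpha> (fst p) (fst (snd p)) = snd (snd p)} \<inter> {p \<in> topspace ?P. fst p \<in> C})"
    (is "closedin ?P ?T") by (rule closedin_Int)
  have "closedin ?MM (snd ` ?T)" using closed_map_snd[OF compact] cl by (auto simp: closed_map_def)
  moreover have "snd ` ?T = {(x, y). x \<in> points M \<and> y \<in> points M \<and> (\<exists>g\<in>C. \<alpha> g x = y)}"
    using C by (force simp: points_L image_iff)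
  ultimately show ?thesis by simp
qed

lemma orbit_map_smooth_near:
  assumes x: "x \<in> points M" and c: "c \<in> smooth_charts M" and l: "l \<in> smooth_charts L"
    and w: "w \<in> snd l ` fst l" and y: "y \<in> points M"
    and wc: "\<alpha> (inv_into (fst l) (snd l) w) x \<in> fst c"
  shows "smooth_near (eucl (model L)) (eucl (model M)) (\<lambda>w. snd c (\<alpha> (inv_into (fst l) (snd l) w) x)) w"
proof -
  note EL = smooth_atlas_eucl[OF subspace_models(1)] and EM = smooth_atlas_eucl[OF subspace_models(2)]
  have "w \<in> points (eucl (model L))"
    using w openin_imp_subset[OF chart_onD(2)[OF smooth_charts_chart_on[OF l]]] by auto
  then have "smooth_near (eucl (model L)) M (\<lambda>w. \<alpha> (inv_into (fst l) (snd l) w) x) w"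
    by (intro smooth_near_act[OF EL smooth_near_inv_chart[OF atlas_L l w]] smooth_near_const[OF EL atlas_M _ x])
  from smooth_near_compose[OF EL atlas_M EM this smooth_near_chart[OF atlas_M c wc]]
  show ?thesis by (simp add: o_def)
qed

text \<open>
  The orbit map is injective, so its derivative is injective at some point near the identity;
  by equivariance it is then injective at the identity.
\<close>

lemma orbit_map_immersive:
  assumes x: "x \<in> points M" and c: "c \<in> smooth_charts M" "x \<in> fst c"
    and l: "l \<in> smooth_charts L" "\<one> \<in> fst l"
    and D: "((\<lambda>w. snd c (\<alpha> (inv_into (fst l) (snd l) w) x)) has_derivative D) (at (snd l \<one>) within model L)"
  shows "inj_on D (model L)"
proof -
  let ?E = "model L" and ?F = "model M"
  define li where "li = inv_into (fst l) (snd l)"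
  define ci where "ci = inv_into (fst c) (snd c)"
  define f where "f w = snd c (\<alpha> (li w) x)" for w
  note E = subspace_models(1) and F = subspace_models(2)
  note EL = smooth_atlas_eucl[OF E] and EM = smooth_atlas_eucl[OF F]
  note cc = smooth_charts_chart_on[OF c(1)] and ll = smooth_charts_chart_on[OF l(1)]
  have li: "li (snd l g) = g" if "g \<in> fst l" for g using chart_inv[OF ll that] by (simp add: li_def)
  have ci: "ci (snd c y) = y" if "y \<in> fst c" for y using chart_inv[OF cc that] by (simp add: ci_def)
  have lG: "fst l \<subseteq> carrier G" using chart_in_points[OF l(1)] points_L by simp
  have "smooth_near L M (\<lambda>g. \<alpha> g x) g" if "g \<in> carrier G" for g
    using that points_L x
    by (intro smooth_near_act[OF atlas_L] smooth_near_id smooth_near_const atlas_L atlas_M) auto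
  then have "smooth_map L M (\<lambda>g. \<alpha> g x)"
    unfolding smooth_map_iff_smooth_near[OF atlas_L atlas_M] points_L by blast
  then have "openin (mtop L) {g \<in> points L. \<alpha> g x \<in> fst c}"
    using openin_continuous_map_preimage[OF _ chart_onD(1)[OF cc]] by (auto simp: smooth_map_def)
  then have A0: "openin (mtop L) ({g \<in> points L. \<alpha> g x \<in> fst c} \<inter> fst l)" (is "openin _ ?A")
    using chart_onD(1)[OF ll] by (rule openin_Int)
  let ?W = "snd l ` ?A"
  have W: "openin (top_of_set ?E) ?W" by (rule chart_image_open[OF ll A0]) auto
  have one: "\<one> \<in> ?A" using c(2) l(2) x points_L by simp
  have fsn: "smooth_near (eucl ?E) (eucl ?F) f w" if "w \<in> ?W" for w
  proof -
    obtain g where "g \<in> ?A" "w = snd l g" using \<open>w \<in> ?W\<close> by blast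
    then show ?thesis
      unfolding f_def li_def using li[of g] by (intro orbit_map_smooth_near[OF x c(1) l(1) _ x]) (auto simp: li_def)
  qed
  have "smooth_on f ?W" by (rule smooth_on_if_smooth_near[OF E F W fsn])
  moreover have "inj_on f ?W"
  proof (rule inj_onI)
    fix w w' assume "w \<in> ?W" "w' \<in> ?W" and eq: "f w = f w'"
    then obtain g g' where g: "g \<in> ?A" "w = snd l g" "g' \<in> ?A" "w' = snd l g'" by blast
    then have "snd c (\<alpha> g x) = snd c (\<alpha> g' x)" using eq li by (simp add: f_def)
    then have "\<alpha> g x = \<alpha> g' x" using g chart_inj[OF cc] by (auto dest: inj_onD)
    then show "w = w'" using act_eq_imp[of g g' x] g lG x by auto
  qed
  \<comment> \<open>The injective orbit map has an injective derivative at some \<open>w1\<close>,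
    the coordinate of a group element \<open>g1\<close> that need not be the identity.\<close>
  ultimately obtain w1 D1 where w1: "w1 \<in> ?W" "(f has_derivative D1) (at w1 within ?E)" "inj_on D1 ?E"
    using inj_on_imp_ex_inj_derivative[OF E W] one by blast
  then obtain g1 where g1: "g1 \<in> ?A" "w1 = snd l g1" by blast
  then have g1G: "g1 \<in> carrier G" using points_L by simp
  let ?z = "snd l \<one>"
  \<comment> \<open>\<open>H\<close> is left translation by \<open>g1\<close> in the chart
    \<open>l\<close>, and \<open>K\<close> is the action of \<open>inv g1\<close> in the chart
    \<open>c\<close>; \<open>H'\<close> and \<open>K'\<close> invert them. As \<open>\<alpha> (inv
    g1) (\<alpha> (g1 \<otimes> g) x) = \<alpha> g x\<close>, near \<open>?z\<close> one has
    \<open>f = K \<circ> f \<circ> H\<close>.\<close>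
  define H where "H w = snd l (g1 \<otimes> li w)" for w
  define H' where "H' w = snd l (inv g1 \<otimes> li w)" for w
  define K where "K u = snd c (\<alpha> (inv g1) (ci u))" for u
  define K' where "K' u = snd c (\<alpha> g1 (ci u))" for u
  have Hsn: "smooth_near (eucl ?E) (eucl ?E) (\<lambda>w. snd l (h \<otimes> li w)) (snd l g)"
    if "g \<in> fst l" "h \<in> carrier G" "h \<otimes> g \<in> fst l" for g h
  proof -
    have "smooth_near (eucl ?E) L ((\<lambda>g. h \<otimes> g) \<circ> li) (snd l g)"
      using that lG li[OF that(1)]
      by (intro smooth_near_compose[OF EL atlas_L atlas_L] smooth_near_inv_chart[OF atlas_L l(1), folded li_def]
          smooth_near_mult_fixed) auto
    from smooth_near_compose[OF EL atlas_L EL this smooth_near_chart[OF atlas_L l(1)]]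
    show ?thesis using that li[OF that(1)] by (simp add: o_def)
  qed
  have Ksn: "smooth_near (eucl ?F) (eucl ?F) (\<lambda>u. snd c (\<alpha> h (ci u))) (snd c y)"
    if "y \<in> fst c" "h \<in> carrier G" "\<alpha> h y \<in> fst c" for y h
  proof -
    have "smooth_near (eucl ?F) M (\<alpha> h \<circ> ci) (snd c y)"
      using that chart_in_points[OF c(1)] ci[OF that(1)]
      by (intro smooth_near_compose[OF EM atlas_M atlas_M] smooth_near_inv_chart[OF atlas_M c(1), folded ci_def]
          smooth_near_act_fixed) auto
    from smooth_near_compose[OF EM atlas_M EM this smooth_near_chart[OF atlas_M c(1)]]
    show ?thesis using that ci[OF that(1)] by (simp add: o_def)
  qed
  have fz: "f ?z = snd c x" using li[OF l(2)] x by (simp add: f_def)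
  have Hz: "H ?z = w1" using li[OF l(2)] g1 g1G by (simp add: H_def)
  have f1: "f w1 = snd c (\<alpha> g1 x)" using g1 li by (simp add: f_def)
  have H: "smooth_near (eucl ?E) (eucl ?E) H ?z"
    unfolding H_def using g1 g1G l(2) by (intro Hsn) auto
  have H': "smooth_near (eucl ?E) (eucl ?E) H' (H ?z)"
    unfolding H'_def Hz g1(2) using g1 g1G l(2) by (intro Hsn) auto
  have K: "smooth_near (eucl ?F) (eucl ?F) K (f w1)"
    unfolding K_def f1 using g1 g1G c(2) x by (intro Ksn) auto
  have Kf: "K (f w1) = snd c x" unfolding K_def f1 using g1 g1G ci x by simp
  have K': "smooth_near (eucl ?F) (eucl ?F) K' (K (f w1))"
    unfolding K'_def Kf using g1 g1G c(2) x by (intro Ksn) auto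
  obtain DH where DH: "(H has_derivative DH) (at ?z within ?E)" "DH ` ?E \<subseteq> ?E"
    by (rule smooth_near_eucl_derivative[OF E E H]) (rule that)
  obtain DK where DK: "(K has_derivative DK) (at (f w1) within ?F)"
    by (rule smooth_near_eucl_derivative[OF F F K]) (rule that)
  obtain AH where AH: "openin (top_of_set ?E) AH" "?z \<in> AH" "openin (top_of_set ?E) {w \<in> AH. H w \<in> ?W}"
  proof (rule smooth_near_neighbourhood[OF H])
    fix A assume "openin (mtop (eucl ?E)) A" "?z \<in> A"
      and "\<And>B. openin (mtop (eucl ?E)) B \<Longrightarrow> openin (mtop (eucl ?E)) {x \<in> A. H x \<in> B}"
    then show thesis using that[of A] W by simp
  qed
  \<comment> \<open>A neighbourhood of \<open>?z\<close> on which the maps in this identity stay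
    inside the two chart domains.\<close>
  define B where "B = {w \<in> AH. H w \<in> ?W} \<inter> ?W \<inter> snd l ` {g \<in> fst l. g1 \<otimes> g \<in> fst l}"
  have "openin (mtop L) {g \<in> points L. g1 \<otimes> g \<in> fst l}"
  proof -
    have "smooth_map L L (\<lambda>g. g1 \<otimes> g)"
      unfolding smooth_map_iff_smooth_near[OF atlas_L atlas_L] points_L using smooth_near_mult_fixed[OF g1G] by blast
    then show ?thesis
      using openin_continuous_map_preimage[OF _ chart_onD(1)[OF ll]] by (auto simp: smooth_map_def)
  qed
  then have "openin (mtop L) ({g \<in> points L. g1 \<otimes> g \<in> fst l} \<inter> fst l)"
    using chart_onD(1)[OF ll] by (rule openin_Int)
  moreover have "{g \<in> points L. g1 \<otimes> g \<in> fst l} \<inter> fst l = {g \<in> fst l. g1 \<otimes> g \<in> fst l}"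
    using lG points_L by auto
  ultimately have B: "openin (top_of_set ?E) B"
    unfolding B_def using AH(3) W chart_image_open[OF ll] by (intro openin_Int) auto
  have zB: "?z \<in> B" using AH(2) Hz w1(1) one g1 g1G l(2) unfolding B_def by auto
  have Beq: "H' (H w) = w" "K (f (H w)) = f w" if w: "w \<in> B" for w
  proof -
    obtain g where g: "g \<in> fst l" "g1 \<otimes> g \<in> fst l" "w = snd l g" "g \<in> carrier G"
      using w lG unfolding B_def by blast
    have Hw: "H w = snd l (g1 \<otimes> g)" using g li by (simp add: H_def)
    show "H' (H w) = w" unfolding H'_def Hw using g g1G li by (simp add: m_assoc[symmetric])
    have "H w \<in> ?W" using w unfolding B_def by blast
    then obtain h where h: "h \<in> ?A" "snd l (g1 \<otimes> g) = snd l h" using Hw by auto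
    then have "h = g1 \<otimes> g" using chart_inj[OF ll] g by (auto dest: inj_onD)
    then have *: "\<alpha> (g1 \<otimes> g) x \<in> fst c" using h by auto
    have "f (H w) = snd c (\<alpha> (g1 \<otimes> g) x)" unfolding Hw f_def using g li by simp
    then have "K (f (H w)) = snd c (\<alpha> (inv g1) (\<alpha> (g1 \<otimes> g) x))" using ci[OF *] unfolding K_def by simp
    then show "K (f (H w)) = f w" using g g1G x li by (simp add: act_mult f_def)
  qed
  have injH: "inj_on DH ?E"
    by (rule eucl_left_inverse_inj[OF E E H H' B zB _ DH(1)]) (rule Beq(1))
  have "openin (mtop M) {y \<in> points M. \<alpha> (inv g1) y \<in> fst c}"
  proof -
    have "smooth_map M M (\<alpha> (inv g1))"
      unfolding smooth_map_iff_smooth_near[OF atlas_M atlas_M] using smooth_near_act_fixed g1G by simp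
    then show ?thesis
      using openin_continuous_map_preimage[OF _ chart_onD(1)[OF cc]] by (auto simp: smooth_map_def)
  qed
  then have "openin (mtop M) ({y \<in> points M. \<alpha> (inv g1) y \<in> fst c} \<inter> fst c)" (is "openin _ ?Y")
    using chart_onD(1)[OF cc] by (rule openin_Int)
  then have Y: "openin (top_of_set ?F) (snd c ` ?Y)" by (rule chart_image_open[OF cc]) auto
  have injK: "inj_on DK ?F"
  proof (rule eucl_left_inverse_inj[OF F F K K' Y _ _ DK])
    show "f w1 \<in> snd c ` ?Y" unfolding f1 using g1 g1G c(2) x by (intro imageI) auto
    show "K' (K u) = u" if "u \<in> snd c ` ?Y" for u using that ci g1G by (auto simp: K_def K'_def)
  qed
  have D1: "(f has_derivative D1) (at (H ?z) within ?E)" using w1(2) Hz by simp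
  have fH: "smooth_near (eucl ?E) (eucl ?F) f (H ?z)" using fsn[OF w1(1)] Hz by simp
  have D1F: "D1 ` ?E \<subseteq> ?F"
    using smooth_near_eucl[OF E F, of f "H ?z"] fH has_derivative_within_subspace_image[OF D1 E F] by blast
  have fHz: "smooth_near (eucl ?E) (eucl ?F) (f \<circ> H) ?z" by (rule smooth_near_compose[OF EL EL EM H fH])
  have DfH: "(f \<circ> H has_derivative D1 \<circ> DH) (at ?z within ?E)" by (rule eucl_chain[OF E E H DH(1) D1])
  have "(K \<circ> (f \<circ> H) has_derivative DK \<circ> (D1 \<circ> DH)) (at ?z within ?E)"
    using DK Hz by (intro eucl_chain[OF E F fHz DfH]) simp
  then have "(f has_derivative DK \<circ> (D1 \<circ> DH)) (at ?z within ?E)"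
    by (rule has_derivative_within_transform_openin[OF _ B zB]) (simp add: Beq(2))
  moreover have "(f has_derivative D) (at ?z within ?E)"
    using D by (simp add: f_def[abs_def] li_def)
  moreover have "?z \<in> ?E" using zB openin_imp_subset[OF B] by blast
  ultimately have eq: "D v = DK (D1 (DH v))" if "v \<in> ?E" for v
    using has_derivative_within_subspace_unique[OF _ _ E _ that] by (metis comp_apply)
  show ?thesis
  proof (rule inj_onI)
    fix u v assume uv: "u \<in> ?E" "v \<in> ?E" "D u = D v"
    then have "DK (D1 (DH u)) = DK (D1 (DH v))" using eq by simp
    moreover have mem: "DH u \<in> ?E" "DH v \<in> ?E" using DH(2) uv by auto
    moreover have "D1 (DH u) \<in> ?F" "D1 (DH v) \<in> ?F" using mem D1F by auto
    ultimately have "D1 (DH u) = D1 (DH v)" using injK by (auto dest: inj_onD)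
    then have "DH u = DH v" using w1(3) mem by (auto dest: inj_onD)
    then show "u = v" using injH uv by (auto dest: inj_onD)
  qed
qed

end

section \<open>Slices\<close>

lemma smooth_near_preimage_open:
  assumes "openin (mtop M) Z" "\<And>z. z \<in> Z \<Longrightarrow> smooth_near M N f z" "openin (mtop N) B"
  shows "openin (mtop M) {z \<in> Z. f z \<in> B}"
proof (subst openin_subopen, intro ballI)
  fix z assume "z \<in> {z \<in> Z. f z \<in> B}"
  then have z: "z \<in> Z" "f z \<in> B" by auto
  show "\<exists>T. openin (mtop M) T \<and> z \<in> T \<and> T \<subseteq> {z \<in> Z. f z \<in> B}"
  proof (rule smooth_near_neighbourhood[OF assms(2)[OF z(1)]])
    fix A assume A: "openin (mtop M) A" "z \<in> A"
      and "\<And>B. openin (mtop N) B \<Longrightarrow> openin (mtop M) {x \<in> A. f x \<in> B}"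
    then have "openin (mtop M) ({x \<in> A. f x \<in> B} \<inter> Z)" using assms(1,3) by (intro openin_Int) auto
    then show ?thesis using A z by (intro exI[of _ "{x \<in> A. f x \<in> B} \<inter> Z"]) auto
  qed
qed

context free_compact_action
begin

definition saturation :: "'a set \<Rightarrow> 'a set" where
  "saturation A = (\<Union>g\<in>carrier G. \<alpha> g ` A)"

text \<open>\<open>s\<close> parametrizes the slice, and \<open>\<rho>\<close> reads off the
  parameter at every point of the saturated open set around it. So \<open>\<rho>\<close> is constant
  on orbits and descends to a chart of the orbit space; no group component is recorded.\<close>

definition is_slice :: "'h::euclidean_space set \<Rightarrow> 'h set \<Rightarrow> ('h \<Rightarrow> 'a) \<Rightarrow> ('a \<Rightarrow> 'h) \<Rightarrow> bool" where
  "is_slice F N s \<rho> \<longleftrightarrow> openin (top_of_set F) N \<and> (\<forall>n\<in>N. smooth_near (eucl F) M s n) \<and>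
     openin (mtop M) (saturation (s ` N)) \<and> (\<forall>p\<in>saturation (s ` N). smooth_near M (eucl F) \<rho> p) \<and>
     (\<forall>g\<in>carrier G. \<forall>n\<in>N. \<rho> (\<alpha> g (s n)) = n)"

text \<open>In charts, the map that sends \<open>(w, n)\<close> to
  \<open>\<alpha> (li w) (s n)\<close> has derivative \<open>k a + B b\<close> at the base point. It
  is injective because the two images meet only in \<open>0\<close>, so the map is a local
  diffeomorphism. This separates orbits of slice points only for group elements near the identity;
  the others form a closed set that moves \<open>x\<close>, and the closed orbit relation excludes
  them.\<close>

lemma slice_exists:
  fixes F :: "'h::euclidean_space set"
  assumes x: "x \<in> points M" and c: "c \<in> smooth_charts M" "x \<in> fst c"
    and l: "l \<in> smooth_charts L" "\<one> \<in> fst l"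
    and k: "((\<lambda>w. snd c (\<alpha> (inv_into (fst l) (snd l) w) x)) has_derivative k) (at (snd l \<one>) within model L)"
    and F: "subspace F" and B: "linear B" "B ` F \<subseteq> model M" "inj_on B F"
    and compl: "k ` model L \<inter> B ` F = {0}" and dim: "dim F + mdim L = mdim M"
    and s: "s = (\<lambda>n. inv_into (fst c) (snd c) (snd c x + B n))"
  obtains N \<rho> where "is_slice F N s \<rho>" "0 \<in> N" "\<And>n. n \<in> N \<Longrightarrow> snd c x + B n \<in> snd c ` fst c"
proof -
  let ?E = "model L" and ?F = "model M" and ?z = "snd l \<one>" and ?p = "snd c x"
  let ?P = "?E \<times> F"
  define li where "li = inv_into (fst l) (snd l)"
  note E = subspace_models(1) and FM = subspace_models(2)
  have P: "subspace ?P" using E F by (rule subspace_Times)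
  note EL = smooth_atlas_eucl[OF E] and EM = smooth_atlas_eucl[OF FM] and EF = smooth_atlas_eucl[OF F]
    and EP = smooth_atlas_eucl[OF P]
  note cc = smooth_charts_chart_on[OF c(1)] and ll = smooth_charts_chart_on[OF l(1)]
  have li: "li (snd l g) = g" if "g \<in> fst l" for g using chart_inv[OF ll that] by (simp add: li_def)
  have lG: "fst l \<subseteq> carrier G" using chart_in_points[OF l(1)] points_L by simp
  have linG: "li w \<in> carrier G" if "w \<in> snd l ` fst l" for w using that li lG by auto
  have s0: "s 0 = x" using chart_inv[OF cc c(2)] linear_0[OF B(1)] by (simp add: s)
  define cN where "cN = {n \<in> F. ?p + B n \<in> snd c ` fst c}"
  have pF: "?p \<in> ?F" using c(2) openin_imp_subset[OF chart_onD(2)[OF cc]] by auto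
  have aff: "smooth_near (eucl F) (eucl ?F) (\<lambda>n. ?p + B n) n" if "n \<in> F" for n
    by (rule smooth_near_eucl_affine[OF F FM B(1,2) pF that])
  have "openin (mtop (eucl F)) {n \<in> F. ?p + B n \<in> snd c ` fst c}"
    by (rule smooth_near_preimage_open[where N = "eucl ?F"]) (use aff chart_onD(2)[OF cc] in auto)
  then have cN: "openin (top_of_set F) cN" by (simp add: cN_def)
  have cs: "snd c (s n) = ?p + B n" "s n \<in> fst c" if "n \<in> cN" for n
    using that by (auto simp: cN_def s f_inv_into_f intro: inv_into_into)
  have sM: "s n \<in> points M" if "n \<in> cN" for n using cs(2)[OF that] chart_in_points[OF c(1)] by auto
  have ssn: "smooth_near (eucl F) M s n" if "n \<in> cN" for n
  proof -
    have "smooth_near (eucl F) M (inv_into (fst c) (snd c) \<circ> (\<lambda>n. ?p + B n)) n"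
      by (rule smooth_near_compose[OF EF EM atlas_M aff smooth_near_inv_chart[OF atlas_M c(1)]])
        (use that in \<open>auto simp: cN_def\<close>)
    then show ?thesis by (simp add: s o_def)
  qed
  have zero: "0 \<in> cN" using c(2) linear_0[OF B(1)] subspace_0[OF F] by (simp add: cN_def)
  define Z where "Z = (snd l ` fst l) \<times> cN"
  have Z: "openin (top_of_set ?P) Z"
    unfolding Z_def using chart_onD(2)[OF ll] cN by (rule openin_Times)
  have ZP: "Z \<subseteq> ?P" using openin_imp_subset[OF Z] .
  define m where "m z = \<alpha> (li (fst z)) (s (snd z))" for z
  have msn: "smooth_near (eucl ?P) M m z" if "z \<in> Z" for z
  proof -
    have z: "fst z \<in> snd l ` fst l" "snd z \<in> cN" "z \<in> ?P" using that ZP by (auto simp: Z_def)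
    have "smooth_near (eucl ?P) L (li \<circ> fst) z"
      by (rule smooth_near_compose[OF EP EL atlas_L smooth_near_eucl_linear[OF P E linear_fst _ z(3)]
            smooth_near_inv_chart[OF atlas_L l(1) z(1), folded li_def]]) auto
    moreover have "smooth_near (eucl ?P) M (s \<circ> snd) z"
      by (rule smooth_near_compose[OF EP EF atlas_M smooth_near_eucl_linear[OF P F linear_snd _ z(3)] ssn[OF z(2)]]) auto
    ultimately have "smooth_near (eucl ?P) M (\<lambda>z. \<alpha> ((li \<circ> fst) z) ((s \<circ> snd) z)) z"
      by (rule smooth_near_act[OF EP])
    then show ?thesis by (simp add: m_def[abs_def])
  qed
  define S where "S = {z \<in> Z. m z \<in> fst c}"
  have S: "openin (top_of_set ?P) S"
    using smooth_near_preimage_open[of "eucl ?P" Z M m "fst c"] Z msn chart_onD(1)[OF cc] by (simp add: S_def)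
  have z1: "(?z, 0) \<in> S" using zero c(2) l(2) x li s0 by (simp add: S_def Z_def m_def)
  define \<Psi> where "\<Psi> z = snd c (m z)" for z
  have Psn: "smooth_near (eucl ?P) (eucl ?F) \<Psi> z" if "z \<in> S" for z
  proof -
    have "smooth_near (eucl ?P) (eucl ?F) (snd c \<circ> m) z"
      by (rule smooth_near_compose[OF EP atlas_M EM msn smooth_near_chart[OF atlas_M c(1)]])
        (use that in \<open>auto simp: S_def\<close>)
    then show ?thesis by (simp add: \<Psi>_def[abs_def] o_def)
  qed
  have Ps: "smooth_on \<Psi> S" by (rule smooth_on_if_smooth_near[OF P FM S Psn])
  have PF: "\<Psi> ` S \<subseteq> ?F" using smooth_near_points(2)[OF Psn] by auto
  obtain D where D: "linear D" "(\<Psi> has_derivative D) (at (?z, 0) within ?P)"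
    by (rule smooth_near_eucl_derivative[OF P FM Psn[OF z1]]) (rule that)
  have zE: "?z \<in> ?E" using l(2) openin_imp_subset[OF chart_onD(2)[OF ll]] by auto
  \<comment> \<open>On \<open>n = 0\<close> the map \<open>\<Psi>\<close> is the orbit map of
    \<open>x\<close> in charts, since \<open>s 0 = x\<close>.\<close>
  have Dk: "D (a, 0) = k a" if "a \<in> ?E" for a
  proof -
    have lin: "linear (\<lambda>w::'f. (w, 0::'h))" by (auto intro!: linearI)
    have i: "smooth_near (eucl ?E) (eucl ?P) (\<lambda>w. (w, 0)) ?z"
      by (rule smooth_near_eucl_linear[OF E P lin _ zE]) (use subspace_0[OF F] in auto)
    have di: "((\<lambda>w::'f. (w, 0::'h)) has_derivative (\<lambda>w. (w, 0))) (at ?z within ?E)"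
      by (rule linear_imp_has_derivative[OF lin])
    have eq: "\<Psi> \<circ> (\<lambda>w. (w, 0)) = (\<lambda>w. snd c (\<alpha> (li w) x))" by (auto simp: \<Psi>_def m_def s0)
    have "((\<lambda>w. snd c (\<alpha> (li w) x)) has_derivative D \<circ> (\<lambda>w. (w, 0))) (at ?z within ?E)"
      using eucl_chain[OF E P i di, of \<Psi> D] D(2) by (simp add: eq)
    from has_derivative_within_subspace_unique[OF this k[folded li_def] E zE that] show ?thesis by simp
  qed
  \<comment> \<open>Over the identity of \<open>G\<close> the map \<open>\<Psi>\<close> is the chart
    expression of \<open>s\<close>, which is affine by construction.\<close>
  have DB: "D (0, b) = B b" if "b \<in> F" for b
  proof -
    have lin: "linear (\<lambda>n::'h. (0::'f, n))" by (auto intro!: linearI)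
    have i: "smooth_near (eucl F) (eucl ?P) (\<lambda>n. (?z, 0) + (0, n)) 0"
      by (rule smooth_near_eucl_affine[OF F P lin]) (use subspace_0[OF F] subspace_0[OF E] zE in auto)
    have di: "((\<lambda>n::'h. (?z, 0) + (0::'f, n)) has_derivative (\<lambda>n. (0, n))) (at 0 within F)"
      by (rule has_derivative_affine[OF lin])
    have "(\<Psi> \<circ> (\<lambda>n. (?z, 0) + (0, n)) has_derivative D \<circ> (\<lambda>n. (0, n))) (at 0 within F)"
      using eucl_chain[OF F P i di, of \<Psi> D] D(2) by simp
    then have "((\<lambda>n. ?p + B n) has_derivative D \<circ> (\<lambda>n. (0, n))) (at 0 within F)"
      by (rule has_derivative_within_transform_openin[OF _ cN zero])
        (use li[OF l(2)] sM cs in \<open>simp add: \<Psi>_def m_def\<close>)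
    from has_derivative_within_subspace_unique[OF this has_derivative_affine[OF B(1)] F subspace_0[OF F] that]
    show ?thesis by simp
  qed
  have link: "linear k" using k by (rule has_derivative_linear)
  have injk: "inj_on k ?E" by (rule orbit_map_immersive[OF x c l k])
  have injD: "inj_on D ?P"
    unfolding linear_inj_on_iff_eq_0[OF D(1) P]
  proof (intro ballI impI)
    fix u assume u: "u \<in> ?P" "D u = 0"
    then obtain a b where ab: "u = (a, b)" "a \<in> ?E" "b \<in> F" by auto
    have "D ((a, 0) + (0, b)) = k a + B b" unfolding linear_add[OF D(1)] using Dk DB ab by simp
    then have z: "k a + B b = 0" using u(2) ab(1) by simp
    then have "k (- a) = B b" using linear_neg[OF link] by (simp add: neg_eq_iff_add_eq_0)
    then have "k (- a) \<in> k ` ?E \<inter> B ` F" using ab E subspace_neg by fastforce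
    then have "k (- a) = 0" using compl by blast
    then have "B b = 0" "k a = 0" using \<open>k (- a) = B b\<close> z by auto
    then show "u = 0"
      using ab injk B(3) linear_inj_on_iff_eq_0[OF link E] linear_inj_on_iff_eq_0[OF B(1) F]
      by (auto simp: zero_prod_def)
  qed
  have "dim ?P = mdim M" using dim_Times[OF E F] dim by simp
  then obtain U V g where UV: "openin (top_of_set ?P) U" "(?z, 0) \<in> U" "U \<subseteq> S"
    "openin (top_of_set ?F) V" "\<Psi> (?z, 0) \<in> V" "\<Psi> ` U \<subseteq> V" "g ` V \<subseteq> U"
    "\<And>u. u \<in> U \<Longrightarrow> g (\<Psi> u) = u" "\<And>v. v \<in> V \<Longrightarrow> \<Psi> (g v) = v" "smooth_on g V"
    by (rule smooth_inverse_function_subspace[OF P FM _ S z1 Ps PF D(2) injD]) (rule that)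
  have "openin (prod_topology (top_of_set ?E) (top_of_set F)) U" using UV(1) by simp
  then obtain W0 N0 where WN: "openin (top_of_set ?E) W0" "openin (top_of_set F) N0" "?z \<in> W0" "0 \<in> N0" "W0 \<times> N0 \<subseteq> U"
    using UV(2) unfolding openin_prod_topology_alt by meson
  have N0c: "N0 \<subseteq> cN"
  proof
    fix n assume "n \<in> N0"
    then have "(?z, n) \<in> S" using WN UV(3) by blast
    then show "n \<in> cN" by (simp add: S_def Z_def)
  qed
  define W where "W = {h \<in> fst l. snd l h \<in> W0}"
  have W: "openin (mtop L) W" unfolding W_def by (rule chart_preimage_open[OF ll WN(1)])
  \<comment> \<open>Group elements away from the identity. By freeness none of them fixes
    \<open>x\<close>, so some product neighbourhood \<open>O1 \<times> O2\<close> of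
    \<open>(x, x)\<close> avoids all pairs that they relate.\<close>
  define C where "C = points L - W"
  have C: "closedin (mtop L) C" unfolding C_def by (rule closedin_diff[OF closedin_topspace W])
  let ?R = "{(x, y). x \<in> points M \<and> y \<in> points M \<and> (\<exists>g\<in>C. \<alpha> g x = y)}"
  let ?MM = "prod_topology (mtop M) (mtop M)"
  have "openin ?MM (topspace ?MM - ?R)" by (rule openin_diff[OF openin_topspace closed_orbit_relation[OF C]])
  moreover have "(x, x) \<in> topspace ?MM - ?R"
  proof -
    have "\<one> \<in> W" using l(2) WN(3) by (simp add: W_def)
    then have "\<not> (\<exists>g\<in>C. \<alpha> g x = x)" using free x by (auto simp: C_def points_L)
    then show ?thesis using x by simp
  qed
  ultimately obtain O1 O2 where O12: "openin (mtop M) O1" "openin (mtop M) O2" "x \<in> O1" "x \<in> O2"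
      "O1 \<times> O2 \<subseteq> topspace ?MM - ?R"
    unfolding openin_prod_topology_alt by meson
  define N where "N = {n \<in> N0. s n \<in> O1 \<inter> O2}"
  have "openin (mtop (eucl F)) {n \<in> N0. s n \<in> O1 \<inter> O2}"
    by (rule smooth_near_preimage_open[where N = M]) (use WN(2) O12 N0c ssn in auto)
  then have N: "openin (top_of_set F) N" by (simp add: N_def)
  have NN0: "N \<subseteq> N0" "N \<subseteq> cN" using N0c by (auto simp: N_def)
  \<comment> \<open>The element \<open>h\<close> relates two points of
    \<open>O1 \<inter> O2\<close>, so it lies in \<open>W\<close>. Then \<open>(snd l h, n)\<close>
    and \<open>(?z, n')\<close> both lie in \<open>U\<close>, where \<open>\<Psi>\<close> is
    injective.\<close>
  have inj: "n = n'" if n: "n \<in> N" "n' \<in> N" and a: "a \<in> carrier G" "b \<in> carrier G" "\<alpha> a (s n) = \<alpha> b (s n')" for n n' a b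
  proof -
    have sn: "s n \<in> points M" "s n' \<in> points M" using sM NN0(2) n by auto
    define h where "h = inv b \<otimes> a"
    have h: "h \<in> carrier G" "\<alpha> h (s n) = s n'" using a sn by (auto simp: h_def act_mult)
    have "(s n, s n') \<notin> ?R" using O12(5) n by (auto simp: N_def)
    then have "h \<in> W" using h sn by (auto simp: C_def points_L)
    then have hl: "h \<in> fst l" "snd l h \<in> W0" by (auto simp: W_def)
    have "\<Psi> (snd l h, n) = \<Psi> (?z, n')" using h li[OF hl(1)] li[OF l(2)] sn by (simp add: \<Psi>_def m_def)
    moreover have "(snd l h, n) \<in> U" "(?z, n') \<in> U" using hl WN n NN0 by auto
    ultimately have "(snd l h, n) = (?z, n')" using UV(8) by metis
    then show ?thesis by simp
  qed
  define \<rho> where "\<rho> p = (THE n. n \<in> N \<and> (\<exists>g\<in>carrier G. p = \<alpha> g (s n)))" for p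
  have \<rho>: "\<rho> (\<alpha> a (s n)) = n" if "a \<in> carrier G" "n \<in> N" for a n
    unfolding \<rho>_def by (rule the_equality) (use that inj in blast)+
  define V' where "V' = {v \<in> V. g v \<in> W0 \<times> N}"
  have gsn: "smooth_near (eucl ?F) (eucl ?P) g v" if "v \<in> V" for v
    unfolding smooth_near_eucl[OF FM P]
    using UV(1,4,7,10) openin_imp_subset[OF UV(1)] that by (intro exI[of _ V]) auto
  have "openin (mtop (eucl ?F)) {v \<in> V. g v \<in> W0 \<times> N}"
    by (rule smooth_near_preimage_open[where N = "eucl ?P"]) (use UV(4) gsn openin_Times[OF WN(1) N] in auto)
  then have V': "openin (top_of_set ?F) V'" by (simp add: V'_def)
  \<comment> \<open>An open set whose points are written as \<open>\<alpha> h (s n)\<close> with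
    \<open>n \<in> N\<close> by means of the local inverse \<open>g\<close>. It contains the slice
    and has the same saturation, which is therefore open.\<close>
  define Y where "Y = {y \<in> fst c. snd c y \<in> V'}"
  have Y: "openin (mtop M) Y" unfolding Y_def by (rule chart_preimage_open[OF cc V'])
  have Yeq: "li (fst (g (snd c y))) \<in> carrier G" "snd (g (snd c y)) \<in> N"
    "y = \<alpha> (li (fst (g (snd c y)))) (s (snd (g (snd c y))))" if "y \<in> Y" for y
  proof -
    have y: "y \<in> fst c" "snd c y \<in> V" "g (snd c y) \<in> W0 \<times> N" using that by (auto simp: Y_def V'_def)
    then have gS: "g (snd c y) \<in> S" using UV(3,7) by auto
    then show "li (fst (g (snd c y))) \<in> carrier G" using linG by (auto simp: S_def Z_def)
    show "snd (g (snd c y)) \<in> N" using y(3) by auto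
    have "snd c (m (g (snd c y))) = snd c y" using UV(9)[OF y(2)] by (simp add: \<Psi>_def)
    then have "m (g (snd c y)) = y" using gS y(1) chart_inj[OF cc] by (auto simp: S_def dest: inj_onD)
    then show "y = \<alpha> (li (fst (g (snd c y)))) (s (snd (g (snd c y))))" by (simp add: m_def)
  qed
  have sY: "s n \<in> Y" if "n \<in> N" for n
  proof -
    have u: "(?z, n) \<in> U" using that NN0 WN by auto
    have "\<Psi> (?z, n) = snd c (s n)" using that NN0 sM li[OF l(2)] by (auto simp: \<Psi>_def m_def)
    then have "snd c (s n) \<in> V" "g (snd c (s n)) = (?z, n)" using UV(6,8) u by (metis image_subset_iff, metis)
    then show ?thesis using cs(2)[of n] that NN0 WN(3) by (auto simp: Y_def V'_def)
  qed
  have YM: "Y \<subseteq> points M" using chart_in_points[OF c(1)] by (auto simp: Y_def)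
  have satY: "saturation (s ` N) = saturation Y"
  proof (intro equalityI subsetI)
    fix p assume "p \<in> saturation (s ` N)"
    then show "p \<in> saturation Y" using sY by (auto simp: saturation_def)
  next
    fix p assume "p \<in> saturation Y"
    then obtain a y where a: "a \<in> carrier G" "y \<in> Y" "p = \<alpha> a y" by (auto simp: saturation_def)
    define h n where "h = li (fst (g (snd c y)))" and "n = snd (g (snd c y))"
    have hn: "h \<in> carrier G" "n \<in> N" "y = \<alpha> h (s n)" using Yeq[OF a(2)] by (simp_all add: h_def n_def)
    then have "p = \<alpha> (a \<otimes> h) (s n)" using a sM NN0 by (auto simp: act_mult)
    then show "p \<in> saturation (s ` N)" using a hn unfolding saturation_def by blast
  qed
  have "openin (mtop M) (saturation Y)"
    unfolding saturation_def by (intro openin_Union ballI) (auto intro: open_act_image[OF Y])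
  \<comment> \<open>Near \<open>p = \<alpha> a (s n)\<close>, translation by \<open>inv a\<close>
    leads into \<open>Y\<close>, where \<open>\<rho>\<close> is the second component of
    \<open>g\<close> in the chart \<open>c\<close>. As \<open>\<rho>\<close> is constant on orbits,
    this is also its value before the translation.\<close>
  moreover have "smooth_near M (eucl F) \<rho> p" if "p \<in> saturation (s ` N)" for p
  proof -
    obtain a n where p: "a \<in> carrier G" "n \<in> N" "p = \<alpha> a (s n)"
      using \<open>p \<in> saturation (s ` N)\<close> by (auto simp: saturation_def)
    have pM: "p \<in> points M" using p sM NN0 by auto
    have ip: "\<alpha> (inv a) p = s n" using p sM NN0 by auto
    have cs': "s n \<in> fst c" "snd c (s n) \<in> V" using sY[OF p(2)] by (auto simp: Y_def V'_def)
    have gP: "g (snd c (s n)) \<in> ?P" using cs'(2) UV(7) openin_imp_subset[OF UV(1)] by auto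
    have 1: "smooth_near M (eucl ?F) (snd c \<circ> \<alpha> (inv a)) p"
      by (rule smooth_near_compose[OF atlas_M atlas_M EM smooth_near_act_fixed smooth_near_chart[OF atlas_M c(1)]])
        (use p pM ip cs' in auto)
    have 2: "smooth_near M (eucl ?P) (g \<circ> (snd c \<circ> \<alpha> (inv a))) p"
      by (rule smooth_near_compose[OF atlas_M EM EP 1 gsn]) (use ip cs' in auto)
    have 3: "smooth_near M (eucl F) (snd \<circ> (g \<circ> (snd c \<circ> \<alpha> (inv a)))) p"
      by (rule smooth_near_compose[OF atlas_M EP EF 2 smooth_near_eucl_linear[OF P F linear_snd]])
        (use ip gP in auto)
    show ?thesis
    proof (rule smooth_near_cong[OF atlas_M 3 open_act_image[OF Y p(1)]])
      show "p \<in> \<alpha> a ` Y" using p sY by auto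
      fix q assume "q \<in> \<alpha> a ` Y"
      then obtain y where y: "y \<in> Y" "q = \<alpha> a y" by auto
      then have iq: "\<alpha> (inv a) q = y" using p(1) YM by auto
      define h n where "h = li (fst (g (snd c y)))" and "n = snd (g (snd c y))"
      have hn: "h \<in> carrier G" "n \<in> N" "y = \<alpha> h (s n)" using Yeq[OF y(1)] by (simp_all add: h_def n_def)
      then have "q = \<alpha> (a \<otimes> h) (s n)" using p(1) y sM NN0 by (auto simp: act_mult)
      then have "\<rho> q = n" using \<rho> p(1) hn by simp
      then show "(snd \<circ> (g \<circ> (snd c \<circ> \<alpha> (inv a)))) q = \<rho> q" using iq by (simp add: n_def)
    qed
  qed
  ultimately have "is_slice F N s \<rho>"
    unfolding is_slice_def using N NN0 ssn satY \<rho> by auto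
  moreover have "0 \<in> N" using WN(4) O12 s0 by (simp add: N_def)
  ultimately show ?thesis using that[of N \<rho>] NN0 by (auto simp: cN_def)
qed

end

section \<open>Domains of local representatives and membership in the maximal atlas\<close>

lemma local_dom_open:
  assumes f: "continuous_map (mtop M) (mtop N) f" and c: "c \<in> smooth_charts M" and d: "d \<in> smooth_charts N"
  shows "openin (top_of_set (model M)) (local_dom c d f)"
proof -
  note cc = smooth_charts_chart_on[OF c] and dd = smooth_charts_chart_on[OF d]
  have "openin (mtop M) ({x \<in> points M. f x \<in> fst d} \<inter> fst c)"
    using openin_continuous_map_preimage[OF f chart_onD(1)[OF dd]] chart_onD(1)[OF cc] by (rule openin_Int)
  moreover have "{x \<in> points M. f x \<in> fst d} \<inter> fst c = {x \<in> fst c. f x \<in> fst d}"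
    using chart_in_points[OF c] by auto
  ultimately show ?thesis unfolding local_dom_def using chart_image_open[OF cc] by auto
qed

lemma at_within_local_dom:
  assumes "continuous_map (mtop M) (mtop N) f" "c \<in> smooth_charts M" "d \<in> smooth_charts N"
    "p \<in> fst c" "f p \<in> fst d"
  shows "at (snd c p) within local_dom c d f = at (snd c p) within model M"
  by (rule at_within_openin[OF local_dom_open[OF assms(1-3)]]) (use assms in \<open>auto simp: local_dom_def\<close>)

lemma smooth_near_into_chart:
  assumes M: "smooth_atlas M" "smooth_atlas N" and d: "d \<in> smooth_charts N"
    and A: "openin (mtop M) A" "p \<in> A" "f ` A \<subseteq> fst d"
    and f: "smooth_near M (eucl (model N)) (snd d \<circ> f) p"
  shows "smooth_near M N f p"
proof -
  have E: "smooth_atlas (eucl (model N))" using M(2) smooth_atlas_eucl by (auto simp: smooth_atlas_def)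
  have "smooth_near M N (inv_into (fst d) (snd d) \<circ> (snd d \<circ> f)) p"
    by (rule smooth_near_compose[OF M(1) E M(2) f smooth_near_inv_chart[OF M(2) d]]) (use A in auto)
  then show ?thesis
    by (rule smooth_near_cong[OF M(1) _ A(1,2)])
      (use A(3) chart_inv[OF smooth_charts_chart_on[OF d]] in auto)
qed

text \<open>If the chart and its inverse are smooth as maps, its transition maps with atlas charts
  are composites of smooth maps through \<open>M\<close>.\<close>

lemma smooth_chartsI:
  assumes M: "smooth_atlas M" and c: "chart_on (mtop M) (model M) c"
    and f: "\<And>p. p \<in> fst c \<Longrightarrow> smooth_near M (eucl (model M)) (snd c) p"
    and g: "\<And>z. z \<in> snd c ` fst c \<Longrightarrow> smooth_near (eucl (model M)) M (inv_into (fst c) (snd c)) z"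
  shows "c \<in> smooth_charts M"
proof -
  have E: "subspace (model M)" using M by (simp add: smooth_atlas_def)
  note EE = smooth_atlas_eucl[OF E]
  have "compatible_charts c d" if d: "d \<in> atlas M" for d
  proof -
    have d': "d \<in> smooth_charts M" using d atlas_subset_smooth_charts[OF M] by blast
    note dd = smooth_charts_chart_on[OF d']
    have cd: "openin (mtop M) (fst c \<inter> fst d)"
      using chart_onD(1)[OF c] chart_onD(1)[OF dd] by (rule openin_Int)
    have 1: "local_dom c d id = snd c ` (fst c \<inter> fst d)" "local_dom d c id = snd d ` (fst c \<inter> fst d)"
      by (auto simp: local_dom_def)
    have "smooth_on (local_rep c d id) (local_dom c d id)"
    proof (rule smooth_on_if_smooth_near[OF E E])
      show "openin (top_of_set (model M)) (local_dom c d id)"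
        unfolding 1 by (rule chart_image_open[OF c cd]) auto
      fix z assume "z \<in> local_dom c d id"
      then obtain x where x: "x \<in> fst c" "x \<in> fst d" "z = snd c x" by (auto simp: 1)
      have "smooth_near (eucl (model M)) (eucl (model M)) (snd d \<circ> inv_into (fst c) (snd c)) z"
        by (rule smooth_near_compose[OF EE M EE g smooth_near_chart[OF M d']])
          (use x chart_inv[OF c x(1)] in auto)
      then show "smooth_near (eucl (model M)) (eucl (model M)) (local_rep c d id) z"
        by (simp add: local_rep_def)
    qed
    moreover have "smooth_on (local_rep d c id) (local_dom d c id)"
    proof (rule smooth_on_if_smooth_near[OF E E])
      show "openin (top_of_set (model M)) (local_dom d c id)"
        unfolding 1 by (rule chart_image_open[OF dd cd]) auto
      fix z assume "z \<in> local_dom d c id"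
      then obtain x where x: "x \<in> fst c" "x \<in> fst d" "z = snd d x" by (auto simp: 1)
      have "smooth_near (eucl (model M)) (eucl (model M)) (snd c \<circ> inv_into (fst d) (snd d)) z"
        by (rule smooth_near_compose[OF EE M EE smooth_near_inv_chart[OF M d'] f])
          (use x chart_inv[OF dd x(2)] in auto)
      then show "smooth_near (eucl (model M)) (eucl (model M)) (local_rep d c id) z"
        by (simp add: local_rep_def)
    qed
    ultimately show ?thesis by (simp add: compatible_charts_def)
  qed
  then show ?thesis using c by (simp add: smooth_charts_def)
qed

section \<open>Quotient manifolds\<close>

context free_compact_action
begin

section \<open>Topology of the orbit space\<close>

abbreviation \<pi> :: "'a \<Rightarrow> 'a set" where "\<pi> \<equiv> orbit G \<alpha>"

lemma pi_in_image_iff: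
  assumes "A \<subseteq> points M" "p \<in> points M"
  shows "\<pi> p \<in> \<pi> ` A \<longleftrightarrow> p \<in> saturation A"
proof
  assume "\<pi> p \<in> \<pi> ` A"
  then obtain a where a: "a \<in> A" "\<pi> a = \<pi> p" by auto
  then obtain g where "g \<in> carrier G" "p = \<alpha> g a" using orbit_eq_iff[of a p] assms by auto
  then show "p \<in> saturation A" using a by (auto simp: saturation_def)
next
  assume "p \<in> saturation A"
  then obtain g a where "g \<in> carrier G" "a \<in> A" "p = \<alpha> g a" by (auto simp: saturation_def)
  then show "\<pi> p \<in> \<pi> ` A" using assms(1) by (auto simp: subset_iff)
qed

lemma saturation_subset: "A \<subseteq> points M \<Longrightarrow> saturation A \<subseteq> points M"
  by (auto simp: saturation_def)

lemma subset_saturation: "A \<subseteq> points M \<Longrightarrow> A \<subseteq> saturation A"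
proof
  fix a assume "A \<subseteq> points M" "a \<in> A"
  then have "a = \<alpha> \<one> a" by auto
  then show "a \<in> saturation A" using \<open>a \<in> A\<close> by (auto simp: saturation_def)
qed

lemma pi_preimage_image: "A \<subseteq> points M \<Longrightarrow> {p \<in> points M. \<pi> p \<in> \<pi> ` A} = saturation A"
  using pi_in_image_iff saturation_subset by blast

lemma open_saturation:
  assumes "openin (mtop M) A"
  shows "openin (mtop M) (saturation A)"
  unfolding saturation_def by (intro openin_Union ballI) (auto intro: open_act_image[OF assms])

text \<open>The preimage of the image of an open set is its saturation, a union of translates, hence
  open.\<close>

lemma quotient_open_map:
  assumes "quotient_map (mtop M) T \<pi>"
  shows "open_map (mtop M) T \<pi>"
  unfolding open_map_def
proof (intro allI impI)
  fix A assume A: "openin (mtop M) A"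
  then have "A \<subseteq> points M" by (rule openin_subset)
  moreover from this have "\<pi> ` A \<subseteq> topspace T" using assms by (auto simp: quotient_map_def)
  ultimately show "openin T (\<pi> ` A)"
    using assms open_saturation[OF A] pi_preimage_image unfolding quotient_map_def by metis
qed

text \<open>A pair of points on distinct orbits lies off the orbit relation, which is closed since
  \<open>G\<close> is compact; a product neighbourhood off the relation projects to disjoint open
  sets.\<close>

lemma quotient_Hausdorff:
  assumes T: "quotient_map (mtop M) T \<pi>"
  shows "Hausdorff_space T"
  unfolding Hausdorff_space_def
proof (intro allI impI)
  fix q r assume qr: "q \<in> topspace T \<and> r \<in> topspace T \<and> q \<noteq> r"
  moreover have "topspace T = \<pi> ` points M" using T by (simp add: quotient_map_def)
  ultimately have "q \<in> \<pi> ` points M" "r \<in> \<pi> ` points M" by simp_all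
  then obtain x y where xy: "x \<in> points M" "y \<in> points M" "q = \<pi> x" "r = \<pi> y"
    by (elim imageE)
  let ?R = "{(x, y). x \<in> points M \<and> y \<in> points M \<and> (\<exists>g\<in>points L. \<alpha> g x = y)}"
  let ?MM = "prod_topology (mtop M) (mtop M)"
  have "openin ?MM (topspace ?MM - ?R)"
    by (rule openin_diff[OF openin_topspace closed_orbit_relation[OF closedin_topspace]])
  moreover have "(x, y) \<in> topspace ?MM - ?R"
    using qr xy orbit_eq_iff[of x y] by (auto simp: points_L)
  ultimately obtain U V where UV: "openin (mtop M) U" "openin (mtop M) V" "x \<in> U" "y \<in> V"
      "U \<times> V \<subseteq> topspace ?MM - ?R"
    unfolding openin_prod_topology_alt by meson
  have sub: "U \<subseteq> points M" "V \<subseteq> points M" using UV openin_subset by auto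
  have "\<pi> ` U \<inter> \<pi> ` V = {}"
  proof (rule ccontr)
    assume "\<pi> ` U \<inter> \<pi> ` V \<noteq> {}"
    then obtain u v where uv: "u \<in> U" "v \<in> V" "\<pi> u = \<pi> v" by auto
    then obtain g where "g \<in> carrier G" "v = \<alpha> g u" using orbit_eq_iff[of u v] sub by auto
    moreover have "(u, v) \<in> topspace ?MM - ?R" using UV(5) uv by blast
    ultimately show False using uv sub by (auto simp: points_L)
  qed
  moreover have "openin T (\<pi> ` U)" "openin T (\<pi> ` V)"
    using quotient_open_map[OF T] UV(1,2) by (simp_all add: open_map_def)
  moreover have "q \<in> \<pi> ` U" "r \<in> \<pi> ` V" unfolding xy(3,4) by (rule imageI[OF UV(3)], rule imageI[OF UV(4)])
  ultimately show "\<exists>U V. openin T U \<and> openin T V \<and> q \<in> U \<and> r \<in> V \<and> disjnt U V"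
    unfolding disjnt_def by (intro exI[of _ "\<pi> ` U"] exI[of _ "\<pi> ` V"] conjI)
qed

lemma quotient_second_countable:
  assumes T: "quotient_map (mtop M) T \<pi>"
  shows "second_countable T"
  using second_countable_open_map_image[OF quotient_imp_continuous_map[OF T] quotient_open_map[OF T]] T manifold
  by (simp add: quotient_map_def smooth_manifold_def)

section \<open>Slice charts and existence of the orbit manifold\<close>

lemma orbit_derivative_exists:
  assumes "x \<in> points M" "c \<in> smooth_charts M" "x \<in> fst c"
  obtains l k where "l \<in> smooth_charts L" "\<one> \<in> fst l"
    "((\<lambda>w. snd c (\<alpha> (inv_into (fst l) (snd l) w) x)) has_derivative k) (at (snd l \<one>) within model L)"
    "linear k" "k ` model L \<subseteq> model M" "inj_on k (model L)" "dim (k ` model L) = mdim L" "mdim L \<le> mdim M"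
proof -
  obtain l where l: "l \<in> smooth_charts L" "\<one> \<in> fst l"
    using atlas_chart_at[OF atlas_L] points_L one_closed by metis
  have "inv_into (fst l) (snd l) (snd l \<one>) = \<one>" using chart_inv[OF smooth_charts_chart_on[OF l(1)] l(2)] .
  then have "smooth_near (eucl (model L)) (eucl (model M)) (\<lambda>w. snd c (\<alpha> (inv_into (fst l) (snd l) w) x)) (snd l \<one>)"
    using assms l by (intro orbit_map_smooth_near[where y = x]) auto
  then obtain k where k: "linear k"
    "((\<lambda>w. snd c (\<alpha> (inv_into (fst l) (snd l) w) x)) has_derivative k) (at (snd l \<one>) within model L)"
    "k ` model L \<subseteq> model M"
    by (rule smooth_near_eucl_derivative[OF subspace_models]) (rule that)
  have inj: "inj_on k (model L)" by (rule orbit_map_immersive[OF assms l k(2)])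
  then have dim: "dim (k ` model L) = mdim L"
    using dim_image_eq[OF k(1), of "model L"] subspace_models(1) by (simp add: span_eq_iff[THEN iffD2])
  show ?thesis using that[OF l k(2,1,3) inj dim] dim_subset[OF k(3)] dim by simp
qed

text \<open>Records how slice, chart and orbit fit together: in \<open>c\<close> the slice is affine
  with direction \<open>B\<close>, and \<open>k\<close> parametrizes the tangent space of the orbit
  at \<open>x\<close>. Condition (B) needs these relations and not just some slice.\<close>

definition adapted_slice where
  "adapted_slice c x F l k B N \<rho> \<longleftrightarrow> l \<in> smooth_charts L \<and> \<one> \<in> fst l \<and>
    ((\<lambda>w. snd c (\<alpha> (inv_into (fst l) (snd l) w) x)) has_derivative k) (at (snd l \<one>) within model L) \<and>
    inj_on k (model L) \<and> k ` model L \<subseteq> model M \<and> dim (k ` model L) = mdim L \<and>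
    linear B \<and> B ` F \<subseteq> model M \<and> inj_on B F \<and> k ` model L \<inter> B ` F = {0} \<and>
    is_slice F N (\<lambda>n. inv_into (fst c) (snd c) (snd c x + B n)) \<rho> \<and> 0 \<in> N \<and>
    (\<forall>n\<in>N. snd c x + B n \<in> snd c ` fst c)"

lemma adapted_slice_exists:
  fixes F :: "'e set"
  assumes x: "x \<in> points M" and c: "c \<in> smooth_charts M" "x \<in> fst c"
    and F: "subspace F" and dim: "dim F + mdim L = mdim M"
  shows "\<exists>l k B N \<rho>. adapted_slice c x F l k B N \<rho>"
proof -
  obtain l k where l: "l \<in> smooth_charts L" "\<one> \<in> fst l"
    and k: "((\<lambda>w. snd c (\<alpha> (inv_into (fst l) (snd l) w) x)) has_derivative k) (at (snd l \<one>) within model L)"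
    "linear k" "k ` model L \<subseteq> model M" "inj_on k (model L)" "dim (k ` model L) = mdim L"
    by (rule orbit_derivative_exists[OF x c]) (rule that)
  have sub: "subspace (k ` model L)" using k(2) subspace_models(1) linear_subspace_image by blast
  have dim': "dim F + dim (k ` model L) = mdim M" using dim k(5) by simp
  obtain B where B: "linear B" "B ` F \<subseteq> model M" "inj_on B F" "k ` model L \<inter> B ` F = {0}"
    by (rule ex_linear_complement[OF subspace_models(2) F sub k(3) dim']) (rule that)
  obtain N \<rho> where "is_slice F N (\<lambda>n. inv_into (fst c) (snd c) (snd c x + B n)) \<rho>" "0 \<in> N"
    "\<And>n. n \<in> N \<Longrightarrow> snd c x + B n \<in> snd c ` fst c"
    by (rule slice_exists[OF x c l k(1) F B dim refl]) (rule that)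
  then have "adapted_slice c x F l k B N \<rho>" unfolding adapted_slice_def using l k B by blast
  then show ?thesis by blast
qed

text \<open>A point of the orbit space is an orbit, hence a set. Any representative may be chosen
  because \<open>\<rho>\<close> is constant on the orbits that meet the slice.\<close>

definition slice_chart :: "'h set \<Rightarrow> ('h \<Rightarrow> 'a) \<Rightarrow> ('a \<Rightarrow> 'h) \<Rightarrow> ('a set, 'h) chart" where
  "slice_chart N s \<rho> = (\<pi> ` s ` N, \<lambda>q. \<rho> (SOME p. p \<in> q))"

lemma is_sliceD:
  assumes "is_slice F N s \<rho>"
  shows "openin (top_of_set F) N" "\<And>n. n \<in> N \<Longrightarrow> smooth_near (eucl F) M s n"
    "openin (mtop M) (saturation (s ` N))" "\<And>p. p \<in> saturation (s ` N) \<Longrightarrow> smooth_near M (eucl F) \<rho> p"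
    "\<And>g n. g \<in> carrier G \<Longrightarrow> n \<in> N \<Longrightarrow> \<rho> (\<alpha> g (s n)) = n" "\<And>n. n \<in> N \<Longrightarrow> s n \<in> points M"
    "\<And>n. n \<in> N \<Longrightarrow> \<rho> (s n) = n"
proof -
  have "smooth_near (eucl F) M s n" if "n \<in> N" for n
    using assms that by (simp add: is_slice_def)
  then show *: "s n \<in> points M" if "n \<in> N" for n using that by (blast dest: smooth_near_points(2))
  show "\<rho> (s n) = n" if "n \<in> N" for n
  proof -
    have "\<rho> (\<alpha> \<one> (s n)) = n" using assms that by (simp add: is_slice_def del: act_one)
    then show ?thesis using *[OF that] by simp
  qed
qed (use assms in \<open>simp_all add: is_slice_def\<close>)

lemma slice_points: "is_slice F N s \<rho> \<Longrightarrow> s ` N \<subseteq> points M"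
  using is_sliceD(6) by blast

lemma slice_chart_pi:
  assumes sl: "is_slice F N s \<rho>" and p: "p \<in> saturation (s ` N)"
  shows "snd (slice_chart N s \<rho>) (\<pi> p) = \<rho> p"
proof -
  obtain g n where g: "g \<in> carrier G" "n \<in> N" "p = \<alpha> g (s n)" using p by (auto simp: saturation_def)
  have sM: "s n \<in> points M" using is_sliceD(6)[OF sl g(2)] .
  then have pM: "p \<in> points M" using g by auto
  have "(SOME p'. p' \<in> \<pi> p) \<in> \<pi> p" using orbit_refl[OF pM] by (rule someI)
  then obtain h where h: "h \<in> carrier G" "(SOME p'. p' \<in> \<pi> p) = \<alpha> h p" unfolding orbit_def by blast
  then have "(SOME p'. p' \<in> \<pi> p) = \<alpha> (h \<otimes> g) (s n)" using g sM by (simp add: act_mult)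
  then have "\<rho> (SOME p'. p' \<in> \<pi> p) = n" using is_sliceD(5)[OF sl m_closed[OF h(1) g(1)] g(2)] by simp
  moreover have "\<rho> p = n" using is_sliceD(5)[OF sl g(1,2)] g(3) by simp
  ultimately show ?thesis by (simp add: slice_chart_def)
qed

lemma slice_chart_s:
  assumes sl: "is_slice F N s \<rho>" and n: "n \<in> N"
  shows "snd (slice_chart N s \<rho>) (\<pi> (s n)) = n"
  using slice_chart_pi[OF sl, of "s n"] subset_saturation[OF slice_points[OF sl]] n is_sliceD(7)[OF sl] by auto

lemma slice_chart_inv:
  assumes sl: "is_slice F N s \<rho>" and n: "n \<in> N"
  shows "inv_into (fst (slice_chart N s \<rho>)) (snd (slice_chart N s \<rho>)) n = \<pi> (s n)"
proof -
  have "inj_on (snd (slice_chart N s \<rho>)) (\<pi> ` s ` N)"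
    by (rule inj_onI) (auto simp: slice_chart_s[OF sl])
  then show ?thesis
    using inv_into_f_f[of "snd (slice_chart N s \<rho>)" "\<pi> ` s ` N" "\<pi> (s n)"] n slice_chart_s[OF sl n]
    by (simp add: slice_chart_def)
qed

lemma slice_chart_image:
  assumes "is_slice F N s \<rho>"
  shows "snd (slice_chart N s \<rho>) ` fst (slice_chart N s \<rho>) = N"
proof -
  have "fst (slice_chart N s \<rho>) = (\<lambda>n. \<pi> (s n)) ` N" by (auto simp: slice_chart_def)
  then show ?thesis using slice_chart_s[OF assms] by (simp add: image_image)
qed

lemma pi_in_slice_chart_iff:
  assumes "is_slice F N s \<rho>" "p \<in> points M"
  shows "\<pi> p \<in> fst (slice_chart N s \<rho>) \<longleftrightarrow> p \<in> saturation (s ` N)"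
  using pi_in_image_iff[OF slice_points[OF assms(1)] assms(2)] by (simp add: slice_chart_def)

text \<open>Continuity comes from that of \<open>\<rho>\<close> and the openness of the projection,
  openness from the continuity of the inverse \<open>\<pi> \<circ> s\<close>. The topology
  \<open>T\<close> is kept abstract because the lemma serves both the orbit manifold to be
  constructed and arbitrary given ones.\<close>

lemma chart_on_slice_chart:
  assumes T: "quotient_map (mtop M) T \<pi>" and sl: "is_slice F N s \<rho>"
  shows "chart_on T F (slice_chart N s \<rho>)"
proof -
  let ?c = "slice_chart N s \<rho>" and ?O = "saturation (s ` N)"
  note op = quotient_open_map[OF T]
  have V: "fst ?c = \<pi> ` ?O"
  proof (intro equalityI subsetI)
    fix q assume "q \<in> fst ?c"
    then show "q \<in> \<pi> ` ?O" using subset_saturation[OF slice_points[OF sl]] by (auto simp: slice_chart_def)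
  next
    fix q assume "q \<in> \<pi> ` ?O"
    then show "q \<in> fst ?c"
      using pi_in_slice_chart_iff[OF sl] saturation_subset[OF slice_points[OF sl]] by auto
  qed
  have opV: "openin T (fst ?c)" unfolding V using op is_sliceD(3)[OF sl] by (auto simp: open_map_def)
  have tV: "topspace (subtopology T (fst ?c)) = fst ?c" using openin_subset[OF opV] by auto
  have "homeomorphic_map (subtopology T (fst ?c)) (top_of_set N) (snd ?c)"
  proof (rule bijective_open_imp_homeomorphic_map)
    show "inj_on (snd ?c) (topspace (subtopology T (fst ?c)))"
      unfolding tV by (rule inj_onI) (auto simp: slice_chart_def slice_chart_s[OF sl, unfolded slice_chart_def, simplified])
    show "snd ?c ` topspace (subtopology T (fst ?c)) = topspace (top_of_set N)"
      unfolding tV using slice_chart_image[OF sl] by simp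
    show "continuous_map (subtopology T (fst ?c)) (top_of_set N) (snd ?c)"
      unfolding continuous_map_def tV
    proof (intro conjI allI impI)
      show "snd ?c \<in> fst ?c \<rightarrow> topspace (top_of_set N)" using slice_chart_image[OF sl] by auto
      fix B assume "openin (top_of_set N) B"
      then have "openin (top_of_set F) B" using is_sliceD(1)[OF sl] openin_trans by blast
      then have "openin (mtop M) {p \<in> ?O. \<rho> p \<in> B}"
        by (intro smooth_near_preimage_open[where N = "eucl F"]) (use is_sliceD[OF sl] in auto)
      then have "openin T (\<pi> ` {p \<in> ?O. \<rho> p \<in> B})" using op by (auto simp: open_map_def)
      moreover have "\<pi> ` {p \<in> ?O. \<rho> p \<in> B} = {q \<in> fst ?c. snd ?c q \<in> B}"
        unfolding V using slice_chart_pi[OF sl] by auto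
      ultimately show "openin (subtopology T (fst ?c)) {q \<in> fst ?c. snd ?c q \<in> B}"
        by (simp add: openin_subtopology) blast
    qed
    show "open_map (subtopology T (fst ?c)) (top_of_set N) (snd ?c)"
      unfolding open_map_def
    proof (intro allI impI)
      fix A assume opA: "openin (subtopology T (fst ?c)) A"
      then have A: "openin T A" "A \<subseteq> fst ?c"
        using openin_trans_full[OF opA opV] openin_subset[OF opA] tV by simp_all
      have "openin (mtop M) {p \<in> points M. \<pi> p \<in> A}"
        using openin_continuous_map_preimage[OF quotient_imp_continuous_map[OF T] A(1)] .
      then have "openin (mtop (eucl F)) {n \<in> N. s n \<in> {p \<in> points M. \<pi> p \<in> A}}"
        by (intro smooth_near_preimage_open[where N = M]) (use is_sliceD[OF sl] in auto)
      moreover have "{n \<in> N. s n \<in> {p \<in> points M. \<pi> p \<in> A}} = snd ?c ` A"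
      proof (intro equalityI subsetI)
        fix n assume "n \<in> {n \<in> N. s n \<in> {p \<in> points M. \<pi> p \<in> A}}"
        then show "n \<in> snd ?c ` A" using slice_chart_s[OF sl, of n] by (metis (mono_tags, lifting) imageI mem_Collect_eq)
      next
        fix n assume "n \<in> snd ?c ` A"
        then obtain q where "q \<in> A" "n = snd ?c q" by blast
        moreover from this obtain n' where "n' \<in> N" "q = \<pi> (s n')" using A(2) by (auto simp: slice_chart_def)
        ultimately show "n \<in> {n \<in> N. s n \<in> {p \<in> points M. \<pi> p \<in> A}}"
          using slice_chart_s[OF sl] is_sliceD(6)[OF sl] by auto
      qed
      ultimately have "openin (top_of_set F) (snd ?c ` A)" by simp
      then show "openin (top_of_set N) (snd ?c ` A)"
        using A(2) slice_chart_image[OF sl] openin_imp_subset[OF is_sliceD(1)[OF sl]]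
        by (intro openin_subset_trans[of F "snd ?c ` A" N]) auto
    qed
  qed
  then show ?thesis
    using opV slice_chart_image[OF sl] is_sliceD(1)[OF sl]
    by (simp add: chart_on_def case_prod_unfold)
qed

text \<open>All slice charts over one fixed model \<open>F\<close> form an atlas for the quotient
  topology; their transition maps have the form \<open>\<rho>' \<circ> s\<close> and are smooth as
  composites through \<open>M\<close>.\<close>

lemma quotient_manifold_exists: "\<exists>Q. quotient_manifold G \<alpha> M Q"
proof -
  define P where "P U \<longleftrightarrow> U \<subseteq> orbits G (points M) \<alpha> \<and> openin (mtop M) {x \<in> points M. \<pi> x \<in> U}" for U
  have "istopology P"
    unfolding istopology_def
  proof (intro conjI allI impI)
    fix U V assume "P U" "P V"
    moreover have "{x \<in> points M. \<pi> x \<in> U \<inter> V} = {x \<in> points M. \<pi> x \<in> U} \<inter> {x \<in> points M. \<pi> x \<in> V}" by auto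
    ultimately show "P (U \<inter> V)" by (auto simp: P_def)
  next
    fix \<U> assume U: "\<forall>U\<in>\<U>. P U"
    have "{x \<in> points M. \<pi> x \<in> \<Union>\<U>} = (\<Union>U\<in>\<U>. {x \<in> points M. \<pi> x \<in> U})" by auto
    moreover have "openin (mtop M) (\<Union>U\<in>\<U>. {x \<in> points M. \<pi> x \<in> U})"
      using U by (intro openin_Union) (auto simp: P_def)
    ultimately show "P (\<Union>\<U>)" using U by (auto simp: P_def)
  qed
  then have op: "openin (topology P) U \<longleftrightarrow> P U" for U by (simp add: topology_inverse')
  have orb: "orbits G (points M) \<alpha> = \<pi> ` points M" by (auto simp: orbits_def)
  have "{x \<in> points M. \<pi> x \<in> \<pi> ` points M} = points M" by auto
  then have Porb: "P (\<pi> ` points M)" by (simp add: P_def orb)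
  have ts: "topspace (topology P) = orbits G (points M) \<alpha>"
  proof (intro equalityI)
    have "openin (topology P) (topspace (topology P))" by (rule openin_topspace)
    then show "topspace (topology P) \<subseteq> orbits G (points M) \<alpha>" unfolding op by (simp add: P_def)
    show "orbits G (points M) \<alpha> \<subseteq> topspace (topology P)"
      using Porb unfolding orb by (intro openin_subset) (simp add: op)
  qed
  have qm: "quotient_map (mtop M) (topology P) \<pi>"
    unfolding quotient_map_def ts op by (simp add: P_def orb)
  have le: "mdim M - mdim L \<le> mdim M" by simp
  \<comment> \<open>The model is fixed before any point is given, and the subtraction may be
    truncated when \<open>M\<close> is empty. A point of \<open>M\<close> yields
    \<open>mdim L \<le> mdim M\<close>, which makes it exact.\<close>
  obtain F where F: "F \<subseteq> span (model M)" "subspace F" "dim F = mdim M - mdim L"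
    by (rule choose_subspace_of_subspace[OF le]) (rule that)
  define \<A> where "\<A> = {slice_chart N s \<rho> | N s \<rho>. is_slice F N s \<rho>}"
  define Q where "Q = \<lparr>mtop = topology P, model = F, atlas = \<A>\<rparr>"
  have Q: "mtop Q = topology P" "model Q = F" "atlas Q = \<A>" by (simp_all add: Q_def)
  have slice: "\<exists>N s \<rho>. is_slice F N s \<rho> \<and> x \<in> saturation (s ` N)" if x: "x \<in> points M" for x
  proof -
    obtain c where c: "c \<in> smooth_charts M" "x \<in> fst c" using atlas_chart_at[OF atlas_M x] by metis
    have "mdim L \<le> mdim M"
      by (rule orbit_derivative_exists[OF x c])
    then have dim: "dim F + mdim L = mdim M" using F(3) by simp
    obtain l k B N \<rho> where ad: "adapted_slice c x F l k B N \<rho>"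
      using adapted_slice_exists[OF x c F(2) dim] by blast
    let ?s = "\<lambda>n. inv_into (fst c) (snd c) (snd c x + B n)"
    have B: "linear B" and sl: "is_slice F N ?s \<rho>" and "0 \<in> N"
      using ad unfolding adapted_slice_def by blast+
    moreover have "?s 0 = x" using linear_0[OF B] chart_inv[OF smooth_charts_chart_on[OF c(1)] c(2)] by simp
    ultimately have "x \<in> ?s ` N" by force
    then show ?thesis using sl subset_saturation[OF slice_points[OF sl]] by blast
  qed
  have compat: "smooth_on (local_rep (slice_chart N s \<rho>) (slice_chart N' s' \<rho>') id)
      (local_dom (slice_chart N s \<rho>) (slice_chart N' s' \<rho>') id)"
    if sl: "is_slice F N s \<rho>" and sl': "is_slice F N' s' \<rho>'" for N s \<rho> N' s' \<rho>'
  proof -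
    have dom: "local_dom (slice_chart N s \<rho>) (slice_chart N' s' \<rho>') id = {n \<in> N. s n \<in> saturation (s' ` N')}"
    proof -
      have "{x \<in> fst (slice_chart N s \<rho>). id x \<in> fst (slice_chart N' s' \<rho>')} = (\<lambda>n. \<pi> (s n)) ` {n \<in> N. s n \<in> saturation (s' ` N')}"
        using pi_in_slice_chart_iff[OF sl'] is_sliceD(6)[OF sl] by (auto simp: slice_chart_def[of N s \<rho>])
      then show ?thesis
        unfolding local_dom_def using slice_chart_s[OF sl] by (simp add: image_image)
    qed
    \<comment> \<open>The transition map: leave the first chart along its slice and read off the
      parameter of the second.\<close>
    have "smooth_on (\<rho>' \<circ> s) {n \<in> N. s n \<in> saturation (s' ` N')}"
    proof (rule smooth_on_if_smooth_near[OF F(2) F(2)])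
      have "openin (mtop (eucl F)) {n \<in> N. s n \<in> saturation (s' ` N')}"
        by (rule smooth_near_preimage_open[where N = M]) (use is_sliceD[OF sl] is_sliceD[OF sl'] in auto)
      then show "openin (top_of_set F) {n \<in> N. s n \<in> saturation (s' ` N')}" by simp
      fix n assume "n \<in> {n \<in> N. s n \<in> saturation (s' ` N')}"
      then show "smooth_near (eucl F) (eucl F) (\<rho>' \<circ> s) n"
        using is_sliceD(2)[OF sl] is_sliceD(4)[OF sl']
        by (intro smooth_near_compose[OF smooth_atlas_eucl[OF F(2)] atlas_M smooth_atlas_eucl[OF F(2)]]) auto
    qed
    then show ?thesis
      unfolding dom
    proof (rule smooth_on_cong)
      fix n assume n: "n \<in> {n \<in> N. s n \<in> saturation (s' ` N')}"
      then show "local_rep (slice_chart N s \<rho>) (slice_chart N' s' \<rho>') id n = (\<rho>' \<circ> s) n"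
        using slice_chart_inv[OF sl, of n] slice_chart_pi[OF sl'] by (simp add: local_rep_def)
    qed
  qed
  have cover: "orbits G (points M) \<alpha> = \<Union>(fst ` \<A>)"
  proof (intro equalityI subsetI)
    fix q assume "q \<in> orbits G (points M) \<alpha>"
    then obtain x where x: "x \<in> points M" "q = \<pi> x" by (auto simp: orb)
    then obtain N s \<rho> where sl: "is_slice F N s \<rho>" "x \<in> saturation (s ` N)" using slice by metis
    then have "q \<in> fst (slice_chart N s \<rho>)" using pi_in_slice_chart_iff[OF sl(1) x(1)] x by simp
    moreover have "slice_chart N s \<rho> \<in> \<A>" using sl(1) by (auto simp: \<A>_def)
    ultimately show "q \<in> \<Union>(fst ` \<A>)" by blast
  next
    fix q assume "q \<in> \<Union>(fst ` \<A>)"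
    then obtain N s \<rho> where sl: "is_slice F N s \<rho>" "q \<in> fst (slice_chart N s \<rho>)"
      unfolding \<A>_def by blast
    then show "q \<in> orbits G (points M) \<alpha>"
      using is_sliceD(6)[OF sl(1)] by (auto simp: slice_chart_def orb)
  qed
  have mfd: "smooth_manifold Q"
    unfolding smooth_manifold_def Q
  proof (intro conjI ballI)
    show "Hausdorff_space (topology P)" by (rule quotient_Hausdorff[OF qm])
    show "second_countable (topology P)" by (rule quotient_second_countable[OF qm])
    show "subspace F" by fact
    show "chart_on (topology P) F c" if "c \<in> \<A>" for c
      using that chart_on_slice_chart[OF qm] by (auto simp: \<A>_def)
    show "topspace (topology P) = \<Union>(fst ` \<A>)" using ts cover by simp
    show "compatible_charts c d" if "c \<in> \<A>" "d \<in> \<A>" for c d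
      using that compat by (auto simp: \<A>_def compatible_charts_def)
  qed
  note atlas_Q = smooth_manifold_imp_smooth_atlas[OF mfd]
  have AQ: "\<A> \<subseteq> smooth_charts Q" using atlas_subset_smooth_charts[OF atlas_Q] Q by simp
  have pi_near: "smooth_near M Q \<pi> x" if x: "x \<in> points M" for x
  proof -
    obtain N s \<rho> where sl: "is_slice F N s \<rho>" "x \<in> saturation (s ` N)" using slice[OF x] by metis
    note O = is_sliceD(3)[OF sl(1)]
    have d: "slice_chart N s \<rho> \<in> smooth_charts Q" using AQ sl(1) by (auto simp: \<A>_def)
    show ?thesis
    proof (rule smooth_near_into_chart[OF atlas_M atlas_Q d O sl(2)])
      show "\<pi> ` saturation (s ` N) \<subseteq> fst (slice_chart N s \<rho>)"
        using pi_in_slice_chart_iff[OF sl(1)] openin_subset[OF O] by auto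
      show "smooth_near M (eucl (model Q)) (snd (slice_chart N s \<rho>) \<circ> \<pi>) x"
        unfolding Q by (rule smooth_near_cong[OF atlas_M is_sliceD(4)[OF sl] O sl(2)])
          (simp add: slice_chart_pi[OF sl(1)])
    qed
  qed
  then have sm: "smooth_map M Q \<pi>" unfolding smooth_map_iff_smooth_near[OF atlas_M atlas_Q] by blast
  have "smooth_submersion M Q \<pi>"
    unfolding smooth_submersion_def
  proof (intro conjI ballI impI sm)
    fix c d p assume c: "c \<in> atlas M" and d: "d \<in> atlas Q" and p: "p \<in> fst c" and q: "\<pi> p \<in> fst d"
    have c': "c \<in> smooth_charts M" using c atlas_subset_smooth_charts[OF atlas_M] by auto
    have d': "d \<in> smooth_charts Q" using d AQ Q by auto
    have pM: "p \<in> points M" using p chart_in_points[OF c'] by auto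
    have cont: "continuous_map (mtop M) (mtop Q) \<pi>" using sm by (simp add: smooth_map_def)
    note at = at_within_local_dom[OF cont c' d' p q]
    have r: "smooth_near (eucl (model M)) (eucl F) (local_rep c d \<pi>) (snd c p)"
      using smooth_near_local_rep[OF atlas_M atlas_Q pi_near[OF pM] c' p d' q] Q by simp
    obtain D where D: "linear D" "(local_rep c d \<pi> has_derivative D) (at (snd c p) within model M)" "D ` model M \<subseteq> F"
      by (rule smooth_near_eucl_derivative[OF subspace_models(2) F(2) r]) (rule that)
    obtain N s \<rho> where sl: "is_slice F N s \<rho>" "d = slice_chart N s \<rho>" using d by (auto simp: Q \<A>_def)
    then have "p \<in> saturation (s ` N)" using pi_in_slice_chart_iff[OF sl(1) pM] q by simp
    then obtain g n where gn: "g \<in> carrier G" "n \<in> N" "p = \<alpha> g (s n)" by (auto simp: saturation_def)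
    note EF = smooth_atlas_eucl[OF F(2)] and EM = smooth_atlas_eucl[OF subspace_models(2)]
    have gs: "smooth_near (eucl F) M (\<alpha> g \<circ> s) n" if "n \<in> N" for n
      by (rule smooth_near_compose[OF EF atlas_M atlas_M is_sliceD(2)[OF sl(1) that]
            smooth_near_act_fixed[OF gn(1) is_sliceD(6)[OF sl(1) that]]])
    have h: "smooth_near (eucl F) (eucl (model M)) (snd c \<circ> (\<alpha> g \<circ> s)) n"
      by (rule smooth_near_compose[OF EF atlas_M EM gs[OF gn(2)] smooth_near_chart[OF atlas_M c']]) (use gn p in simp)
    obtain Dh where Dh: "linear Dh" "(snd c \<circ> (\<alpha> g \<circ> s) has_derivative Dh) (at n within F)" "Dh ` F \<subseteq> model M"
      by (rule smooth_near_eucl_derivative[OF F(2) subspace_models(2) h]) (rule that)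
    have "openin (mtop (eucl F)) {n \<in> N. (\<alpha> g \<circ> s) n \<in> fst c}"
      by (rule smooth_near_preimage_open[where N = M])
        (use is_sliceD(1)[OF sl(1)] gs[unfolded o_def] chart_onD(1)[OF smooth_charts_chart_on[OF c']] in
          \<open>auto simp: o_def\<close>)
    then have A: "openin (top_of_set F) {n \<in> N. \<alpha> g (s n) \<in> fst c}" by simp
    \<comment> \<open>The translate of the slice through \<open>p\<close> is a local section of the
      projection that becomes the identity in the chart \<open>d\<close>, so \<open>D\<close> has a
      right inverse.\<close>
    have "D (Dh v) = v" if "v \<in> F" for v
    proof (rule eucl_left_inverse_derivative[OF F(2) subspace_models(2) h Dh(2) _ A _ _ that])
      show "(local_rep c d \<pi> has_derivative D) (at ((snd c \<circ> (\<alpha> g \<circ> s)) n) within model M)"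
        using D(2) gn by simp
      show "n \<in> {n \<in> N. \<alpha> g (s n) \<in> fst c}" using gn p by simp
      fix n assume n: "n \<in> {n \<in> N. \<alpha> g (s n) \<in> fst c}"
      then show "local_rep c d \<pi> ((snd c \<circ> (\<alpha> g \<circ> s)) n) = n"
        using chart_inv[OF smooth_charts_chart_on[OF c'], of "\<alpha> g (s n)"] gn(1)
          slice_chart_s[OF sl(1)] is_sliceD(6)[OF sl(1)] by (simp add: local_rep_def sl(2))
    qed
    then have "F \<subseteq> D ` model M" using Dh(3) by (metis image_subset_iff imageI subsetI)
    then show "\<exists>D. (local_rep c d \<pi> has_derivative D) (at (snd c p) within local_dom c d \<pi>) \<and> D ` model M = model Q"
      unfolding at Q using D(2,3) by blast
  qed
  then have "quotient_manifold G \<alpha> M Q"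
    unfolding quotient_manifold_def using mfd ts qm Q(1) by simp
  then show ?thesis by blast
qed

end

section \<open>Dimension counts\<close>

lemma eucl_diffeo_dim:
  assumes E: "subspace E" and F: "subspace F" and f: "smooth_near (eucl E) (eucl F) f z"
    and g: "smooth_near (eucl F) (eucl E) g (f z)"
    and A: "openin (top_of_set E) A" "z \<in> A" "\<And>x. x \<in> A \<Longrightarrow> g (f x) = x"
    and B: "openin (top_of_set F) B" "f z \<in> B" "\<And>y. y \<in> B \<Longrightarrow> f (g y) = y"
  shows "dim E = dim F"
proof -
  obtain D where D: "linear D" "(f has_derivative D) (at z within E)" "D ` E \<subseteq> F"
    by (rule smooth_near_eucl_derivative[OF E F f]) (rule that)
  obtain D' where D': "linear D'" "(g has_derivative D') (at (f z) within F)" "D' ` F \<subseteq> E"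
    by (rule smooth_near_eucl_derivative[OF F E g]) (rule that)
  have gz: "g (f z) = z" using A by blast
  have 1: "inj_on D E" by (rule eucl_left_inverse_inj[OF E F f g A(1,2) _ D(2)]) (rule A(3))
  have f': "smooth_near (eucl E) (eucl F) f (g (f z))" using f gz by simp
  have 2: "inj_on D' F" by (rule eucl_left_inverse_inj[OF F E g f' B(1,2) _ D'(2)]) (rule B(3))
  have "dim E \<le> dim F"
    using dim_image_eq[OF D(1), of E] dim_subset[OF D(3)] E 1 by (simp add: span_eq_iff[THEN iffD2])
  moreover have "dim F \<le> dim E"
    using dim_image_eq[OF D'(1), of F] dim_subset[OF D'(3)] F 2 by (simp add: span_eq_iff[THEN iffD2])
  ultimately show ?thesis by simp
qed

text \<open>A right inverse of \<open>D\<close> carries the image isomorphically onto a complement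
  of the kernel in \<open>E\<close>.\<close>

lemma dim_kernel_plus_dim_image:
  fixes D :: "'a::euclidean_space \<Rightarrow> 'b::euclidean_space"
  assumes D: "linear D" and E: "subspace E"
  shows "dim {u \<in> E. D u = 0} + dim (D ` E) = dim E"
proof -
  obtain R where R: "range R \<subseteq> E" "linear R" "\<And>w. w \<in> D ` E \<Longrightarrow> D (R w) = w"
    using linear_exists_right_inverse_on[OF D E] by blast
  let ?K = "{u \<in> E. D u = 0}" and ?C = "R ` (D ` E)"
  have K: "subspace ?K"
    using E by (auto simp: subspace_def linear_0[OF D] linear_add[OF D] linear_cmul[OF D])
  have DE: "subspace (D ` E)" using D E linear_subspace_image by blast
  then have C: "subspace ?C" using R(2) linear_subspace_image by blast
  have "inj_on R (D ` E)" using R(3) by (intro inj_on_inverseI[of _ D]) blast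
  then have "dim ?C = dim (D ` E)"
    using dim_image_eq[OF R(2), of "D ` E"] DE by (simp add: span_eq_iff[THEN iffD2])
  moreover have "{x + y | x y. x \<in> ?K \<and> y \<in> ?C} = E"
  proof (intro equalityI subsetI)
    fix u assume "u \<in> {x + y | x y. x \<in> ?K \<and> y \<in> ?C}"
    then obtain x y where "u = x + y" "x \<in> E" "y \<in> ?C" by blast
    moreover from this have "y \<in> E" using R(1) by blast
    ultimately show "u \<in> E" using E by (simp add: subspace_add)
  next
    fix u assume u: "u \<in> E"
    have "R (D u) \<in> E" using R(1) by blast
    then have "u - R (D u) \<in> ?K" using u E R(3)[of "D u"] by (simp add: subspace_diff linear_diff[OF D])
    moreover have "u = (u - R (D u)) + R (D u)" by simp
    ultimately show "u \<in> {x + y | x y. x \<in> ?K \<and> y \<in> ?C}" using u by blast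
  qed
  moreover have "?K \<inter> ?C = {0}"
  proof (intro equalityI subsetI)
    fix u assume "u \<in> ?K \<inter> ?C"
    then obtain w where w: "w \<in> D ` E" "u = R w" "D u = 0" by blast
    then have "w = 0" using R(3)[OF w(1)] by simp
    then show "u \<in> {0}" using w(2) linear_0[OF R(2)] by simp
  qed (use subspace_0[OF K] subspace_0[OF C] in simp)
  ultimately show ?thesis using dim_sums_Int[OF K C] by simp
qed

section \<open>Arbitrary smooth structures on the orbit space\<close>

context free_compact_action
begin

context
  fixes Q :: "('a set, 'e) manifold"
  assumes Q: "quotient_manifold G \<alpha> M Q"
begin

lemma quotient_facts:
  shows quotient_map_pi: "quotient_map (mtop M) (mtop Q) \<pi>" and atlas_Q: "smooth_atlas Q"
    and points_Q: "points Q = \<pi> ` points M" and continuous_pi: "continuous_map (mtop M) (mtop Q) \<pi>"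
    and subspace_Q: "subspace (model Q)"
proof -
  show qm: "quotient_map (mtop M) (mtop Q) \<pi>" and "smooth_atlas Q"
    using Q smooth_manifold_imp_smooth_atlas by (auto simp: quotient_manifold_def)
  show "points Q = \<pi> ` points M" using qm by (simp add: quotient_map_def)
  show "continuous_map (mtop M) (mtop Q) \<pi>" using qm by (rule quotient_imp_continuous_map)
  show "subspace (model Q)" using Q by (simp add: quotient_manifold_def smooth_manifold_def)
qed

lemma smooth_near_pi: "p \<in> points M \<Longrightarrow> smooth_near M Q \<pi> p"
  using Q smooth_map_iff_smooth_near[OF atlas_M atlas_Q]
  by (auto simp: quotient_manifold_def smooth_submersion_def)

lemma pi_submersion:
  assumes c: "c \<in> atlas M" "p \<in> fst c" and d: "d \<in> atlas Q" "\<pi> p \<in> fst d"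
  obtains D where "linear D" "(local_rep c d \<pi> has_derivative D) (at (snd c p) within model M)"
    "D ` model M = model Q"
proof -
  have cd: "c \<in> smooth_charts M" "d \<in> smooth_charts Q"
    using c d atlas_subset_smooth_charts[OF atlas_M] atlas_subset_smooth_charts[OF atlas_Q] by auto
  have sub: "smooth_submersion M Q \<pi>" using Q by (simp add: quotient_manifold_def)
  obtain D where D: "(local_rep c d \<pi> has_derivative D) (at (snd c p) within local_dom c d \<pi>)" "D ` model M = model Q"
    using sub c d unfolding smooth_submersion_def by blast
  have D': "(local_rep c d \<pi> has_derivative D) (at (snd c p) within model M)"
    using D(1) at_within_local_dom[OF continuous_pi cd c(2) d(2)] by simp
  show ?thesis by (rule that[OF has_derivative_linear[OF D'] D' D(2)])
qed

text \<open>A right inverse \<open>R\<close> of the derivative of the submersion spans an affine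
  subspace on which the projection is a local diffeomorphism; inverting it gives a section through
  \<open>p\<close>. Sections transfer smoothness from \<open>M\<close> to the given structure on
  \<open>Q\<close>.\<close>

lemma local_section:
  assumes p: "p \<in> points M"
  obtains V \<sigma> where "openin (mtop Q) V" "\<pi> p \<in> V" "\<sigma> (\<pi> p) = p"
    "\<And>q. q \<in> V \<Longrightarrow> smooth_near Q M \<sigma> q" "\<And>q. q \<in> V \<Longrightarrow> \<pi> (\<sigma> q) = q"
proof -
  obtain c where c: "c \<in> atlas M" "c \<in> smooth_charts M" "p \<in> fst c" by (rule atlas_chart_at[OF atlas_M p])
  have "\<pi> p \<in> points Q" using p points_Q by simp
  then obtain d where d: "d \<in> atlas Q" "d \<in> smooth_charts Q" "\<pi> p \<in> fst d" by (rule atlas_chart_at[OF atlas_Q])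
  note cc = smooth_charts_chart_on[OF c(2)] and dd = smooth_charts_chart_on[OF d(2)]
  let ?E = "model M" and ?F = "model Q"
  note E = subspace_models(2) and F = subspace_Q
  note EE = smooth_atlas_eucl[OF E] and FF = smooth_atlas_eucl[OF F]
  define r where "r = local_rep c d \<pi>"
  obtain D where D: "linear D" "(r has_derivative D) (at (snd c p) within ?E)" "D ` ?E = ?F"
    by (rule pi_submersion[OF c(1,3) d(1,3), folded r_def]) (rule that)
  obtain R where R: "range R \<subseteq> ?E" "linear R" "\<And>w. w \<in> ?F \<Longrightarrow> D (R w) = w"
    using linear_exists_right_inverse_on[OF D(1) E] unfolding D(3) by blast
  have cp: "snd c p \<in> ?E" using c(3) openin_imp_subset[OF chart_onD(2)[OF cc]] by auto
  define a where "a w = snd c p + R w" for w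
  have asn: "smooth_near (eucl ?F) (eucl ?E) a w" if "w \<in> ?F" for w
    unfolding a_def using R(1) by (intro smooth_near_eucl_affine[OF F E R(2) _ cp that]) auto
  define S where "S = {w \<in> ?F. a w \<in> local_dom c d \<pi>}"
  have "openin (mtop (eucl ?F)) {w \<in> ?F. a w \<in> local_dom c d \<pi>}"
    by (rule smooth_near_preimage_open[where N = "eucl ?E"])
      (use asn local_dom_open[OF continuous_pi c(2) d(2)] in auto)
  then have S: "openin (top_of_set ?F) S" by (simp add: S_def)
  have a0: "a 0 = snd c p" using linear_0[OF R(2)] by (simp add: a_def)
  have zS: "0 \<in> S" using a0 c(3) d(3) subspace_0[OF F] by (auto simp: S_def local_dom_def)
  have rsn: "smooth_near (eucl ?E) (eucl ?F) r z" if "z \<in> local_dom c d \<pi>" for z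
  proof -
    obtain y where y: "y \<in> fst c" "\<pi> y \<in> fst d" "z = snd c y" using \<open>z \<in> local_dom c d \<pi>\<close> by (auto simp: local_dom_def)
    then have "y \<in> points M" using chart_in_points[OF c(2)] by auto
    then show ?thesis
      unfolding r_def y(3) by (intro smooth_near_local_rep[OF atlas_M atlas_Q smooth_near_pi c(2) y(1) d(2) y(2)])
  qed
  define h where "h w = r (a w)" for w
  have hsn: "smooth_near (eucl ?F) (eucl ?F) h w" if "w \<in> S" for w
    using smooth_near_compose[OF FF EE FF asn rsn, of w] that by (simp add: S_def h_def[abs_def] o_def)
  have hS: "smooth_on h S" by (rule smooth_on_if_smooth_near[OF F F S hsn])
  have hF: "h ` S \<subseteq> ?F" using smooth_near_points(2)[OF hsn] by auto
  have "(r has_derivative D) (at (a 0) within ?E)" using D(2) a0 by simp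
  from eucl_chain[OF F E asn[OF subspace_0[OF F]] _ this, of R]
  have Dh: "(h has_derivative D \<circ> R) (at 0 within ?F)"
    using has_derivative_affine[OF R(2)] by (simp add: a_def[abs_def] h_def[abs_def] o_def)
  have inj: "inj_on (D \<circ> R) ?F" using R(3) by (intro inj_onI) simp
  obtain U V g where UV: "openin (top_of_set ?F) U" "0 \<in> U" "U \<subseteq> S" "openin (top_of_set ?F) V" "h 0 \<in> V"
    "h ` U \<subseteq> V" "g ` V \<subseteq> U" "\<And>u. u \<in> U \<Longrightarrow> g (h u) = u" "\<And>v. v \<in> V \<Longrightarrow> h (g v) = v" "smooth_on g V"
    by (rule smooth_inverse_function_subspace[OF F F refl S zS hS hF Dh inj]) (rule that)
  have gsn: "smooth_near (eucl ?F) (eucl ?F) g v" if "v \<in> V" for v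
    unfolding smooth_near_eucl[OF F F]
    using UV(1,4,7,10) openin_imp_subset[OF UV(1)] that by (intro exI[of _ V]) auto
  define W where "W = {q \<in> fst d. snd d q \<in> V}"
  have W: "openin (mtop Q) W" unfolding W_def by (rule chart_preimage_open[OF dd UV(4)])
  define \<sigma> where "\<sigma> q = inv_into (fst c) (snd c) (a (g (snd d q)))" for q
  have h0: "h 0 = snd d (\<pi> p)" using chart_inv[OF cc c(3)] by (simp add: h_def a0 r_def local_rep_def)
  have agS: "g (snd d q) \<in> S" "a (g (snd d q)) \<in> local_dom c d \<pi>" "g (snd d q) \<in> ?F" if "q \<in> W" for q
    using that UV(3,7) unfolding W_def S_def by blast+
  show ?thesis
  proof (rule that[OF W])
    show "\<pi> p \<in> W" using d(3) UV(5) h0 by (simp add: W_def)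
    show "\<sigma> (\<pi> p) = p"
      using UV(8)[OF UV(2)] h0 chart_inv[OF cc c(3)] by (simp add: \<sigma>_def a0)
    fix q assume q: "q \<in> W"
    then have qd: "q \<in> fst d" "snd d q \<in> V" by (auto simp: W_def)
    have im: "a (g (snd d q)) \<in> snd c ` fst c" using agS(2)[OF q] by (auto simp: local_dom_def)
    have 1: "smooth_near Q (eucl ?F) (g \<circ> snd d) q"
      by (rule smooth_near_compose[OF atlas_Q FF FF smooth_near_chart[OF atlas_Q d(2) qd(1)] gsn[OF qd(2)]])
    have 2: "smooth_near Q (eucl ?E) (a \<circ> (g \<circ> snd d)) q"
      by (rule smooth_near_compose[OF atlas_Q FF EE 1 asn]) (use agS(3)[OF q] in simp)
    have "smooth_near Q M (inv_into (fst c) (snd c) \<circ> (a \<circ> (g \<circ> snd d))) q"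
      by (rule smooth_near_compose[OF atlas_Q EE atlas_M 2 smooth_near_inv_chart[OF atlas_M c(2)]]) (use im in simp)
    then show "smooth_near Q M \<sigma> q" by (simp add: \<sigma>_def[abs_def] o_def)
    obtain y where y: "y \<in> fst c" "\<pi> y \<in> fst d" "a (g (snd d q)) = snd c y"
      using agS(2)[OF q] by (auto simp: local_dom_def)
    then have sy: "\<sigma> q = y" using chart_inv[OF cc y(1)] by (simp add: \<sigma>_def)
    have "snd d (\<pi> y) = snd d q"
      using UV(9)[OF qd(2)] y chart_inv[OF cc y(1)] by (simp add: h_def r_def local_rep_def)
    then show "\<pi> (\<sigma> q) = q" using chart_inj[OF dd] y(2) qd(1) sy by (auto dest: inj_onD)
  qed
qed

text \<open>Along a local section \<open>\<sigma>\<close> of the projection the slice chart becomes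
  \<open>\<rho> \<circ> \<sigma>\<close>, so slice charts are smooth for every admissible
  \<open>Q\<close>.\<close>

lemma slice_chart_smooth_near:
  assumes sl: "is_slice F N s \<rho>" and F: "subspace F" and q: "q \<in> fst (slice_chart N s \<rho>)"
  shows "smooth_near Q (eucl F) (snd (slice_chart N s \<rho>)) q"
proof -
  obtain n where n: "n \<in> N" "q = \<pi> (s n)" using q by (auto simp: slice_chart_def)
  note O = is_sliceD(3)[OF sl]
  have sn: "s n \<in> points M" "s n \<in> saturation (s ` N)"
    using is_sliceD(6)[OF sl] subset_saturation[OF slice_points[OF sl]] n by auto
  obtain V \<sigma> where V: "openin (mtop Q) V" "\<pi> (s n) \<in> V" "\<sigma> (\<pi> (s n)) = s n"
    "\<And>q. q \<in> V \<Longrightarrow> smooth_near Q M \<sigma> q" "\<And>q. q \<in> V \<Longrightarrow> \<pi> (\<sigma> q) = q"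
    by (rule local_section[OF sn(1)]) (rule that)
  have "smooth_near M (eucl F) \<rho> (\<sigma> q)" using is_sliceD(4)[OF sl] sn V(3) n(2) by simp
  then have 1: "smooth_near Q (eucl F) (\<rho> \<circ> \<sigma>) q"
    using V(2,4) n(2) by (intro smooth_near_compose[OF atlas_Q atlas_M smooth_atlas_eucl[OF F]]) auto
  show ?thesis
  proof (rule smooth_near_cong[OF atlas_Q 1])
    show "openin (mtop Q) {q \<in> V. \<sigma> q \<in> saturation (s ` N)}"
      by (rule smooth_near_preimage_open[OF V(1) V(4) O])
    show "q \<in> {q \<in> V. \<sigma> q \<in> saturation (s ` N)}" using V(2,3) n(2) sn by simp
    show "(\<rho> \<circ> \<sigma>) r = snd (slice_chart N s \<rho>) r" if "r \<in> {q \<in> V. \<sigma> q \<in> saturation (s ` N)}" for r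
      using slice_chart_pi[OF sl, of "\<sigma> r"] V(5)[of r] that by simp
  qed
qed

lemma pi_slice_smooth_near:
  assumes sl: "is_slice F N s \<rho>" and F: "subspace F" and n: "n \<in> N"
  shows "smooth_near (eucl F) Q (\<pi> \<circ> s) n"
  by (rule smooth_near_compose[OF smooth_atlas_eucl[OF F] atlas_M atlas_Q is_sliceD(2)[OF sl n]
        smooth_near_pi[OF is_sliceD(6)[OF sl n]]])

text \<open>A slice chart and a chart of \<open>Q\<close> differ by a diffeomorphism between open
  parts of \<open>F\<close> and of \<open>model Q\<close>, which forces equal dimensions.\<close>

lemma slice_dim:
  assumes sl: "is_slice F N s \<rho>" and F: "subspace F" and n: "n \<in> N"
  shows "dim F = mdim Q"
proof -
  let ?c = "slice_chart N s \<rho>"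
  have q: "\<pi> (s n) \<in> points Q" using points_Q is_sliceD(6)[OF sl n] by simp
  obtain d where d: "d \<in> smooth_charts Q" "\<pi> (s n) \<in> fst d" using atlas_chart_at[OF atlas_Q q] by metis
  note dd = smooth_charts_chart_on[OF d(1)] and cc = chart_on_slice_chart[OF quotient_map_pi sl]
  note FF = smooth_atlas_eucl[OF F] and QQ = smooth_atlas_eucl[OF subspace_Q]
  have V: "fst ?c = (\<lambda>n. \<pi> (s n)) ` N" by (auto simp: slice_chart_def)
  let ?q = "\<pi> (s n)"
  have dq: "inv_into (fst d) (snd d) (snd d ?q) = ?q" by (rule chart_inv[OF dd d(2)])
  have f: "smooth_near (eucl F) (eucl (model Q)) (snd d \<circ> (\<pi> \<circ> s)) n"
    by (rule smooth_near_compose[OF FF atlas_Q QQ pi_slice_smooth_near[OF sl F n] smooth_near_chart[OF atlas_Q d(1)]])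
      (use d in simp)
  have g: "smooth_near (eucl (model Q)) (eucl F) (snd ?c \<circ> inv_into (fst d) (snd d)) (snd d ?q)"
    by (rule smooth_near_compose[OF QQ atlas_Q FF smooth_near_inv_chart[OF atlas_Q d(1)] slice_chart_smooth_near[OF sl F]])
      (use d n in \<open>auto simp: V dq\<close>)
  have "openin (mtop (eucl F)) {n \<in> N. (\<pi> \<circ> s) n \<in> fst d}"
    by (rule smooth_near_preimage_open[where N = Q])
      (use is_sliceD(1)[OF sl] pi_slice_smooth_near[OF sl F, unfolded o_def] chart_onD(1)[OF dd] in
        \<open>auto simp: o_def\<close>)
  then have A: "openin (top_of_set F) {n \<in> N. \<pi> (s n) \<in> fst d}" by simp
  have "openin (mtop Q) (fst d \<inter> fst ?c)" using chart_onD(1)[OF dd] chart_onD(1)[OF cc] by (rule openin_Int)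
  then have B: "openin (top_of_set (model Q)) (snd d ` (fst d \<inter> fst ?c))" by (rule chart_image_open[OF dd]) auto
  show ?thesis
  proof (rule eucl_diffeo_dim[OF F subspace_Q f _ A _ _ B])
    show "smooth_near (eucl (model Q)) (eucl F) (snd ?c \<circ> inv_into (fst d) (snd d)) ((snd d \<circ> (\<pi> \<circ> s)) n)"
      using g by simp
    show "n \<in> {n \<in> N. \<pi> (s n) \<in> fst d}" using n d by simp
    show "(snd ?c \<circ> inv_into (fst d) (snd d)) ((snd d \<circ> (\<pi> \<circ> s)) m) = m" if "m \<in> {n \<in> N. \<pi> (s n) \<in> fst d}" for m
      using that chart_inv[OF dd, of "\<pi> (s m)"] slice_chart_s[OF sl, of m] by simp
    show "(snd d \<circ> (\<pi> \<circ> s)) n \<in> snd d ` (fst d \<inter> fst ?c)" using d n V by simp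
    show "(snd d \<circ> (\<pi> \<circ> s)) ((snd ?c \<circ> inv_into (fst d) (snd d)) z) = z" if z: "z \<in> snd d ` (fst d \<inter> fst ?c)" for z
    proof -
      obtain m where m: "m \<in> N" "\<pi> (s m) \<in> fst d" "z = snd d (\<pi> (s m))" using z V by auto
      then show ?thesis using chart_inv[OF dd m(2)] slice_chart_s[OF sl m(1)] by simp
    qed
  qed
qed

text \<open>Every admissible \<open>Q\<close> has these charts in its maximal atlas, so they may
  serve as the charts in condition (B).\<close>

lemma slice_chart_in_smooth_charts:
  assumes sl: "is_slice (model Q) N s \<rho>"
  shows "slice_chart N s \<rho> \<in> smooth_charts Q"
proof (rule smooth_chartsI[OF atlas_Q chart_on_slice_chart[OF quotient_map_pi sl]])
  show "smooth_near Q (eucl (model Q)) (snd (slice_chart N s \<rho>)) q" if "q \<in> fst (slice_chart N s \<rho>)" for q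
    by (rule slice_chart_smooth_near[OF sl subspace_Q that])
  fix n assume "n \<in> snd (slice_chart N s \<rho>) ` fst (slice_chart N s \<rho>)"
  then have n: "n \<in> N" using slice_chart_image[OF sl] by simp
  show "smooth_near (eucl (model Q)) Q (inv_into (fst (slice_chart N s \<rho>)) (snd (slice_chart N s \<rho>))) n"
    by (rule smooth_near_cong[OF smooth_atlas_eucl[OF subspace_Q] pi_slice_smooth_near[OF sl subspace_Q n]])
      (use n is_sliceD(1)[OF sl] slice_chart_inv[OF sl] in auto)
qed

text \<open>A slice through \<open>x\<close> determines the dimension of \<open>Q\<close>, which
  \<open>quotient_manifold\<close> leaves implicit. For empty \<open>M\<close> there is no slice and
  the dimension of \<open>Q\<close> is unconstrained, whence the assumption.\<close>

lemma mdim_quotient: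
  assumes x: "x \<in> points M"
  shows "mdim Q + mdim L = mdim M"
proof -
  obtain c where c: "c \<in> smooth_charts M" "x \<in> fst c" using atlas_chart_at[OF atlas_M x] by metis
  have "mdim L \<le> mdim M" by (rule orbit_derivative_exists[OF x c])
  moreover have le: "mdim M - mdim L \<le> mdim M" by simp
  obtain F where F: "F \<subseteq> span (model M)" "subspace F" "dim F = mdim M - mdim L"
    by (rule choose_subspace_of_subspace[OF le]) (rule that)
  ultimately have dim: "dim F + mdim L = mdim M" by simp
  obtain l k B N \<rho> where "adapted_slice c x F l k B N \<rho>"
    using adapted_slice_exists[OF x c F(2) dim] by blast
  then have sl: "is_slice F N (\<lambda>n. inv_into (fst c) (snd c) (snd c x + B n)) \<rho>" "0 \<in> N"
    unfolding adapted_slice_def by blast+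
  show ?thesis using slice_dim[OF sl(1) F(2) sl(2)] dim by simp
qed

text \<open>The projection is constant along the orbit, which puts the image of \<open>k\<close> in
  the kernel of \<open>D\<close>. By \<open>mdim_quotient\<close> and surjectivity of
  \<open>D\<close> the kernel has dimension \<open>mdim L\<close>, as has the image of
  \<open>k\<close>, so the two coincide.\<close>

lemma ker_projection:
  assumes x: "x \<in> points M" and c: "c \<in> smooth_charts M" "x \<in> fst c" and d: "d \<in> smooth_charts Q" "\<pi> x \<in> fst d"
    and l: "l \<in> smooth_charts L" "\<one> \<in> fst l"
    and k: "((\<lambda>w. snd c (\<alpha> (inv_into (fst l) (snd l) w) x)) has_derivative k) (at (snd l \<one>) within model L)"
    and D: "(local_rep c d \<pi> has_derivative D) (at (snd c x) within model M)"
  shows "\<And>w. w \<in> model L \<Longrightarrow> D (k w) = 0"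
    and "D ` model M = model Q \<Longrightarrow> u \<in> model M \<Longrightarrow> D u = 0 \<Longrightarrow> u \<in> k ` model L"
proof -
  let ?f = "\<lambda>w. snd c (\<alpha> (inv_into (fst l) (snd l) w) x)" and ?z = "snd l \<one>"
  note cc = smooth_charts_chart_on[OF c(1)] and ll = smooth_charts_chart_on[OF l(1)]
  have li: "inv_into (fst l) (snd l) (snd l g) = g" if "g \<in> fst l" for g using chart_inv[OF ll that] .
  have lG: "fst l \<subseteq> carrier G" using chart_in_points[OF l(1)] points_L by simp
  have fz: "?f ?z = snd c x" using li[OF l(2)] x by simp
  have f: "smooth_near (eucl (model L)) (eucl (model M)) ?f ?z"
    using li[OF l(2)] l c x by (intro orbit_map_smooth_near[where y = x]) auto
  have "(local_rep c d \<pi> has_derivative D) (at (?f ?z) within model M)" using D fz by simp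
  from eucl_chain[OF subspace_models f k this]
  have chain: "(local_rep c d \<pi> \<circ> ?f has_derivative D \<circ> k) (at ?z within model L)" .
  have "smooth_near L M (\<lambda>g. \<alpha> g x) g" if "g \<in> points L" for g
    using that points_L x
    by (intro smooth_near_act[OF atlas_L] smooth_near_id smooth_near_const atlas_L atlas_M) auto
  then have "openin (mtop L) {g \<in> fst l. \<alpha> g x \<in> fst c}"
    using chart_in_points[OF l(1)] chart_onD(1)[OF cc]
    by (intro smooth_near_preimage_open[where N = M] chart_onD(1)[OF ll]) auto
  then have A: "openin (top_of_set (model L)) (snd l ` {g \<in> fst l. \<alpha> g x \<in> fst c})"
    by (rule chart_image_open[OF ll]) auto
  have zA: "?z \<in> snd l ` {g \<in> fst l. \<alpha> g x \<in> fst c}" using l(2) c(2) x by (intro imageI) simp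
  have const: "((\<lambda>w. snd d (\<pi> x)) has_derivative D \<circ> k) (at ?z within model L)"
  proof (rule has_derivative_within_transform_openin[OF chain A zA])
    fix w assume "w \<in> snd l ` {g \<in> fst l. \<alpha> g x \<in> fst c}"
    then obtain g where g: "g \<in> fst l" "\<alpha> g x \<in> fst c" "w = snd l g" by blast
    then show "(local_rep c d \<pi> \<circ> ?f) w = snd d (\<pi> x)"
      using li[OF g(1)] chart_inv[OF cc g(2)] lG x by (auto simp: local_rep_def)
  qed
  have zL: "?z \<in> model L" using zA openin_imp_subset[OF A] by blast
  show zero: "D (k w) = 0" if "w \<in> model L" for w
    using has_derivative_within_subspace_unique[OF const has_derivative_const subspace_models(1) zL that] by simp
  assume surj: "D ` model M = model Q" and u: "u \<in> model M" "D u = 0"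
  have linD: "linear D" using D by (rule has_derivative_linear)
  have link: "linear k" using k by (rule has_derivative_linear)
  let ?K = "{u \<in> model M. D u = 0}"
  have K: "subspace ?K"
    using subspace_models(2) by (auto simp: subspace_def linear_0[OF linD] linear_add[OF linD] linear_cmul[OF linD])
  have kM: "k ` model L \<subseteq> model M"
  proof -
    obtain A' where "openin (top_of_set (model L)) A'" "?z \<in> A'" "?f ` A' \<subseteq> model M"
      using f unfolding smooth_near_eucl[OF subspace_models] by blast
    then show ?thesis by (rule has_derivative_within_subspace_image[OF k subspace_models])
  qed
  have "inj_on k (model L)" by (rule orbit_map_immersive[OF x c l k])
  then have "dim (k ` model L) = mdim L"
    using dim_image_eq[OF link, of "model L"] subspace_models(1) by (simp add: span_eq_iff[THEN iffD2])
  moreover have "dim ?K + mdim Q = mdim M" using dim_kernel_plus_dim_image[OF linD subspace_models(2)] surj by simp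
  ultimately have "dim ?K \<le> dim (k ` model L)" using mdim_quotient[OF x] by simp
  moreover have "k ` model L \<subseteq> ?K" using zero kM by auto
  moreover have "subspace (k ` model L)" using link subspace_models(1) linear_subspace_image by blast
  ultimately have "k ` model L = ?K" using K by (intro subspace_dim_equal)
  then show "u \<in> k ` model L" using u by simp
qed

end

end

section \<open>Quotients of submanifolds\<close>

lemma quotient_map_unique:
  assumes Y: "quotient_map X Y f" and Z: "quotient_map X Z f"
  shows "Y = Z"
proof -
  have ts: "topspace Y = topspace Z" using assms by (simp add: quotient_map_def)
  have "openin Y U \<longleftrightarrow> openin Z U" for U
  proof (cases "U \<subseteq> topspace Y")
    case True
    then show ?thesis using Y Z ts unfolding quotient_map_def by metis
  next
    case False
    then show ?thesis using ts openin_subset by metis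
  qed
  then show ?thesis by (simp add: topology_eq)
qed

text \<open>Quotient maps do not restrict to saturated subsets in general, but open ones do. This is
  applied to \<open>X\<close> and to the strata.\<close>

lemma quotient_map_open_restriction:
  assumes f: "quotient_map X Y f" "open_map X Y f" and U: "U \<subseteq> topspace X"
    "{x \<in> topspace X. f x \<in> f ` U} = U"
  shows "quotient_map (subtopology X U) (subtopology Y (f ` U)) f"
    and "open_map (subtopology X U) (subtopology Y (f ` U)) f"
proof -
  show op: "open_map (subtopology X U) (subtopology Y (f ` U)) f"
    by (rule open_map_restriction[OF f(2)]) (use U(2) in simp)
  have "continuous_map (subtopology X U) (subtopology Y (f ` U)) f"
    using quotient_imp_continuous_map[OF f(1)]
    by (auto simp: continuous_map_in_subtopology continuous_map_from_subtopology)
  moreover have "f ` topspace (subtopology X U) = topspace (subtopology Y (f ` U))"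
    using U(1) f(1) by (auto simp: quotient_map_def)
  ultimately show "quotient_map (subtopology X U) (subtopology Y (f ` U)) f"
    using continuous_open_imp_quotient_map op by blast
qed

lemma submanifoldD:
  assumes "submanifold M S"
  shows "smooth_manifold S" "points S \<subseteq> points M" "mtop S = subtopology (mtop M) (points S)"
    "smooth_map S M id" "smooth_immersion S M id"
  using assms by (auto simp: submanifold_def smooth_immersion_def)

lemma submanifold_inclusion:
  assumes sub: "submanifold M S" and M: "smooth_atlas M" and x: "x \<in> points S"
  shows "smooth_near S M (\<lambda>x. x) x"
proof -
  have S: "smooth_atlas S" using submanifoldD(1)[OF sub] by (rule smooth_manifold_imp_smooth_atlas)
  have "smooth_near S M id x"
    using submanifoldD(4)[OF sub] x unfolding smooth_map_iff_smooth_near[OF S M] by blast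
  then show ?thesis by (simp add: id_def)
qed

lemma submanifold_immersion:
  assumes sub: "submanifold M S"
    and e: "e \<in> atlas S" "x \<in> fst e" and m: "m \<in> atlas M" "x \<in> fst m" and M: "smooth_atlas M"
  obtains D where "linear D" "(local_rep e m id has_derivative D) (at (snd e x) within model S)" "inj_on D (model S)"
proof -
  have S: "smooth_atlas S" using submanifoldD(1)[OF sub] smooth_manifold_imp_smooth_atlas by blast
  have em: "e \<in> smooth_charts S" "m \<in> smooth_charts M"
    using e m atlas_subset_smooth_charts[OF S] atlas_subset_smooth_charts[OF M] by auto
  have cont: "continuous_map (mtop S) (mtop M) id" using submanifoldD(4)[OF sub] by (simp add: smooth_map_def)
  have mx: "id x \<in> fst m" using m by simp
  obtain D where D: "(local_rep e m id has_derivative D) (at (snd e x) within local_dom e m id)" "inj_on D (model S)"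
    using submanifoldD(5)[OF sub] e m(1) mx unfolding smooth_immersion_def by blast
  have D': "(local_rep e m id has_derivative D) (at (snd e x) within model S)"
    using D(1) at_within_local_dom[OF cont em e(2) mx] by simp
  show ?thesis by (rule that[OF has_derivative_linear[OF D'] D' D(2)])
qed

text \<open>The topology of \<open>T\<close> is given intrinsically as a quotient of that of
  \<open>S\<close>. As \<open>S\<close> is a union of orbits, the topology induced from
  \<open>Q\<close> is a quotient of that of \<open>S\<close> too, and the quotient topology is
  unique.\<close>

lemma quotient_subtopology:
  assumes M: "free_compact_action G L M \<alpha>" and S: "free_compact_action G L S \<alpha>"
    and sub: "submanifold M S"
    and Q: "quotient_manifold G \<alpha> M Q" and T: "quotient_manifold G \<alpha> S T"
  shows "points T \<subseteq> points Q" "mtop T = subtopology (mtop Q) (points T)"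
    "free_compact_action.saturation G \<alpha> (points S) = points S"
proof -
  interpret m: free_compact_action G L M \<alpha> by fact
  interpret s: free_compact_action G L S \<alpha> by fact
  note SM = submanifoldD(2)[OF sub]
  show sat: "m.saturation (points S) = points S"
    using m.subset_saturation[OF SM] s.act_closed by (auto simp: m.saturation_def)
  have pT: "points T = orbit G \<alpha> ` points S" by (rule s.points_Q[OF T])
  then show "points T \<subseteq> points Q" using m.points_Q[OF Q] SM by auto
  have "{x \<in> points M. orbit G \<alpha> x \<in> orbit G \<alpha> ` points S} = points S"
    using m.pi_preimage_image[OF SM] sat by simp
  from quotient_map_open_restriction(1)[OF m.quotient_map_pi[OF Q] m.quotient_open_map[OF m.quotient_map_pi[OF Q]] SM this]
  have "quotient_map (mtop S) (subtopology (mtop Q) (points T)) (orbit G \<alpha>)"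
    using submanifoldD(3)[OF sub] pT by simp
  then show "mtop T = subtopology (mtop Q) (points T)"
    by (rule quotient_map_unique[OF s.quotient_map_pi[OF T]])
qed

text \<open>
  A tangent vector of \<open>S/G\<close> that dies in \<open>M/G\<close> lifts to one of \<open>S\<close> that is tangent to the orbit in \<open>M\<close>.
  As the orbit lies in \<open>S\<close>, the lift is tangent to the orbit in \<open>S\<close>, so it projects to zero.
\<close>

lemma quotient_submanifold:
  assumes M: "free_compact_action G L M \<alpha>" and S: "free_compact_action G L S \<alpha>"
    and sub: "submanifold M S"
    and Q: "quotient_manifold G \<alpha> M Q" and T: "quotient_manifold G \<alpha> S T"
  shows "submanifold Q T"
proof -
  interpret m: free_compact_action G L M \<alpha> by fact
  interpret s: free_compact_action G L S \<alpha> by fact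
  let ?pi = "orbit G \<alpha>"
  note aM = m.atlas_M and aS = s.atlas_M and aQ = m.atlas_Q[OF Q] and aT = s.atlas_Q[OF T]
  note qs = quotient_subtopology[OF M S sub Q T]
  note sM = m.subspace_models(2) and sS = s.subspace_models(2) and sQ = m.subspace_Q[OF Q] and sT = s.subspace_Q[OF T]
  note sL = m.subspace_models(1)
  note eM = smooth_atlas_eucl[OF sM] and eSS = smooth_atlas_eucl[OF sS] and eQ = smooth_atlas_eucl[OF sQ]
    and eT = smooth_atlas_eucl[OF sT] and eL = smooth_atlas_eucl[OF sL]
  have pT: "points T = ?pi ` points S" by (rule s.points_Q[OF T])
  have id_near: "smooth_near T Q id q" if "q \<in> points T" for q
  proof -
    obtain x where x: "x \<in> points S" "q = ?pi x" using \<open>q \<in> points T\<close> pT by auto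
    obtain V \<sigma> where V: "openin (mtop T) V" "?pi x \<in> V" "\<sigma> (?pi x) = x"
      "\<And>q. q \<in> V \<Longrightarrow> smooth_near T S \<sigma> q" "\<And>q. q \<in> V \<Longrightarrow> ?pi (\<sigma> q) = q"
      by (rule s.local_section[OF T x(1)]) (rule that)
    have 1: "smooth_near T S \<sigma> q" using V(2,4) x(2) by simp
    have 2: "smooth_near T M ((\<lambda>x. x) \<circ> \<sigma>) q"
      by (rule smooth_near_compose[OF aT aS aM 1 submanifold_inclusion[OF sub aM]])
        (use smooth_near_points(2)[OF 1] in simp)
    have 3: "smooth_near T Q (?pi \<circ> ((\<lambda>x. x) \<circ> \<sigma>)) q"
      by (rule smooth_near_compose[OF aT aM aQ 2 m.smooth_near_pi[OF Q]]) (rule smooth_near_points(2)[OF 2])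
    show ?thesis by (rule smooth_near_cong[OF aT 3 V(1)]) (use V(2,5) x(2) in auto)
  qed
  then have sm: "smooth_map T Q id" unfolding smooth_map_iff_smooth_near[OF aT aQ] by blast
  have "smooth_immersion T Q id"
    unfolding smooth_immersion_def
  proof (intro conjI ballI impI sm)
    fix c d q assume c: "c \<in> atlas T" and d: "d \<in> atlas Q" and q: "q \<in> fst c" and qd: "id q \<in> fst d"
    have cd: "c \<in> smooth_charts T" "d \<in> smooth_charts Q"
      using c d atlas_subset_smooth_charts[OF aT] atlas_subset_smooth_charts[OF aQ] by auto
    note cc = smooth_charts_chart_on[OF cd(1)]
    have "q \<in> points T" using q chart_in_points[OF cd(1)] by auto
    then obtain x where x: "x \<in> points S" "q = ?pi x" using pT by auto
    have xM: "x \<in> points M" using x submanifoldD(2)[OF sub] by auto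
    obtain e where e: "e \<in> atlas S" "e \<in> smooth_charts S" "x \<in> fst e" by (rule atlas_chart_at[OF aS x(1)])
    obtain mm where mm: "mm \<in> atlas M" "mm \<in> smooth_charts M" "x \<in> fst mm" by (rule atlas_chart_at[OF aM xM])
    obtain l where l: "l \<in> smooth_charts L" "\<one>\<^bsub>G\<^esub> \<in> fst l"
      using atlas_chart_at[OF m.atlas_L] m.points_L m.one_closed by metis
    note ee = smooth_charts_chart_on[OF e(2)] and mmc = smooth_charts_chart_on[OF mm(2)]
      and ll = smooth_charts_chart_on[OF l(1)]
    obtain V \<sigma> where V: "openin (mtop T) V" "?pi x \<in> V" "\<sigma> (?pi x) = x"
      "\<And>q. q \<in> V \<Longrightarrow> smooth_near T S \<sigma> q" "\<And>q. q \<in> V \<Longrightarrow> ?pi (\<sigma> q) = q"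
      by (rule s.local_section[OF T x(1)]) (rule that)
    let ?z = "snd c q"
    have cq: "inv_into (fst c) (snd c) ?z = q" by (rule chart_inv[OF cc q])
    have sq: "\<sigma> q = x" using V(3) x(2) by simp
    have \<sigma>q: "smooth_near T S \<sigma> q" using V(2,4) x(2) by simp
    \<comment> \<open>In charts, \<open>a\<close> is a local section of the projection of
      \<open>S\<close>, \<open>b\<close> is the inclusion of \<open>S\<close> in \<open>M\<close>,
      and \<open>w\<close> and \<open>r\<close> are the projections to \<open>Q\<close> and to
      \<open>T\<close>. Near \<open>?z\<close> the inclusion of \<open>T\<close> in \<open>Q\<close>
      is \<open>w \<circ> b \<circ> a\<close>, while \<open>r \<circ> a\<close> is the
      identity.\<close>
    define a where "a = local_rep c e \<sigma>"
    define b where "b = local_rep e mm id"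
    define w where "w = local_rep mm d ?pi"
    define r where "r = local_rep e c ?pi"
    have asn: "smooth_near (eucl (model T)) (eucl (model S)) a ?z"
      unfolding a_def by (rule smooth_near_local_rep[OF aT aS \<sigma>q cd(1) q e(2)]) (use sq e in simp)
    have bsn: "smooth_near (eucl (model S)) (eucl (model M)) b (snd e x)"
      unfolding b_def
      by (rule smooth_near_local_rep[OF aS aM submanifold_inclusion[OF sub aM x(1), folded id_def] e(2,3) mm(2)]) (use mm in simp)
    have rsn: "smooth_near (eucl (model S)) (eucl (model T)) r (snd e x)"
      unfolding r_def by (rule smooth_near_local_rep[OF aS aT s.smooth_near_pi[OF T x(1)] e(2,3) cd(1)]) (use x q in simp)
    have az: "a ?z = snd e x" using cq sq by (simp add: a_def local_rep_def)
    have bx: "b (snd e x) = snd mm x" using chart_inv[OF ee e(3)] by (simp add: b_def local_rep_def)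
    obtain da where da: "linear da" "(a has_derivative da) (at ?z within model T)" "da ` model T \<subseteq> model S"
      by (rule smooth_near_eucl_derivative[OF sT sS asn]) (rule that)
    obtain db where db: "linear db" "(b has_derivative db) (at (snd e x) within model S)" "inj_on db (model S)"
      by (rule submanifold_immersion[OF sub e(1,3) mm(1,3) aM, folded b_def]) (rule that)
    have db_img: "db ` model S \<subseteq> model M"
    proof -
      obtain A where "openin (top_of_set (model S)) A" "snd e x \<in> A" "b ` A \<subseteq> model M"
        using bsn unfolding smooth_near_eucl[OF sS sM] by blast
      then show ?thesis by (rule has_derivative_within_subspace_image[OF db(2) sS sM])
    qed
    have pd: "?pi x \<in> fst d" using qd x by simp
    obtain dw where dw: "linear dw" "(w has_derivative dw) (at (snd mm x) within model M)" "dw ` model M = model Q"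
      by (rule m.pi_submersion[OF Q mm(1,3) d pd, folded w_def]) (rule that)
    obtain dr where dr: "linear dr" "(r has_derivative dr) (at (snd e x) within model S)" "dr ` model S \<subseteq> model T"
      by (rule smooth_near_eucl_derivative[OF sS sT rsn]) (rule that)
    define O1 where "O1 = {q' \<in> V. \<sigma> q' \<in> fst e \<inter> points S} \<inter> fst c"
    have eS: "openin (mtop S) (fst e \<inter> points S)" by (intro openin_Int chart_onD(1)[OF ee] openin_topspace)
    have "openin (mtop T) {q' \<in> V. \<sigma> q' \<in> fst e \<inter> points S}"
      by (rule smooth_near_preimage_open[where N = S, OF V(1) V(4) eS])
    then have O1: "openin (mtop T) O1" unfolding O1_def using chart_onD(1)[OF cc] by (rule openin_Int)
    have qO1: "q \<in> O1" using V(2) x q sq e by (auto simp: O1_def)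
    define O2 where "O2 = {q' \<in> O1. \<sigma> q' \<in> fst mm}"
    have O1n: "smooth_near T M ((\<lambda>x. x) \<circ> \<sigma>) q'" if "q' \<in> O1" for q'
      using that V(4) submanifold_inclusion[OF sub aM] by (intro smooth_near_compose[OF aT aS aM]) (auto simp: O1_def)
    have "openin (mtop T) {q' \<in> O1. ((\<lambda>x. x) \<circ> \<sigma>) q' \<in> fst mm}"
      by (rule smooth_near_preimage_open[OF O1 O1n chart_onD(1)[OF mmc]])
    then have O2: "openin (mtop T) O2" by (simp add: O2_def)
    have qO2: "q \<in> O2" using qO1 sq mm by (simp add: O2_def)
    have B: "openin (top_of_set (model T)) (snd c ` O2)" by (rule chart_image_open[OF cc O2]) (auto simp: O2_def O1_def)
    have zB: "?z \<in> snd c ` O2" using qO2 by simp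
    have rep: "w (b (a z)) = local_rep c d id z" "r (a z) = z" if z: "z \<in> snd c ` O2" for z
    proof -
      obtain q' where q': "q' \<in> O2" "z = snd c q'" using z by blast
      then have m': "q' \<in> fst c" "q' \<in> V" "\<sigma> q' \<in> fst e" "\<sigma> q' \<in> fst mm" by (auto simp: O2_def O1_def)
      have az': "a z = snd e (\<sigma> q')" using chart_inv[OF cc m'(1)] q'(2) by (simp add: a_def local_rep_def)
      then show "r (a z) = z" using chart_inv[OF ee m'(3)] V(5)[OF m'(2)] q'(2) by (simp add: r_def local_rep_def)
      have "b (a z) = snd mm (\<sigma> q')" using az' chart_inv[OF ee m'(3)] by (simp add: b_def local_rep_def)
      then show "w (b (a z)) = local_rep c d id z"
        using chart_inv[OF mmc m'(4)] V(5)[OF m'(2)] chart_inv[OF cc m'(1)] q'(2)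
        by (simp add: w_def local_rep_def)
    qed
    have dba: "(b \<circ> a has_derivative db \<circ> da) (at ?z within model T)"
      by (rule eucl_chain[OF sT sS asn da(2)]) (use db(2) az in simp)
    have basn: "smooth_near (eucl (model T)) (eucl (model M)) (b \<circ> a) ?z"
      by (rule smooth_near_compose[OF eT eSS eM asn]) (use bsn az in simp)
    have "(w \<circ> (b \<circ> a) has_derivative dw \<circ> (db \<circ> da)) (at ?z within model T)"
      by (rule eucl_chain[OF sT sM basn dba]) (use dw(2) az bx in simp)
    then have D: "(local_rep c d id has_derivative dw \<circ> (db \<circ> da)) (at ?z within model T)"
      by (rule has_derivative_within_transform_openin[OF _ B zB]) (use rep(1) in simp)
    have rda: "dr (da v) = v" if "v \<in> model T" for v
      by (rule eucl_left_inverse_derivative[OF sT sS asn da(2) _ B zB rep(2) that]) (use dr(2) az in simp_all)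
    define li where "li = inv_into (fst l) (snd l)"
    have li1: "li (snd l \<one>\<^bsub>G\<^esub>) = \<one>\<^bsub>G\<^esub>" using chart_inv[OF ll l(2)] by (simp add: li_def)
    let ?l1 = "snd l \<one>\<^bsub>G\<^esub>"
    define fS where "fS = (\<lambda>w. snd e (\<alpha> (li w) x))"
    define fM where "fM = (\<lambda>w. snd mm (\<alpha> (li w) x))"
    have fSsn: "smooth_near (eucl (model L)) (eucl (model S)) fS ?l1"
      unfolding fS_def li_def
      by (rule s.orbit_map_smooth_near[OF x(1) e(2) l(1) _ x(1)]) (use l e x li1 in \<open>auto simp: li_def\<close>)
    obtain kS where kS: "linear kS" "(fS has_derivative kS) (at ?l1 within model L)" "kS ` model L \<subseteq> model S"
      by (rule smooth_near_eucl_derivative[OF sL sS fSsn]) (rule that)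
    have fS1: "fS ?l1 = snd e x" using li1 x by (simp add: fS_def)
    have "(b \<circ> fS has_derivative db \<circ> kS) (at ?l1 within model L)"
      by (rule eucl_chain[OF sL sS fSsn kS(2)]) (use db(2) fS1 in simp)
    moreover have "smooth_near L S (\<lambda>g. \<alpha> g x) g" if "g \<in> points L" for g
      using that m.points_L x
      by (intro s.smooth_near_act[OF m.atlas_L] smooth_near_id smooth_near_const m.atlas_L aS) auto
    then have "openin (mtop L) {g \<in> fst l. \<alpha> g x \<in> fst e}"
      using chart_in_points[OF l(1)] chart_onD(1)[OF ee]
      by (intro smooth_near_preimage_open[where N = S] chart_onD(1)[OF ll]) auto
    then have A: "openin (top_of_set (model L)) (snd l ` {g \<in> fst l. \<alpha> g x \<in> fst e})"
      by (rule chart_image_open[OF ll]) auto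
    have "?l1 \<in> snd l ` {g \<in> fst l. \<alpha> g x \<in> fst e}" using l(2) e(3) x(1) by (intro imageI) simp
    \<comment> \<open>The orbit of \<open>x\<close> runs inside \<open>S\<close>, so its derivative
      in \<open>M\<close> is its derivative in \<open>S\<close> followed by that of the
      inclusion.\<close>
    ultimately have kM: "(fM has_derivative db \<circ> kS) (at ?l1 within model L)"
    proof (rule has_derivative_within_transform_openin[OF _ A])
      fix z assume "z \<in> snd l ` {g \<in> fst l. \<alpha> g x \<in> fst e}"
      then obtain g where "g \<in> fst l" "\<alpha> g x \<in> fst e" "z = snd l g" by blast
      then show "(b \<circ> fS) z = fM z"
        using chart_inv[OF ll] chart_inv[OF ee] by (simp add: b_def fS_def fM_def li_def local_rep_def)
    qed
    have pc: "?pi x \<in> fst c" using q x by simp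
    have "inj_on (dw \<circ> (db \<circ> da)) (model T)"
    proof -
      have lin: "linear (dw \<circ> (db \<circ> da))" using dw(1) db(1) da(1) by (intro linear_compose)
      show ?thesis
        unfolding linear_inj_on_iff_eq_0[OF lin sT]
      proof (intro ballI impI)
        fix v assume v: "v \<in> model T" "(dw \<circ> (db \<circ> da)) v = 0"
        have dav: "da v \<in> model S" using da(3) v by auto
        then have "db (da v) \<in> model M" using db_img by auto
        then have "db (da v) \<in> (db \<circ> kS) ` model L"
          using m.ker_projection(2)[OF Q xM mm(2,3) cd(2) pd l kM[unfolded fM_def li_def] dw(2)[unfolded w_def] dw(3)] v(2)
          by simp
        then obtain u where u: "u \<in> model L" "db (da v) = db (kS u)" by auto
        then have "da v = kS u" using db(3) dav kS(3) by (auto dest: inj_onD)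
        moreover have "dr (kS u) = 0"
          by (rule s.ker_projection(1)[OF T x(1) e(2,3) cd(1) pc l kS(2)[unfolded fS_def li_def] dr(2)[unfolded r_def] u(1)])
        ultimately show "v = 0" using rda[OF v(1)] by simp
      qed
    qed
    moreover have cont: "continuous_map (mtop T) (mtop Q) id" using sm by (simp add: smooth_map_def)
    ultimately show "\<exists>D. (local_rep c d id has_derivative D) (at ?z within local_dom c d id) \<and> inj_on D (model T)"
      unfolding at_within_local_dom[OF cont cd q qd] using D by blast
  qed
  then show ?thesis
    unfolding submanifold_def using qs(1,2) T by (simp add: quotient_manifold_def)
qed

section \<open>Convergence in Grassmannians\<close>

text \<open>The variational inequality for the nearest point, applied to \<open>v\<close> and to
  \<open>- v\<close>, becomes orthogonality.\<close>

lemma closest_point_subspace: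
  fixes L :: "'e::euclidean_space set"
  assumes L: "subspace L"
  shows "closest_point L y \<in> L" "v \<in> L \<Longrightarrow> (y - closest_point L y) \<bullet> v = 0"
proof -
  have cl: "closed L" "convex L" "L \<noteq> {}"
    using closed_subspace[OF L] subspace_imp_convex[OF L] subspace_0[OF L] by auto
  show P: "closest_point L y \<in> L" using closest_point_in_set[OF cl(1,3)] .
  assume v: "v \<in> L"
  have "(y - closest_point L y) \<bullet> (closest_point L y + v - closest_point L y) \<le> 0"
    by (rule closest_point_dot[OF cl(2,1)]) (use P v L subspace_add in blast)
  moreover have "(y - closest_point L y) \<bullet> (closest_point L y - v - closest_point L y) \<le> 0"
    by (rule closest_point_dot[OF cl(2,1)]) (use P v L subspace_diff in blast)
  ultimately show "(y - closest_point L y) \<bullet> v = 0" by simp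
qed

lemma closest_point_subspace_eqI:
  fixes L :: "'e::euclidean_space set"
  assumes L: "subspace L" and p: "p \<in> L" "\<And>v. v \<in> L \<Longrightarrow> (y - p) \<bullet> v = 0"
  shows "closest_point L y = p"
proof -
  let ?d = "closest_point L y - p"
  have "?d \<in> L" using closest_point_subspace(1)[OF L] p(1) L by (simp add: subspace_diff)
  then have "(y - p) \<bullet> ?d = 0" "(y - closest_point L y) \<bullet> ?d = 0"
    using p(2) closest_point_subspace(2)[OF L] by auto
  then have "?d \<bullet> ?d = 0" by (simp add: inner_diff_left)
  then show ?thesis by simp
qed

lemma linear_closest_point:
  fixes L :: "'e::euclidean_space set"
  assumes L: "subspace L"
  shows "linear (closest_point L)"
proof (rule linearI)
  fix a b :: 'e and r :: real
  show "closest_point L (a + b) = closest_point L a + closest_point L b"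
  proof (rule closest_point_subspace_eqI[OF L])
    show "(a + b - (closest_point L a + closest_point L b)) \<bullet> v = 0" if "v \<in> L" for v
      using closest_point_subspace(2)[OF L that, of a] closest_point_subspace(2)[OF L that, of b]
      by (simp add: inner_diff_left inner_add_left)
  qed (use closest_point_subspace(1)[OF L] subspace_add[OF L] in blast)
  show "closest_point L (r *\<^sub>R a) = r *\<^sub>R closest_point L a"
  proof (rule closest_point_subspace_eqI[OF L])
    show "(r *\<^sub>R a - r *\<^sub>R closest_point L a) \<bullet> v = 0" if "v \<in> L" for v
      using closest_point_subspace(2)[OF L that, of a] by (simp add: inner_diff_left)
  qed (use closest_point_subspace(1)[OF L] subspace_scale[OF L] in blast)
qed

text \<open>Unfolds the pullback topology. Membership in the Grassmannian is demanded only
  eventually along the sequence, and the projections converge pointwise because functions carry the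
  product topology.\<close>

lemma limitin_Grassmannian_iff:
  "limitin (Grassmannian m E) Lk l sequentially \<longleftrightarrow>
     (subspace l \<and> l \<subseteq> E \<and> dim l = m) \<and>
     (\<forall>\<^sub>F k in sequentially. subspace (Lk k) \<and> Lk k \<subseteq> E \<and> dim (Lk k) = m) \<and>
     (\<forall>y. (\<lambda>k. closest_point (Lk k) y) \<longlonglongrightarrow> closest_point l y)"
  (is "?lhs \<longleftrightarrow> ?l \<and> ?ev \<and> ?lim")
proof -
  let ?A = "{L. subspace L \<and> L \<subseteq> E \<and> dim L = m}"
  have ts: "topspace (Grassmannian m E) = ?A" by (simp add: Grassmannian_def topspace_pullback_topology)
  have op: "openin (Grassmannian m E) S \<longleftrightarrow> (\<exists>U. open U \<and> S = closest_point -` U \<inter> ?A)" for S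
    by (simp add: Grassmannian_def openin_pullback_topology)
  have lim: "?lim \<longleftrightarrow> ((\<lambda>k. closest_point (Lk k)) \<longlongrightarrow> closest_point l) sequentially"
  proof -
    have "limitin (product_topology (\<lambda>i::'a. euclidean :: 'a topology) UNIV) (\<lambda>k. closest_point (Lk k)) (closest_point l) sequentially
      \<longleftrightarrow> ?lim"
      by (simp add: limitin_componentwise)
    then show ?thesis by (simp add: euclidean_product_topology)
  qed
  show ?thesis
  proof
    assume L: ?lhs
    then have l: "?l" using ts by (auto simp: limitin_def)
    have "\<forall>\<^sub>F k in sequentially. Lk k \<in> ?A"
      using L ts openin_topspace[of "Grassmannian m E"] unfolding limitin_def by metis
    moreover have "((\<lambda>k. closest_point (Lk k)) \<longlongrightarrow> closest_point l) sequentially"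
    proof (rule topological_tendstoI)
      fix U :: "('a \<Rightarrow> 'a) set" assume U: "open U" "closest_point l \<in> U"
      then have "openin (Grassmannian m E) (closest_point -` U \<inter> ?A)" "l \<in> closest_point -` U \<inter> ?A"
        using op l by auto
      then have "\<forall>\<^sub>F k in sequentially. Lk k \<in> closest_point -` U \<inter> ?A" using L unfolding limitin_def by blast
      then show "\<forall>\<^sub>F k in sequentially. closest_point (Lk k) \<in> U" by (rule eventually_mono) simp
    qed
    ultimately show "?l \<and> ?ev \<and> ?lim" using l lim by simp
  next
    assume R: "?l \<and> ?ev \<and> ?lim"
    show ?lhs
      unfolding limitin_def ts
    proof (intro conjI allI impI)
      show "l \<in> ?A" using R by simp
      fix S assume "openin (Grassmannian m E) S \<and> l \<in> S"
      then obtain U where U: "open U" "S = closest_point -` U \<inter> ?A" "l \<in> S" using op by blast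
      then have "\<forall>\<^sub>F k in sequentially. closest_point (Lk k) \<in> U"
        using R lim topological_tendstoD by blast
      moreover have "?ev" using R by blast
      ultimately show "\<forall>\<^sub>F k in sequentially. Lk k \<in> S" by eventually_elim (simp add: U(2))
    qed
  qed
qed

text \<open>
  Convergence can be tested on vectors: as the dimensions agree, the projections \<open>P\<^sub>k\<close> onto \<open>Lk k\<close>
  restrict to isomorphisms from \<open>l\<close> that are close to the identity, and so \<open>P\<^sub>k z\<close> is small for \<open>z\<close>
  orthogonal to \<open>l\<close>.
\<close>

lemma limitin_GrassmannianI:
  fixes l :: "'e::euclidean_space set"
  assumes l: "subspace l" "l \<subseteq> E" "dim l = m"
    and ev: "\<forall>\<^sub>F k in sequentially. subspace (Lk k) \<and> Lk k \<subseteq> E \<and> dim (Lk k) = m"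
    and v: "\<And>v. v \<in> l \<Longrightarrow> \<exists>w. (\<forall>\<^sub>F k in sequentially. w k \<in> Lk k) \<and> w \<longlonglongrightarrow> v"
  shows "limitin (Grassmannian m E) Lk l sequentially"
proof -
  define P where "P k = closest_point (Lk k)" for k
  define P0 where "P0 = closest_point l"
  note lin0 = linear_closest_point[OF l(1), folded P0_def]
  have P0: "P0 y \<in> l" "w \<in> l \<Longrightarrow> (y - P0 y) \<bullet> w = 0" for y w
    using closest_point_subspace[OF l(1)] by (auto simp: P0_def)
  have P0_id: "P0 w = w" if "w \<in> l" for w
    using closest_point_subspace_eqI[OF l(1) that] by (simp add: P0_def)
  have on_l: "(\<lambda>k. P k v) \<longlonglongrightarrow> v" if "v \<in> l" for v
  proof -
    obtain w where w: "\<forall>\<^sub>F k in sequentially. w k \<in> Lk k" "w \<longlonglongrightarrow> v" using v[OF \<open>v \<in> l\<close>] by blast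
    have "(\<lambda>k. norm (w k - v)) \<longlonglongrightarrow> 0" using w(2) by (simp add: LIM_zero tendsto_norm_zero)
    moreover have "\<forall>\<^sub>F k in sequentially. norm (P k v - v) \<le> norm (w k - v)"
      using ev w(1)
    proof eventually_elim
      case (elim k)
      then have "dist v (P k v) \<le> dist v (w k)"
        unfolding P_def by (intro closest_point_le closed_subspace) auto
      then show ?case by (simp add: dist_norm norm_minus_commute)
    qed
    ultimately have "(\<lambda>k. P k v - v) \<longlonglongrightarrow> 0" by (rule Lim_null_comparison[rotated])
    then show ?thesis by (simp add: LIM_zero_iff)
  qed
  \<comment> \<open>Bounds the distance of \<open>P k\<close> from the identity on \<open>l\<close>
    in operator norm: by expansion in \<open>Basis\<close> the finitely many vectors
    \<open>P0 i\<close> control all of \<open>l\<close>.\<close>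
  define \<epsilon> where "\<epsilon> k = (\<Sum>i\<in>Basis. norm (P k (P0 i) - P0 i))" for k
  have "\<epsilon> \<longlonglongrightarrow> (\<Sum>i\<in>(Basis::'e set). norm (P0 i - P0 i))"
    unfolding \<epsilon>_def by (intro tendsto_intros on_l P0)
  then have eps: "\<epsilon> \<longlonglongrightarrow> 0" by simp
  have "(\<lambda>k. P k z) \<longlonglongrightarrow> 0" if z: "\<And>w. w \<in> l \<Longrightarrow> z \<bullet> w = 0" for z
  proof -
    \<comment> \<open>Below \<open>1 / 2\<close>, \<open>P k\<close> shrinks vectors of
      \<open>l\<close> by at most a factor \<open>2\<close>. So it is injective on \<open>l\<close>
      and, the dimensions being equal, maps \<open>l\<close> onto \<open>Lk k\<close>.\<close>
    have "\<forall>\<^sub>F k in sequentially. \<epsilon> k < 1 / 2" using order_tendstoD(2)[OF eps, of "1 / 2"] by simp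
    then have "\<forall>\<^sub>F k in sequentially. norm ((norm (P k z))\<^sup>2) \<le> 2 * \<epsilon> k * (norm z)\<^sup>2"
      using ev
    proof eventually_elim
      case (elim k)
      then have L: "subspace (Lk k)" "dim (Lk k) = m" by auto
      note lin = linear_closest_point[OF L(1), folded P_def]
      have PL: "P k y \<in> Lk k" "w \<in> Lk k \<Longrightarrow> (y - P k y) \<bullet> w = 0" for y w
        using closest_point_subspace[OF L(1)] by (auto simp: P_def)
      have near: "norm (P k w - w) \<le> \<epsilon> k * norm w" if "w \<in> l" for w
      proof -
        have "P k w - w = P k (P0 w) - P0 w" using P0_id[OF that] by simp
        also have "\<dots> = (\<Sum>i\<in>Basis. (w \<bullet> i) *\<^sub>R (P k (P0 i) - P0 i))"
          using linear_eq_sum_Basis[OF linear_compose_sub[OF linear_compose[OF lin0 lin] lin0], of w] by simp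
        also have "norm \<dots> \<le> (\<Sum>i\<in>Basis. norm w * norm (P k (P0 i) - P0 i))"
          by (rule sum_norm_le) (auto intro!: mult_right_mono Basis_le_norm)
        finally show ?thesis by (simp add: \<epsilon>_def sum_distrib_left mult.commute)
      qed
      have half: "norm w \<le> 2 * norm (P k w)" if "w \<in> l" for w
      proof -
        have "norm w \<le> norm (P k w) + norm (P k w - w)"
          using norm_triangle_ineq4[of "P k w" "P k w - w"] by simp
        also have "\<dots> \<le> norm (P k w) + 1 / 2 * norm w"
          using near[OF that] mult_right_mono[of "\<epsilon> k" "1 / 2" "norm w"] elim(1) by simp
        finally show ?thesis by simp
      qed
      have "inj_on (P k) l"
        unfolding linear_inj_on_iff_eq_0[OF lin l(1)] using half by force
      moreover have "P k ` l \<subseteq> Lk k" using PL(1) by auto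
      ultimately have "P k ` l = Lk k"
        using linear_inj_on_imp_image_eq[OF lin l(1) L(1)] l(3) L(2) by simp
      then obtain w where w: "w \<in> l" "P k z = P k w" using PL(1)[of z] by auto
      have "norm w \<le> 2 * norm z"
      proof -
        have "(norm (P k z))\<^sup>2 = z \<bullet> P k z"
          using PL(2)[OF PL(1)[of z], of z] by (simp add: inner_diff_left power2_norm_eq_inner)
        also have "\<dots> \<le> norm z * norm (P k z)" by (rule norm_cauchy_schwarz)
        finally have "norm (P k z) \<le> norm z"
          by (metis mult_le_cancel_right norm_ge_zero norm_le_zero_iff not_le order.trans power2_eq_square)
        then show ?thesis using half[OF w(1)] w(2) by simp
      qed
      have "(norm (P k z))\<^sup>2 = z \<bullet> P k z"
        using PL(2)[OF PL(1)[of z], of z] by (simp add: inner_diff_left power2_norm_eq_inner)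
      \<comment> \<open>Subtracting \<open>w\<close> changes nothing because \<open>z\<close> is
        orthogonal to \<open>l\<close>, and it replaces a bounded factor by one of size
        \<open>\<epsilon> k\<close>.\<close>
      also have "\<dots> = z \<bullet> (P k w - w)" using w(2) z[OF w(1)] by (simp add: inner_diff_right)
      also have "\<dots> \<le> norm z * norm (P k w - w)" by (rule norm_cauchy_schwarz)
      also have "\<dots> \<le> norm z * (\<epsilon> k * (2 * norm z))"
      proof (rule mult_left_mono)
        have "0 \<le> \<epsilon> k" by (simp add: \<epsilon>_def sum_nonneg)
        then show "norm (P k w - w) \<le> \<epsilon> k * (2 * norm z)"
          using near[OF w(1)] mult_left_mono[OF \<open>norm w \<le> 2 * norm z\<close>] by fastforce
      qed simp
      finally show ?case by (simp add: power2_eq_square mult_ac)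
    qed
    moreover have "(\<lambda>k. 2 * \<epsilon> k * (norm z)\<^sup>2) \<longlonglongrightarrow> 2 * 0 * (norm z)\<^sup>2" by (intro tendsto_intros eps)
    then have "(\<lambda>k. 2 * \<epsilon> k * (norm z)\<^sup>2) \<longlonglongrightarrow> 0" by simp
    ultimately have "(\<lambda>k. (norm (P k z))\<^sup>2) \<longlonglongrightarrow> 0" by (rule Lim_null_comparison)
    then have "(\<lambda>k. sqrt ((norm (P k z))\<^sup>2)) \<longlonglongrightarrow> sqrt 0" by (rule tendsto_real_sqrt)
    then show ?thesis by (simp add: tendsto_norm_zero_iff)
  qed
  then have perp: "(\<lambda>k. P k (y - P0 y)) \<longlonglongrightarrow> 0" for y using P0(2) by blast
  have "(\<lambda>k. P k y) \<longlonglongrightarrow> P0 y" for y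
  proof -
    have "(\<lambda>k. P k (P0 y) + P k (y - P0 y)) \<longlonglongrightarrow> P0 y + 0" by (intro tendsto_add on_l P0 perp)
    moreover have "\<forall>\<^sub>F k in sequentially. P k (P0 y) + P k (y - P0 y) = P k y"
      using ev
    proof eventually_elim
      case (elim k)
      then have "linear (P k)" unfolding P_def by (intro linear_closest_point) simp
      then show ?case by (simp add: linear_diff)
    qed
    ultimately show ?thesis by (simp add: filterlim_cong)
  qed
  then show ?thesis unfolding limitin_Grassmannian_iff using l ev by (simp add: P_def P0_def)
qed

lemma limitin_GrassmannianD:
  assumes "limitin (Grassmannian m E) Lk l sequentially"
  shows "subspace l" "l \<subseteq> E" "dim l = m"
    "\<forall>\<^sub>F k in sequentially. subspace (Lk k) \<and> Lk k \<subseteq> E \<and> dim (Lk k) = m"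
    "v \<in> l \<Longrightarrow> \<exists>w. (\<forall>\<^sub>F k in sequentially. w k \<in> Lk k) \<and> w \<longlonglongrightarrow> v"
proof -
  note * = assms[unfolded limitin_Grassmannian_iff]
  show l: "subspace l" "l \<subseteq> E" "dim l = m"
    and ev: "\<forall>\<^sub>F k in sequentially. subspace (Lk k) \<and> Lk k \<subseteq> E \<and> dim (Lk k) = m"
    using * by auto
  assume v: "v \<in> l"
  have "closest_point l v = v" by (rule closest_point_subspace_eqI[OF l(1) v]) simp
  then have "(\<lambda>k. closest_point (Lk k) v) \<longlonglongrightarrow> v" using * by metis
  moreover have "\<forall>\<^sub>F k in sequentially. closest_point (Lk k) v \<in> Lk k"
    using ev by (rule eventually_mono) (auto intro: closest_point_subspace(1))
  ultimately show "\<exists>w. (\<forall>\<^sub>F k in sequentially. w k \<in> Lk k) \<and> w \<longlonglongrightarrow> v"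
    by (intro exI[of _ "\<lambda>k. closest_point (Lk k) v"] conjI)
qed

text \<open>The projection onto the image of a subspace under \<open>B\<close> is not easily
  expressed through that onto the subspace, but the criterion by convergent vectors is stable under
  linear maps.\<close>

lemma limitin_Grassmannian_linear_image:
  assumes lim: "limitin (Grassmannian m E) Lk l sequentially"
    and B: "linear B" "B ` E \<subseteq> F" "inj_on B E"
  shows "limitin (Grassmannian m F) (\<lambda>k. B ` Lk k) (B ` l) sequentially"
proof (rule limitin_GrassmannianI)
  note D = limitin_GrassmannianD[OF lim]
  have img: "subspace (B ` l') \<and> B ` l' \<subseteq> F \<and> dim (B ` l') = m" if "subspace l' \<and> l' \<subseteq> E \<and> dim l' = m" for l'
    using that B linear_subspace_image[OF B(1)] dim_image_eq[OF B(1), of l'] inj_on_subset[OF B(3), of l']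
    by (auto simp: span_eq_iff[THEN iffD2])
  show "subspace (B ` l)" "B ` l \<subseteq> F" "dim (B ` l) = m" using img D(1-3) by auto
  show "\<forall>\<^sub>F k in sequentially. subspace (B ` Lk k) \<and> B ` Lk k \<subseteq> F \<and> dim (B ` Lk k) = m"
    using D(4) by (rule eventually_mono) (rule img)
  fix v assume "v \<in> B ` l"
  then obtain u where u: "u \<in> l" "v = B u" by blast
  then obtain w where w: "\<forall>\<^sub>F k in sequentially. w k \<in> Lk k" "w \<longlonglongrightarrow> u" using D(5) by blast
  have "(\<lambda>k. B (w k)) \<longlonglongrightarrow> B u"
    using w(2) B(1) by (intro bounded_linear.tendsto[of B]) (simp add: linear_linear)
  moreover have "\<forall>\<^sub>F k in sequentially. B (w k) \<in> B ` Lk k" using w(1) by (rule eventually_mono) simp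
  ultimately show "\<exists>w. (\<forall>\<^sub>F k in sequentially. w k \<in> B ` Lk k) \<and> w \<longlonglongrightarrow> v"
    unfolding u(2) by (intro exI[of _ "\<lambda>k. B (w k)"] conjI)
qed

section \<open>Tangent spaces\<close>

text \<open>\<open>smooth_immersion\<close> speaks of atlas charts, whereas condition (B) allows any
  chart of the maximal atlas. Composition with the injective derivative of a transition map bridges
  the two.\<close>

lemma submanifold_immersion_smooth_chart:
  assumes sub: "submanifold M S" and M: "smooth_atlas M"
    and e: "e \<in> atlas S" "x \<in> fst e" and c: "c \<in> smooth_charts M" "x \<in> fst c"
  obtains D where "linear D" "(local_rep e c id has_derivative D) (at (snd e x) within model S)"
    "inj_on D (model S)" "D ` model S \<subseteq> model M"
proof -
  have S: "smooth_atlas S" using submanifoldD(1)[OF sub] by (rule smooth_manifold_imp_smooth_atlas)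
  have sS: "subspace (model S)" and sM: "subspace (model M)" using S M by (auto simp: smooth_atlas_def)
  have e': "e \<in> smooth_charts S" using e atlas_subset_smooth_charts[OF S] by auto
  have x: "x \<in> points S" using e chart_in_points[OF e'] by auto
  then have xM: "x \<in> points M" using submanifoldD(2)[OF sub] by auto
  obtain m where m: "m \<in> atlas M" "m \<in> smooth_charts M" "x \<in> fst m" by (rule atlas_chart_at[OF M xM])
  note cc = smooth_charts_chart_on[OF c(1)] and mm = smooth_charts_chart_on[OF m(2)]
    and ee = smooth_charts_chart_on[OF e']
  obtain D where D: "linear D" "(local_rep e m id has_derivative D) (at (snd e x) within model S)" "inj_on D (model S)"
    by (rule submanifold_immersion[OF sub e m(1,3) M]) (rule that)
  have inc: "smooth_near S M id x" using submanifold_inclusion[OF sub M x] by (simp add: id_def)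
  have f: "smooth_near (eucl (model S)) (eucl (model M)) (local_rep e m id) (snd e x)"
    by (rule smooth_near_local_rep[OF S M inc e' e(2) m(2)]) (use m in simp)
  have fx: "local_rep e m id (snd e x) = snd m x" using chart_inv[OF ee e(2)] by (simp add: local_rep_def)
  have idn: "smooth_near M M id x" using smooth_near_id[OF M xM] by (simp add: id_def)
  have g: "smooth_near (eucl (model M)) (eucl (model M)) (local_rep m c id) (snd m x)"
    by (rule smooth_near_local_rep[OF M M idn m(2,3) c(1)]) (use c in simp)
  have gx: "local_rep m c id (snd m x) = snd c x" using chart_inv[OF mm m(3)] by (simp add: local_rep_def)
  have h: "smooth_near (eucl (model M)) (eucl (model M)) (local_rep c m id) (snd c x)"
    by (rule smooth_near_local_rep[OF M M idn c(1,2) m(2)]) (use m in simp)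
  obtain Dg where Dg: "linear Dg" "(local_rep m c id has_derivative Dg) (at (snd m x) within model M)" "Dg ` model M \<subseteq> model M"
    by (rule smooth_near_eucl_derivative[OF sM sM g]) (rule that)
  have A: "openin (top_of_set (model M)) (snd m ` (fst m \<inter> fst c))"
    by (rule chart_image_open[OF mm openin_Int[OF chart_onD(1)[OF mm] chart_onD(1)[OF cc]]]) auto
  have injg: "inj_on Dg (model M)"
    by (rule eucl_left_inverse_inj[OF sM sM g _ A _ _ Dg(2)])
      (use h gx m c chart_inv[OF mm] chart_inv[OF cc] in \<open>auto simp: local_rep_def\<close>)
  have DM: "D ` model S \<subseteq> model M"
  proof -
    obtain A where "openin (top_of_set (model S)) A" "snd e x \<in> A" "local_rep e m id ` A \<subseteq> model M"
      using f unfolding smooth_near_eucl[OF sS sM] by blast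
    then show ?thesis by (rule has_derivative_within_subspace_image[OF D(2) sS sM])
  qed
  have comp: "(local_rep m c id \<circ> local_rep e m id has_derivative Dg \<circ> D) (at (snd e x) within model S)"
    by (rule eucl_chain[OF sS sM f D(2)]) (use Dg(2) fx in simp)
  have "openin (mtop S) {y \<in> points S. (\<lambda>x. x) y \<in> fst m}"
    by (rule smooth_near_preimage_open[OF openin_topspace submanifold_inclusion[OF sub M] chart_onD(1)[OF mm]])
  then have "openin (mtop S) ({y \<in> points S. y \<in> fst m} \<inter> fst e)" using chart_onD(1)[OF ee] by (intro openin_Int) simp_all
  then have A': "openin (top_of_set (model S)) (snd e ` ({y \<in> points S. y \<in> fst m} \<inter> fst e))"
    by (rule chart_image_open[OF ee]) auto
  have "(local_rep e c id has_derivative Dg \<circ> D) (at (snd e x) within model S)"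
    by (rule has_derivative_within_transform_openin[OF comp A'])
      (use x m e chart_inv[OF ee] chart_inv[OF mm] in \<open>auto simp: local_rep_def\<close>)
  moreover have "inj_on (Dg \<circ> D) (model S)" using comp_inj_on[OF D(3) inj_on_subset[OF injg DM]] .
  moreover have "(Dg \<circ> D) ` model S \<subseteq> model M" using DM Dg(3) by (auto simp: image_subset_iff)
  ultimately show ?thesis using that[OF linear_compose[OF D(1) Dg(1)]] by blast
qed

lemma line_has_vector_derivative:
  fixes f :: "'a::euclidean_space \<Rightarrow> 'b::euclidean_space"
  assumes f: "(f has_derivative D) (at z within E)" and E: "subspace E" "z \<in> E" "v \<in> E"
  shows "((\<lambda>t. f (z + t *\<^sub>R v)) has_vector_derivative D v) (at 0)"
proof -
  have "((\<lambda>t. z + t *\<^sub>R v) has_derivative (\<lambda>t. t *\<^sub>R v)) (at 0)"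
    by (auto intro!: derivative_eq_intros)
  moreover have "range (\<lambda>t. z + t *\<^sub>R v) \<subseteq> E" using E by (auto intro!: subspace_add subspace_scale)
  then have "(f has_derivative D) (at (z + 0 *\<^sub>R v) within range (\<lambda>t. z + t *\<^sub>R v))"
    using has_derivative_subset[OF f] by simp
  ultimately have "((\<lambda>t. f (z + t *\<^sub>R v)) has_derivative (\<lambda>t. D (t *\<^sub>R v))) (at 0)"
    using diff_chain_within[of "\<lambda>t. z + t *\<^sub>R v" _ 0 UNIV f D] by (simp add: o_def)
  then show ?thesis
    using linear_cmul[OF has_derivative_linear[OF f]] by (simp add: has_vector_derivative_def)
qed

lemma smooth_on_line: "smooth_on (\<lambda>t::real. z + t *\<^sub>R (v::'a::euclidean_space)) S"
  by (rule smooth_on_add[OF smooth_on_const smooth_on_linear]) (auto intro!: linearI simp: scaleR_add_left)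

lemma line_in_openin:
  fixes E :: "'a::euclidean_space set"
  assumes A: "openin (top_of_set E) A" "z \<in> A" and E: "subspace E" "v \<in> E"
  obtains e where "e > 0" "\<And>t. \<bar>t\<bar> < e \<Longrightarrow> z + t *\<^sub>R v \<in> A"
proof -
  obtain W where W: "open W" "A = E \<inter> W" using A(1) by (auto simp: openin_open)
  have "((\<lambda>t::real. z + t *\<^sub>R v) \<longlongrightarrow> z + 0 *\<^sub>R v) (at 0)" by (intro tendsto_intros)
  then have "\<forall>\<^sub>F t::real in at 0. z + t *\<^sub>R v \<in> W"
    using W A(2) topological_tendstoD by force
  then obtain e where e: "e > 0" "\<And>t::real. t \<noteq> 0 \<Longrightarrow> \<bar>t\<bar> < e \<Longrightarrow> z + t *\<^sub>R v \<in> W"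
    by (auto simp: eventually_at)
  have "z + t *\<^sub>R v \<in> A" if "\<bar>t\<bar> < e" for t
    using e(2)[of t] that W(2) A(2) E by (cases "t = 0") (auto intro!: subspace_add subspace_scale)
  then show ?thesis using that e(1) by blast
qed

text \<open>Straight lines in a parameter domain, shortened so as to stay in \<open>A\<close>,
  provide the curves.\<close>

lemma tangent_spaceI:
  assumes f: "smooth_on f A" "openin (top_of_set E) A" "z \<in> A" "f ` A \<subseteq> C"
    and v: "subspace E" "v \<in> E" "((\<lambda>t. f (z + t *\<^sub>R v)) has_vector_derivative d) (at 0)"
  shows "d \<in> tangent_space C (f z)"
proof -
  obtain e where e: "e > 0" "\<And>t. \<bar>t\<bar> < e \<Longrightarrow> z + t *\<^sub>R v \<in> A"
    by (rule line_in_openin[OF f(2,3) v(1,2)]) (rule that)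
  have "smooth_on (\<lambda>t. f (z + t *\<^sub>R v)) {-e<..<e}"
    by (rule smooth_on_compose[OF smooth_on_line f(1)]) (use e(2) in auto)
  moreover have "(\<lambda>t. f (z + t *\<^sub>R v)) ` {-e<..<e} \<subseteq> C"
    using e(2) f(4) by (auto simp: image_subset_iff)
  ultimately show ?thesis
    unfolding tangent_space_def using e(1) v(3)
    by (intro CollectI exI[of _ "\<lambda>t. f (z + t *\<^sub>R v)"] exI[of _ e]) simp
qed

text \<open>
  A curve in \<open>S\<close> through \<open>y\<close> is recovered from its chart image \<open>\<gamma>\<close> by a local smooth inverse of
  \<open>R \<circ> b\<close>, where \<open>R\<close> is a linear left inverse of the derivative of the inclusion \<open>b\<close>.
\<close>

lemma tangent_space_submanifold:
  assumes sub: "submanifold M S" and M: "smooth_atlas M"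
    and c: "c \<in> smooth_charts M" and y: "y \<in> points S" "y \<in> fst c"
  shows "subspace (tangent_space (snd c ` (points S \<inter> fst c)) (snd c y))"
    "tangent_space (snd c ` (points S \<inter> fst c)) (snd c y) \<subseteq> model M"
    "dim (tangent_space (snd c ` (points S \<inter> fst c)) (snd c y)) = mdim S"
proof -
  let ?C = "snd c ` (points S \<inter> fst c)"
  have S: "smooth_atlas S" using submanifoldD(1)[OF sub] by (rule smooth_manifold_imp_smooth_atlas)
  have sS: "subspace (model S)" and sM: "subspace (model M)" using S M by (auto simp: smooth_atlas_def)
  obtain e where e: "e \<in> atlas S" "e \<in> smooth_charts S" "y \<in> fst e" by (rule atlas_chart_at[OF S y(1)])
  note ee = smooth_charts_chart_on[OF e(2)] and cc = smooth_charts_chart_on[OF c]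
  define b where "b = local_rep e c id"
  obtain D where D: "linear D" "(b has_derivative D) (at (snd e y) within model S)"
    "inj_on D (model S)" "D ` model S \<subseteq> model M"
    by (rule submanifold_immersion_smooth_chart[OF sub M e(1,3) c y(2), folded b_def]) (rule that)
  let ?z = "snd e y"
  have zS: "?z \<in> model S" using e(3) openin_imp_subset[OF chart_onD(2)[OF ee]] by auto
  have inc: "smooth_near S M id y" using submanifold_inclusion[OF sub M y(1)] by (simp add: id_def)
  have idy: "id y \<in> fst c" using y by simp
  obtain A where A: "openin (mtop S) A" "y \<in> A" "A \<subseteq> fst e" "id ` A \<subseteq> fst c" "smooth_on b (snd e ` A)"
    by (rule smooth_near_charts[OF S M inc e(2,3) c idy, folded b_def]) (rule that)
  have beq: "b (snd e p) = snd c p" if "p \<in> A" for p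
    using chart_inv_subset[OF ee A(3) that] by (simp add: b_def local_rep_def)
  have eA: "openin (top_of_set (model S)) (snd e ` A)" by (rule chart_image_open[OF ee A(1,3)])
  have AS: "A \<subseteq> points S" using A(1) by (rule openin_subset)
  have bC: "b ` (snd e ` A) \<subseteq> ?C" using beq AS A(4) by auto
  have CM: "?C \<subseteq> model M" using openin_imp_subset[OF chart_onD(2)[OF cc]] by auto
  have bz: "b ?z = snd c y" using beq[OF A(2)] .
  have zA: "?z \<in> snd e ` A" using A(2) by simp
  have "tangent_space ?C (snd c y) = D ` model S"
  proof (intro equalityI subsetI)
    fix d assume "d \<in> D ` model S"
    then obtain v where v: "v \<in> model S" "d = D v" by blast
    have "((\<lambda>t. b (?z + t *\<^sub>R v)) has_vector_derivative d) (at 0)"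
      unfolding v(2) by (rule line_has_vector_derivative[OF D(2) sS zS v(1)])
    from tangent_spaceI[OF A(5) eA zA bC sS v(1) this] show "d \<in> tangent_space ?C (snd c y)" using bz by simp
  next
    fix v assume "v \<in> tangent_space ?C (snd c y)"
    then obtain \<gamma> \<epsilon> where \<gamma>: "\<epsilon> > (0::real)" "smooth_on \<gamma> {-\<epsilon><..<\<epsilon>}" "\<gamma> ` {-\<epsilon><..<\<epsilon>} \<subseteq> ?C"
      "\<gamma> 0 = snd c y" "(\<gamma> has_vector_derivative v) (at 0)"
      unfolding tangent_space_def by blast
    obtain R where R: "range R \<subseteq> model S" "linear R" "\<And>u. u \<in> model S \<Longrightarrow> R (D u) = u"
      using linear_exists_left_inverse_on[OF D(1) sS D(3)] by blast
    have "smooth_on (\<lambda>w. R (b w)) (snd e ` A)" by (rule smooth_on_linear_compose[OF A(5) R(2)])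
    moreover have "(\<lambda>w. R (b w)) ` (snd e ` A) \<subseteq> model S" using R(1) by auto
    moreover have "((\<lambda>w. R (b w)) has_derivative (\<lambda>u. R (D u))) (at ?z within model S)"
      by (rule bounded_linear.has_derivative[OF _ D(2)]) (use R(2) in \<open>simp add: linear_linear\<close>)
    moreover have "inj_on (\<lambda>u. R (D u)) (model S)" using R(3) by (intro inj_onI) simp
    ultimately obtain U V g where UV: "openin (top_of_set (model S)) U" "?z \<in> U" "U \<subseteq> snd e ` A"
      "openin (top_of_set (model S)) V" "R (b ?z) \<in> V" "(\<lambda>w. R (b w)) ` U \<subseteq> V" "g ` V \<subseteq> U"
      "\<And>u. u \<in> U \<Longrightarrow> g (R (b u)) = u" "\<And>v. v \<in> V \<Longrightarrow> R (b (g v)) = v" "smooth_on g V"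
      by (rule smooth_inverse_function_subspace[OF sS sS refl eA zA]) (rule that)
    have "openin (mtop S) ({p \<in> fst e. snd e p \<in> U} \<inter> A)"
      using chart_preimage_open[OF ee UV(1)] A(1) by (rule openin_Int)
    \<comment> \<open>Here the embedded topology enters: an open part of \<open>S\<close> is cut out
      by an open set \<open>W\<close> of \<open>M\<close>, so near its start a curve in the image of
      \<open>S\<close> stays in the part parametrized by \<open>U\<close>. For a merely immersed
      \<open>S\<close> it could continue on another sheet.\<close>
    then have "openin (subtopology (mtop M) (points S)) ({p \<in> fst e. snd e p \<in> U} \<inter> A)"
      by (rule subst[OF submanifoldD(3)[OF sub], of "\<lambda>T. openin T ({p \<in> fst e. snd e p \<in> U} \<inter> A)"])
    then obtain W where W: "openin (mtop M) W" "{p \<in> fst e. snd e p \<in> U} \<inter> A = W \<inter> points S"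
      unfolding openin_subtopology by blast
    have "openin (mtop M) (W \<inter> fst c)" using W(1) chart_onD(1)[OF cc] by (rule openin_Int)
    then have "openin (top_of_set (model M)) (snd c ` (W \<inter> fst c))" by (rule chart_image_open[OF cc]) auto
    then obtain O' where O': "open O'" "snd c ` (W \<inter> fst c) = model M \<inter> O'" by (auto simp: openin_open)
    have "y \<in> {p \<in> fst e. snd e p \<in> U} \<inter> A" using e(3) UV(2) A(2) by simp
    then have yW: "y \<in> W" using W(2) by blast
    then have "\<gamma> 0 \<in> O'" using O'(2) \<gamma>(4) y(2) by blast
    moreover have "isCont \<gamma> 0" using \<gamma>(5) by (rule has_vector_derivative_continuous)
    ultimately have "\<forall>\<^sub>F t in at 0. \<gamma> t \<in> O'" using O'(1) by (simp add: isCont_def topological_tendstoD)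
    then obtain r where r: "r > 0" "\<And>t. t \<noteq> 0 \<Longrightarrow> \<bar>t\<bar> < r \<Longrightarrow> \<gamma> t \<in> O'" by (auto simp: eventually_at)
    define \<delta> where "\<delta> = min r \<epsilon>"
    have \<delta>: "\<delta> > 0" "\<delta> \<le> r" "\<delta> \<le> \<epsilon>" using r(1) \<gamma>(1) by (auto simp: \<delta>_def)
    \<comment> \<open>On the image of \<open>U\<close> under \<open>b\<close> the map
      \<open>b \<circ> g \<circ> R\<close> is the identity, so \<open>\<gamma>\<close> lifts to the
      smooth curve \<open>g (R (\<gamma> t))\<close> in the model of \<open>S\<close>.\<close>
    have main: "R (\<gamma> t) \<in> V \<and> b (g (R (\<gamma> t))) = \<gamma> t" if t: "\<bar>t\<bar> < \<delta>" for t
    proof -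
      have "t \<in> {-\<epsilon><..<\<epsilon>}" using t \<delta>(3) by auto
      then have "\<gamma> t \<in> ?C" using \<gamma>(3) by blast
      then obtain p where p: "p \<in> points S" "p \<in> fst c" "\<gamma> t = snd c p" by blast
      have "\<gamma> t \<in> O'" using r(2)[of t] t \<delta>(2) \<open>\<gamma> 0 \<in> O'\<close> by (cases "t = 0") auto
      then have "\<gamma> t \<in> snd c ` (W \<inter> fst c)" using \<open>\<gamma> t \<in> ?C\<close> CM O'(2) by blast
      then have "p \<in> W" using p chart_inj[OF cc] by (auto dest: inj_onD)
      then have "p \<in> {p \<in> fst e. snd e p \<in> U} \<inter> A" using W(2) p(1) by blast
      then have pU: "snd e p \<in> U" "p \<in> A" by auto
      then show ?thesis using UV(6,8) beq[OF pU(2)] p(3) by (metis image_subset_iff)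
    qed
    let ?I = "{-\<delta><..<\<delta>}"
    have I: "0 \<in> ?I" "open ?I" using \<delta>(1) by auto
    have sg: "smooth_on (\<lambda>t. g (R (\<gamma> t))) ?I"
      by (rule smooth_on_compose[OF smooth_on_linear_compose[OF smooth_on_subset[OF \<gamma>(2)] R(2)] UV(10)])
        (use main \<delta>(3) in auto)
    obtain d where d: "((\<lambda>t. g (R (\<gamma> t))) has_derivative d) (at 0 within ?I)"
      using smooth_on_imp_has_derivative[OF sg I(1)] by blast
    have lind: "linear d" using d by (rule has_derivative_linear)
    have gS: "(\<lambda>t. g (R (\<gamma> t))) ` ?I \<subseteq> model S"
    proof clarify
      fix t assume "t \<in> ?I"
      then have "R (\<gamma> t) \<in> V" using main[of t] by auto
      then show "g (R (\<gamma> t)) \<in> model S" using UV(7) openin_imp_subset[OF UV(1)] by blast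
    qed
    have g0: "g (R (\<gamma> 0)) = ?z" using UV(8)[OF UV(2)] \<gamma>(4) bz by simp
    have "(b has_derivative D) (at (g (R (\<gamma> 0))) within (\<lambda>t. g (R (\<gamma> t))) ` ?I)"
      using D(2) gS unfolding g0 by (rule has_derivative_subset)
    from diff_chain_within[OF d this]
    have "((\<lambda>t. b (g (R (\<gamma> t)))) has_derivative D \<circ> d) (at 0 within ?I)" by (simp add: o_def)
    then have "(\<gamma> has_derivative D \<circ> d) (at 0 within ?I)"
      by (rule has_derivative_transform[rotated 2]) (use main I(1) in auto)
    then have "(\<gamma> has_derivative D \<circ> d) (at 0)" using at_within_open[OF I] by simp
    \<comment> \<open>Both are derivatives of \<open>\<gamma>\<close> at \<open>0\<close>;
      evaluation at \<open>1\<close> exhibits \<open>v\<close> in the image of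
      \<open>D\<close>.\<close>
    then have "D \<circ> d = (\<lambda>t. t *\<^sub>R v)"
      using \<gamma>(5) has_derivative_unique unfolding has_vector_derivative_def by blast
    then have "v = D (d 1)" by (metis comp_apply scaleR_one)
    moreover have "d 1 \<in> model S"
    proof -
      have "((\<lambda>t. g (R (\<gamma> t))) has_derivative d) (at 0 within UNIV)"
        using d at_within_open[OF I] by simp
      then have "d ` UNIV \<subseteq> model S"
        by (rule has_derivative_within_subspace_image[OF _ subspace_UNIV sS _ I(1) gS]) (use I(2) in auto)
      then show ?thesis by auto
    qed
    ultimately show "v \<in> D ` model S" by blast
  qed
  then show "subspace (tangent_space ?C (snd c y))" "tangent_space ?C (snd c y) \<subseteq> model M"
    "dim (tangent_space ?C (snd c y)) = mdim S"
    using D sS linear_subspace_image[OF D(1) sS] dim_image_eq[OF D(1), of "model S"]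
    by (simp_all add: span_eq_iff[THEN iffD2])
qed

section \<open>Whitney stratifications of orbit spaces\<close>

lemma smooth_near_limitin:
  assumes f: "smooth_near M N f p" and xs: "limitin (mtop M) xs p sequentially"
  shows "limitin (mtop N) (\<lambda>k. f (xs k)) (f p) sequentially"
  unfolding limitin_def
proof (intro conjI allI impI)
  show "f p \<in> points N" by (rule smooth_near_points(2)[OF f])
  fix U assume U: "openin (mtop N) U \<and> f p \<in> U"
  show "\<forall>\<^sub>F k in sequentially. f (xs k) \<in> U"
  proof (rule smooth_near_neighbourhood[OF f])
    fix A assume A: "openin (mtop M) A" "p \<in> A"
      and "\<And>B. openin (mtop N) B \<Longrightarrow> openin (mtop M) {x \<in> A. f x \<in> B}"
    then have "openin (mtop M) {x \<in> A. f x \<in> U}" "p \<in> {x \<in> A. f x \<in> U}" using U by auto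
    then have "\<forall>\<^sub>F k in sequentially. xs k \<in> {x \<in> A. f x \<in> U}" using xs unfolding limitin_def by blast
    then show ?thesis by (rule eventually_mono) simp
  qed
qed

text \<open>Provides a directional derivative that depends continuously on the base point. Applied
  to a family of orbits, it makes orbit directions at nearby points converge.\<close>

lemma smooth_near_directional_derivative:
  assumes P: "subspace P" and E: "subspace E" and f: "smooth_near (eucl P) (eucl E) f z" and u: "u \<in> P"
  obtains A \<Delta> where "openin (top_of_set P) A" "z \<in> A"
    "\<And>w. w \<in> A \<Longrightarrow> ((\<lambda>t. f (w + t *\<^sub>R u)) has_vector_derivative \<Delta> w) (at 0)" "continuous_on A \<Delta>"
proof -
  obtain A0 where A0: "openin (top_of_set P) A0" "z \<in> A0" "smooth_on f A0"
    using f unfolding smooth_near_eucl[OF P E] by blast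
  obtain V g where g: "open V" "z \<in> V" "\<And>k. Ck_on k g V" "\<And>y. y \<in> V \<Longrightarrow> y \<in> A0 \<Longrightarrow> g y = f y"
    by (rule smooth_onE[OF A0(3,2)]) (rule that)
  define A where "A = A0 \<inter> V"
  have A: "openin (top_of_set P) A" "z \<in> A" using A0 g by (auto simp: A_def openin_Int_open)
  show ?thesis
  proof (rule that[OF A])
    fix w assume w: "w \<in> A"
    then have "(g has_derivative frechet_derivative g (at w)) (at w within P)"
      using Ck_on_SucD_has_derivative[OF g(3)] by (auto simp: A_def intro: has_derivative_at_withinI)
    then have "(f has_derivative frechet_derivative g (at w)) (at w within P)"
      by (rule has_derivative_within_transform_openin[OF _ A(1) w]) (use g(4) in \<open>auto simp: A_def\<close>)
    moreover have "w \<in> P" using w openin_imp_subset[OF A(1)] by blast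
    ultimately show "((\<lambda>t. f (w + t *\<^sub>R u)) has_vector_derivative frechet_derivative g (at w) u) (at 0)"
      using P u by (intro line_has_vector_derivative)
  next
    have "Ck_on 0 (\<lambda>w. frechet_derivative g (at w) u) V" using g(3)[of "Suc 0"] by simp
    then show "continuous_on A (\<lambda>w. frechet_derivative g (at w) u)"
      by (auto simp: A_def intro: continuous_on_subset)
  qed
qed

text \<open>An open map carries neighbourhoods of \<open>x\<close> to neighbourhoods of
  \<open>f x\<close>, and saturation turns a point whose image lies in that of \<open>A\<close> into
  a point of \<open>A\<close>. The converse is continuity.\<close>

lemma closure_of_saturated_iff:
  assumes f: "open_map X Y f" "continuous_map X Y f" and A: "A \<subseteq> topspace X"
    "{x \<in> topspace X. f x \<in> f ` A} = A" and x: "x \<in> topspace X"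
  shows "f x \<in> Y closure_of (f ` A) \<longleftrightarrow> x \<in> X closure_of A"
proof
  assume fx: "f x \<in> Y closure_of (f ` A)"
  show "x \<in> X closure_of A"
    unfolding in_closure_of
  proof (intro conjI allI impI x)
    fix U assume U: "x \<in> U \<and> openin X U"
    then have "openin Y (f ` U)" "f x \<in> f ` U" using f(1) by (auto simp: open_map_def)
    then obtain q where "q \<in> f ` A" "q \<in> f ` U" using fx unfolding in_closure_of by blast
    then obtain u where "u \<in> U" "q = f u" by blast
    then have "u \<in> U" "f u \<in> f ` A" using \<open>q \<in> f ` A\<close> by simp_all
    then show "\<exists>y. y \<in> A \<and> y \<in> U" using A(2) U openin_subset by blast
  qed
next
  assume "x \<in> X closure_of A"
  then show "f x \<in> Y closure_of (f ` A)" using continuous_map_image_closure_subset[OF f(2), of A] by blast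
qed

context free_compact_action
begin

text \<open>The orbits through all slice points form one smooth map on a product; its derivatives in
  the group direction relate tangent vectors of neighbouring orbits.\<close>

lemma orbit_family_smooth_near:
  assumes F: "subspace F" and l: "l \<in> smooth_charts L" "w \<in> snd l ` fst l"
    and s: "smooth_near (eucl F) M s n" and c: "c \<in> smooth_charts M" "\<alpha> (inv_into (fst l) (snd l) w) (s n) \<in> fst c"
  shows "smooth_near (eucl (model L \<times> F)) (eucl (model M))
    (\<lambda>z. snd c (\<alpha> (inv_into (fst l) (snd l) (fst z)) (s (snd z)))) (w, n)"
proof -
  note E = subspace_models(1) and sM = subspace_models(2)
  have P: "subspace (model L \<times> F)" using E F by (rule subspace_Times)
  note EL = smooth_atlas_eucl[OF E] and EM = smooth_atlas_eucl[OF sM] and EF = smooth_atlas_eucl[OF F]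
    and EP = smooth_atlas_eucl[OF P]
  have "w \<in> model L" using l openin_imp_subset[OF chart_onD(2)[OF smooth_charts_chart_on[OF l(1)]]] by auto
  moreover have "n \<in> F" using smooth_near_points(1)[OF s] by simp
  ultimately have wn: "(w, n) \<in> model L \<times> F" by simp
  have "smooth_near (eucl (model L \<times> F)) L (inv_into (fst l) (snd l) \<circ> fst) (w, n)"
    by (rule smooth_near_compose[OF EP EL atlas_L smooth_near_eucl_linear[OF P E linear_fst _ wn]
          smooth_near_inv_chart[OF atlas_L l(1)]]) (use l in auto)
  moreover have "smooth_near (eucl (model L \<times> F)) M (s \<circ> snd) (w, n)"
    by (rule smooth_near_compose[OF EP EF atlas_M smooth_near_eucl_linear[OF P F linear_snd _ wn]]) (use s in auto)
  ultimately have "smooth_near (eucl (model L \<times> F)) M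
      (\<lambda>z. \<alpha> ((inv_into (fst l) (snd l) \<circ> fst) z) ((s \<circ> snd) z)) (w, n)"
    by (rule smooth_near_act[OF EP])
  from smooth_near_compose[OF EP atlas_M EM this smooth_near_chart[OF atlas_M c(1)]] c(2)
  show ?thesis by (simp add: o_def)
qed

text \<open>Group elements moving along a line in the chart \<open>l\<close> carry \<open>y\<close>
  along a curve in its orbit, hence in \<open>A\<close>; \<open>d\<close> is the velocity of this
  curve in the chart \<open>c\<close>.\<close>

lemma orbit_tangent:
  assumes y: "y \<in> points M" "y \<in> fst c" and c: "c \<in> smooth_charts M" and l: "l \<in> smooth_charts L" "\<one> \<in> fst l"
    and A: "\<And>g. g \<in> carrier G \<Longrightarrow> \<alpha> g y \<in> A" and u: "u \<in> model L"
    and d: "((\<lambda>t. snd c (\<alpha> (inv_into (fst l) (snd l) (snd l \<one> + t *\<^sub>R u)) y)) has_vector_derivative d) (at 0)"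
  shows "d \<in> tangent_space (snd c ` (A \<inter> fst c)) (snd c y)"
proof -
  let ?f = "\<lambda>w. snd c (\<alpha> (inv_into (fst l) (snd l) w) y)"
  note ll = smooth_charts_chart_on[OF l(1)] and cc = smooth_charts_chart_on[OF c]
  have li: "inv_into (fst l) (snd l) (snd l g) = g" if "g \<in> fst l" for g using chart_inv[OF ll that] .
  have lG: "fst l \<subseteq> carrier G" using chart_in_points[OF l(1)] points_L by simp
  have "smooth_near L M (\<lambda>g. \<alpha> g y) g" if "g \<in> points L" for g
    using that points_L y
    by (intro smooth_near_act[OF atlas_L] smooth_near_id smooth_near_const atlas_L atlas_M) auto
  then have "openin (mtop L) {g \<in> fst l. \<alpha> g y \<in> fst c}"
    using chart_in_points[OF l(1)] chart_onD(1)[OF cc]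
    by (intro smooth_near_preimage_open[where N = M] chart_onD(1)[OF ll]) auto
  then have W: "openin (top_of_set (model L)) (snd l ` {g \<in> fst l. \<alpha> g y \<in> fst c})" (is "openin _ ?W")
    by (rule chart_image_open[OF ll]) auto
  have sm: "smooth_on ?f ?W"
  proof (rule smooth_on_if_smooth_near[OF subspace_models W])
    fix w assume "w \<in> ?W"
    then obtain g where "g \<in> fst l" "\<alpha> g y \<in> fst c" "w = snd l g" by blast
    then show "smooth_near (eucl (model L)) (eucl (model M)) ?f w"
      using li by (intro orbit_map_smooth_near[OF y(1) c l(1) _ y(1)]) auto
  qed
  have z: "snd l \<one> \<in> ?W" using l y by (intro imageI) simp
  have img: "?f ` ?W \<subseteq> snd c ` (A \<inter> fst c)" using li A lG by auto
  have fz: "?f (snd l \<one>) = snd c y" using li[OF l(2)] y by simp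
  show ?thesis using tangent_spaceI[OF sm W z img subspace_models(1) u d] unfolding fz .
qed

end

text \<open>
  A slice built in the chart \<open>\<chi>\<close> of the condition for \<open>(R, S)\<close> yields a chart of \<open>M/G\<close> whose inverse is
  affine in \<open>\<chi>\<close>. So secants are carried to secants by the linear map \<open>B\<close>, and the tangent spaces of \<open>S\<close>
  contain the images under \<open>B\<close> of those of \<open>S/G\<close> together with the tangent spaces of the orbits.
\<close>

lemma whitney_B_quotient:
  fixes M R S :: "('a, 'e::euclidean_space) manifold"
  assumes M: "free_compact_action G L M \<alpha>" and R: "free_compact_action G L R \<alpha>"
    and S: "free_compact_action G L S \<alpha>"
    and subR: "submanifold M R" and subS: "submanifold M S"
    and Q: "quotient_manifold G \<alpha> M Q" and TR: "quotient_manifold G \<alpha> R TR"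
    and TS: "quotient_manifold G \<alpha> S TS"
    and x: "x \<in> points R" and B_reg: "whitney_B_regular_at M R S x"
  shows "whitney_B_regular_at Q TR TS (orbit G \<alpha> x)"
proof -
  interpret m: free_compact_action G L M \<alpha> by fact
  interpret r: free_compact_action G L R \<alpha> by fact
  interpret s: free_compact_action G L S \<alpha> by fact
  let ?pi = "orbit G \<alpha>"
  note aM = m.atlas_M and aQ = m.atlas_Q[OF Q]
  have "\<exists>c\<in>smooth_charts M. x \<in> fst c \<and> (\<forall>xs ys l \<tau>.
           (\<forall>k. xs k \<in> points R \<inter> fst c) \<and> (\<forall>k. ys k \<in> points S \<inter> fst c) \<and>
           limitin (mtop M) xs x sequentially \<and> limitin (mtop M) ys x sequentially \<and>
           limitin (Grassmannian 1 (model M)) (\<lambda>k. span {snd c (ys k) - snd c (xs k)}) l sequentially \<and>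
           limitin (Grassmannian (mdim S) (model M))
             (\<lambda>k. tangent_space (snd c ` (points S \<inter> fst c)) (snd c (ys k))) \<tau> sequentially
           \<longrightarrow> l \<subseteq> \<tau>)"
    using B_reg unfolding whitney_B_regular_at_def case_prod_unfold .
  then obtain c where c: "c \<in> smooth_charts M" "x \<in> fst c" and reg: "\<And>xs ys l \<tau>.
      (\<forall>k. xs k \<in> points R \<inter> fst c) \<and> (\<forall>k. ys k \<in> points S \<inter> fst c) \<and>
      limitin (mtop M) xs x sequentially \<and> limitin (mtop M) ys x sequentially \<and>
      limitin (Grassmannian 1 (model M)) (\<lambda>k. span {snd c (ys k) - snd c (xs k)}) l sequentially \<and>
      limitin (Grassmannian (mdim S) (model M))
        (\<lambda>k. tangent_space (snd c ` (points S \<inter> fst c)) (snd c (ys k))) \<tau> sequentially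
      \<Longrightarrow> l \<subseteq> \<tau>"
    by (elim bexE conjE) (rule that, assumption, assumption, elim allE impE, assumption, assumption)
  have xM: "x \<in> points M" using x submanifoldD(2)[OF subR] by auto
  note F = m.subspace_Q[OF Q]
  \<comment> \<open>The slice is taken over \<open>model Q\<close>, so that it yields a chart of the
    given \<open>Q\<close> and not only of an orbit manifold with another model.\<close>
  obtain l k B N \<rho> where ad: "m.adapted_slice c x (model Q) l k B N \<rho>"
    using m.adapted_slice_exists[OF xM c F m.mdim_quotient[OF Q xM]] by blast
  define s where "s n = inv_into (fst c) (snd c) (snd c x + B n)" for n
  have l: "l \<in> smooth_charts L" "\<one>\<^bsub>G\<^esub> \<in> fst l"
    and k: "((\<lambda>w. snd c (\<alpha> (inv_into (fst l) (snd l) w) x)) has_derivative k) (at (snd l \<one>\<^bsub>G\<^esub>) within model L)"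
    and kd: "k ` model L \<subseteq> model M" "dim (k ` model L) = mdim L"
    and B: "linear B" "B ` model Q \<subseteq> model M" "inj_on B (model Q)" "k ` model L \<inter> B ` model Q = {0}"
    and sl: "m.is_slice (model Q) N s \<rho>" and N0: "0 \<in> N"
    and Nc: "\<And>n. n \<in> N \<Longrightarrow> snd c x + B n \<in> snd c ` fst c"
    using ad unfolding m.adapted_slice_def s_def[abs_def] by blast+
  note cc = smooth_charts_chart_on[OF c(1)] and ll = smooth_charts_chart_on[OF l(1)]
  have cs: "snd c (s n) = snd c x + B n" "s n \<in> fst c" if "n \<in> N" for n
    using Nc[OF that] by (auto simp: s_def f_inv_into_f intro: inv_into_into)
  have s0: "s 0 = x" using chart_inv[OF cc c(2)] linear_0[OF B(1)] by (simp add: s_def)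
  define d where "d = m.slice_chart N s \<rho>"
  have d: "d \<in> smooth_charts Q" unfolding d_def by (rule m.slice_chart_in_smooth_charts[OF Q sl])
  note dd = smooth_charts_chart_on[OF d]
  have dV: "fst d = ?pi ` s ` N" by (simp add: d_def m.slice_chart_def)
  have ds: "snd d (?pi (s n)) = n" if "n \<in> N" for n unfolding d_def by (rule m.slice_chart_s[OF sl that])
  have dN: "snd d q \<in> N" "?pi (s (snd d q)) = q" if "q \<in> fst d" for q
    using that ds unfolding dV by auto
  have xd: "?pi x \<in> fst d" "snd d (?pi x) = 0" using N0 s0 ds[OF N0] unfolding dV by auto
  \<comment> \<open>A stratum is a union of orbits, so it contains the slice representative of each
    of its orbits that meets the slice.\<close>
  have lift: "s (snd d q) \<in> points S'"
    if q: "q \<in> fst d" "q \<in> points T'" and S': "free_compact_action G L S' \<alpha>" "submanifold M S'"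
      and T': "quotient_manifold G \<alpha> S' T'" for q S' and T' :: "('a set, 'e) manifold"
  proof -
    note qs = quotient_subtopology[OF M S' Q T']
    have "points T' = ?pi ` points S'" by (rule free_compact_action.points_Q[OF S'(1) T'])
    then have "?pi (s (snd d q)) \<in> ?pi ` points S'" using dN(2)[OF q(1)] q(2) by simp
    then show ?thesis
      using m.pi_in_image_iff[OF submanifoldD(2)[OF S'(2)] m.is_sliceD(6)[OF sl dN(1)[OF q(1)]]] qs(3) by simp
  qed
  have sd: "smooth_near Q M (s \<circ> snd d) (?pi x)"
    by (rule smooth_near_compose[OF aQ smooth_atlas_eucl[OF F] aM smooth_near_chart[OF aQ d xd(1)]])
      (use m.is_sliceD(2)[OF sl N0] xd(2) in simp)
  show ?thesis
    unfolding whitney_B_regular_at_def case_prod_unfold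
  proof (intro bexI[OF _ d] conjI xd(1) allI impI)
    fix xs ys el \<tau>
    assume "(\<forall>k. xs k \<in> points TR \<inter> fst d) \<and> (\<forall>k. ys k \<in> points TS \<inter> fst d) \<and>
       limitin (mtop Q) xs (?pi x) sequentially \<and> limitin (mtop Q) ys (?pi x) sequentially \<and>
       limitin (Grassmannian 1 (model Q)) (\<lambda>k. span {snd d (ys k) - snd d (xs k)}) el sequentially \<and>
       limitin (Grassmannian (mdim TS) (model Q))
         (\<lambda>k. tangent_space (snd d ` (points TS \<inter> fst d)) (snd d (ys k))) \<tau> sequentially"
    then have xs: "\<And>k. xs k \<in> points TR" "\<And>k. xs k \<in> fst d" and ys: "\<And>k. ys k \<in> points TS" "\<And>k. ys k \<in> fst d"
      and lim: "limitin (mtop Q) xs (?pi x) sequentially" "limitin (mtop Q) ys (?pi x) sequentially"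
      and limel: "limitin (Grassmannian 1 (model Q)) (\<lambda>k. span {snd d (ys k) - snd d (xs k)}) el sequentially"
      and lim\<tau>: "limitin (Grassmannian (mdim TS) (model Q))
         (\<lambda>k. tangent_space (snd d ` (points TS \<inter> fst d)) (snd d (ys k))) \<tau> sequentially"
      by auto
    \<comment> \<open>These lifts converge to \<open>x\<close> itself, since the slice passes
      through \<open>x\<close> at the parameter \<open>0\<close>.\<close>
    define X Y where "X k = s (snd d (xs k))" and "Y k = s (snd d (ys k))" for k
    let ?n = "\<lambda>k. snd d (ys k)"
    have nN: "?n k \<in> N" for k using dN(1)[OF ys(2)] .
    have XY: "X k \<in> points R \<inter> fst c" "Y k \<in> points S \<inter> fst c" for k
      using lift[OF xs(2,1) R subR TR] lift[OF ys(2,1) S subS TS] cs(2)[OF dN(1)[OF xs(2)]] cs(2)[OF nN]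
      by (auto simp: X_def Y_def)
    have limXY: "limitin (mtop M) X x sequentially" "limitin (mtop M) Y x sequentially"
      using smooth_near_limitin[OF sd lim(1)] smooth_near_limitin[OF sd lim(2)] xd(2) s0
      by (simp_all add: X_def[abs_def] Y_def[abs_def])
    have "limitin (mtop (eucl (model Q))) ?n (snd d (?pi x)) sequentially"
      by (rule smooth_near_limitin[OF smooth_near_chart[OF aQ d xd(1)] lim(2)])
    then have n0: "?n \<longlonglongrightarrow> 0" using xd(2) by (simp add: limitin_subtopology)
    have secant: "span {snd c (Y k) - snd c (X k)} = B ` span {snd d (ys k) - snd d (xs k)}" for k
    proof -
      have "snd c (Y k) - snd c (X k) = B (snd d (ys k) - snd d (xs k))"
        using cs(1)[OF dN(1)[OF xs(2)]] cs(1)[OF nN] by (simp add: X_def Y_def linear_diff[OF B(1)])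
      then show ?thesis using linear_span_image[OF B(1), of "{snd d (ys k) - snd d (xs k)}"] by simp
    qed
    have limB: "limitin (Grassmannian 1 (model M)) (\<lambda>k. span {snd c (Y k) - snd c (X k)}) (B ` el) sequentially"
      unfolding secant by (rule limitin_Grassmannian_linear_image[OF limel B(1-3)])
    let ?t = "\<lambda>k. tangent_space (snd c ` (points S \<inter> fst c)) (snd c (Y k))"
    let ?t' = "\<lambda>k. tangent_space (snd d ` (points TS \<inter> fst d)) (snd d (ys k))"
    let ?K = "k ` model L"
    \<comment> \<open>The candidate for the limit of the tangent spaces of \<open>S\<close> at the
      lifts \<open>Y k\<close>. The sum is direct, as the image of \<open>B\<close> on the model
      meets the tangent space of the orbit only in \<open>0\<close>.\<close>
    define \<tau>' where "\<tau>' = {a + b | a b. a \<in> B ` \<tau> \<and> b \<in> ?K}"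
    note \<tau> = limitin_GrassmannianD[OF lim\<tau>]
    have t: "subspace (?t k)" "?t k \<subseteq> model M" "dim (?t k) = mdim S" for k
      using tangent_space_submanifold[OF subS aM c(1), of "Y k"] XY(2)[of k] by auto
    \<comment> \<open>The affine map with linear part \<open>B\<close> carries curves in the chart
      image of \<open>TS\<close> to curves in the chart image of \<open>S\<close>, because it is the
      slice seen in the two charts.\<close>
    have Bt: "B v \<in> ?t k" if v: "v \<in> ?t' k" for v k
    proof -
      obtain \<gamma> e where \<gamma>: "e > (0::real)" "smooth_on \<gamma> {-e<..<e}" "\<gamma> ` {-e<..<e} \<subseteq> snd d ` (points TS \<inter> fst d)"
        "\<gamma> 0 = snd d (ys k)" "(\<gamma> has_vector_derivative v) (at 0)"
        using v unfolding tangent_space_def by blast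
      have "smooth_on (\<lambda>t. snd c x + B (\<gamma> t)) {-e<..<e}"
        by (rule smooth_on_add[OF smooth_on_const smooth_on_linear_compose[OF \<gamma>(2) B(1)]])
      moreover have "(\<lambda>t. snd c x + B (\<gamma> t)) ` {-e<..<e} \<subseteq> snd c ` (points S \<inter> fst c)"
      proof
        fix z assume "z \<in> (\<lambda>t. snd c x + B (\<gamma> t)) ` {-e<..<e}"
        then obtain t where "t \<in> {-e<..<e}" "z = snd c x + B (\<gamma> t)" by blast
        moreover from this obtain q where "q \<in> points TS" "q \<in> fst d" "\<gamma> t = snd d q" using \<gamma>(3) by blast
        ultimately have "z = snd c (s (snd d q))" "s (snd d q) \<in> points S \<inter> fst c"
          using cs[OF dN(1)] lift[OF _ _ S subS TS] by auto
        then show "z \<in> snd c ` (points S \<inter> fst c)" by blast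
      qed
      moreover have "((\<lambda>t. snd c x + B (\<gamma> t)) has_vector_derivative 0 + B v) (at 0)"
        using B(1) by (intro has_vector_derivative_add has_vector_derivative_const
            bounded_linear.has_vector_derivative[OF _ \<gamma>(5)]) (simp add: linear_linear)
      moreover have "snd c x + B (\<gamma> 0) = snd c (Y k)" using cs(1)[OF nN] \<gamma>(4) by (simp add: Y_def)
      ultimately show ?thesis
        unfolding tangent_space_def using \<gamma>(1)
        by (intro CollectI exI[of _ "\<lambda>t. snd c x + B (\<gamma> t)"] exI[of _ e]) simp
    qed
    \<comment> \<open>Orbit directions at \<open>x\<close> are limits of orbit directions at
      \<open>Y k\<close>, and the latter are tangent to \<open>S\<close>. The point \<open>x\<close>
      itself lies in \<open>R\<close>, so its directions enter only as limits.\<close>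
    have Kt: "\<exists>w. (\<forall>\<^sub>F k in sequentially. w k \<in> ?t k) \<and> w \<longlonglongrightarrow> k u" if u: "u \<in> model L" for u
    proof -
      let ?li = "inv_into (fst l) (snd l)" and ?z = "snd l \<one>\<^bsub>G\<^esub>"
      define \<Psi> where "\<Psi> z = snd c (\<alpha> (?li (fst z)) (s (snd z)))" for z
      have P: "subspace (model L \<times> model Q)" using m.subspace_models(1) F by (rule subspace_Times)
      have li: "?li ?z = \<one>\<^bsub>G\<^esub>" by (rule chart_inv[OF ll l(2)])
      have zL: "?z \<in> model L" using l(2) openin_imp_subset[OF chart_onD(2)[OF ll]] by auto
      have "smooth_near (eucl (model L \<times> model Q)) (eucl (model M)) \<Psi> (?z, 0)"
        unfolding \<Psi>_def
        by (rule m.orbit_family_smooth_near[OF F l(1) _ m.is_sliceD(2)[OF sl N0] c(1)]) (use l li s0 xM c in auto)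
      moreover have uP: "(u, 0) \<in> model L \<times> model Q" using u subspace_0[OF F] by simp
      ultimately obtain A \<Delta> where A: "openin (top_of_set (model L \<times> model Q)) A" "(?z, 0) \<in> A"
        "\<And>w. w \<in> A \<Longrightarrow> ((\<lambda>t. \<Psi> (w + t *\<^sub>R (u, 0))) has_vector_derivative \<Delta> w) (at 0)" "continuous_on A \<Delta>"
        by (rule smooth_near_directional_derivative[OF P m.subspace_models(2)]) (rule that)
      have "((\<lambda>t. snd c (\<alpha> (?li (?z + t *\<^sub>R u)) x)) has_vector_derivative k u) (at 0)"
        by (rule line_has_vector_derivative[OF k m.subspace_models(1) zL u])
      moreover have "((\<lambda>t. snd c (\<alpha> (?li (?z + t *\<^sub>R u)) x)) has_vector_derivative \<Delta> (?z, 0)) (at 0)"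
        using A(3)[OF A(2)] by (simp add: \<Psi>_def s0)
      ultimately have D0: "\<Delta> (?z, 0) = k u" by (metis vector_derivative_at)
      obtain W where W: "open W" "A = (model L \<times> model Q) \<inter> W" using A(1) by (auto simp: openin_open)
      have lim1: "(\<lambda>k. (?z, ?n k)) \<longlonglongrightarrow> (?z, 0)" using n0 by (intro tendsto_intros)
      have "\<forall>\<^sub>F k in sequentially. (?z, ?n k) \<in> W" using lim1 W A(2) topological_tendstoD by blast
      then have evA: "\<forall>\<^sub>F k in sequentially. (?z, ?n k) \<in> A"
        by (rule eventually_mono)
          (use W(2) zL nN openin_imp_subset[OF m.is_sliceD(1)[OF sl]] in blast)
      have "(\<lambda>k. \<Delta> (?z, ?n k)) \<longlonglongrightarrow> k u"
        using continuous_on_tendsto_compose[OF A(4) lim1 A(2) evA] D0 by simp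
      moreover have "\<forall>\<^sub>F k in sequentially. \<Delta> (?z, ?n k) \<in> ?t k"
        using evA
      proof (rule eventually_mono)
        fix k assume "(?z, ?n k) \<in> A"
        from A(3)[OF this]
        have "((\<lambda>t. snd c (\<alpha> (?li (?z + t *\<^sub>R u)) (Y k))) has_vector_derivative \<Delta> (?z, ?n k)) (at 0)"
          by (simp add: \<Psi>_def Y_def)
        moreover have "Y k \<in> points M" "Y k \<in> points S" "Y k \<in> fst c" using XY(2)[of k] submanifoldD(2)[OF subS] by auto
        ultimately show "\<Delta> (?z, ?n k) \<in> ?t k"
          using u by (intro m.orbit_tangent[OF _ _ c(1) l]) auto
      qed
      ultimately show ?thesis by (intro exI[of _ "\<lambda>k. \<Delta> (?z, ?n k)"] conjI)
    qed
    have BtM: "B ` \<tau> \<subseteq> model M" "inj_on B \<tau>" using B(2) \<tau>(2) inj_on_subset[OF B(3)] by auto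
    have sB: "subspace (B ` \<tau>)" using \<tau>(1) B(1) linear_subspace_image by blast
    have link: "linear k" using k by (rule has_derivative_linear)
    have sK: "subspace ?K" using link m.subspace_models(1) linear_subspace_image by blast
    have int0: "B ` \<tau> \<inter> ?K = {0}" using B(4) \<tau>(2) subspace_0[OF sB] subspace_0[OF sK] by blast
    have "dim (B ` \<tau>) = mdim TS"
      using dim_image_eq[OF B(1), of \<tau>] BtM(2) \<tau>(1,3) by (simp add: span_eq_iff[THEN iffD2])
    \<comment> \<open>The count needs a point of \<open>S\<close>, and \<open>Y 0\<close> provides
      one. It makes \<open>\<tau>'\<close> as large as the tangent spaces of \<open>S\<close>, as
      testing convergence on vectors requires.\<close>
    moreover have "mdim TS + mdim L = mdim S" using s.mdim_quotient[OF TS] XY(2)[of 0] by blast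
    ultimately have dim\<tau>': "dim \<tau>' = mdim S"
      using dim_sums_Int[OF sB sK] int0 kd(2) by (simp add: \<tau>'_def)
    have lim\<tau>': "limitin (Grassmannian (mdim S) (model M)) ?t \<tau>' sequentially"
    proof (rule limitin_GrassmannianI)
      show "subspace \<tau>'" unfolding \<tau>'_def by (rule subspace_sums[OF sB sK])
      show "\<tau>' \<subseteq> model M"
      proof
        fix v assume "v \<in> \<tau>'"
        then obtain a b where "v = a + b" "a \<in> B ` \<tau>" "b \<in> ?K" by (auto simp: \<tau>'_def)
        then show "v \<in> model M" using BtM(1) kd(1) m.subspace_models(2) subspace_add by blast
      qed
      show "dim \<tau>' = mdim S" by fact
      show "\<forall>\<^sub>F k in sequentially. subspace (?t k) \<and> ?t k \<subseteq> model M \<and> dim (?t k) = mdim S" using t by simp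
      fix v assume "v \<in> \<tau>'"
      then obtain a u where v: "v = B a + k u" "a \<in> \<tau>" "u \<in> model L" by (auto simp: \<tau>'_def)
      obtain w1 where w1: "\<forall>\<^sub>F k in sequentially. w1 k \<in> ?t' k" "w1 \<longlonglongrightarrow> a" using \<tau>(5)[OF v(2)] by blast
      obtain w2 where w2: "\<forall>\<^sub>F k in sequentially. w2 k \<in> ?t k" "w2 \<longlonglongrightarrow> k u" using Kt[OF v(3)] by blast
      have "(\<lambda>k. B (w1 k)) \<longlonglongrightarrow> B a"
        using w1(2) B(1) by (intro bounded_linear.tendsto[of B]) (simp add: linear_linear)
      then have "(\<lambda>k. B (w1 k) + w2 k) \<longlonglongrightarrow> v" unfolding v(1) using w2(2) by (rule tendsto_add)
      moreover have "\<forall>\<^sub>F k in sequentially. B (w1 k) + w2 k \<in> ?t k"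
        using w1(1) w2(1)
      proof eventually_elim
        case (elim i)
        then show ?case using Bt[of "w1 i" i] t(1)[of i] by (simp add: subspace_add)
      qed
      ultimately show "\<exists>w. (\<forall>\<^sub>F k in sequentially. w k \<in> ?t k) \<and> w \<longlonglongrightarrow> v"
        by (intro exI[of _ "\<lambda>k. B (w1 k) + w2 k"] conjI)
    qed
    have sub: "B ` el \<subseteq> \<tau>'"
      by (rule reg[of X Y]) (use XY limXY limB lim\<tau>' in blast)
    show "el \<subseteq> \<tau>"
    proof
      fix v assume v: "v \<in> el"
      then have vQ: "v \<in> model Q" using limitin_GrassmannianD(2)[OF limel] by auto
      have "B v \<in> \<tau>'" using sub v by blast
      then obtain a b where ab: "B v = B a + b" "a \<in> \<tau>" "b \<in> ?K" by (auto simp: \<tau>'_def)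
      have aQ': "a \<in> model Q" using ab(2) \<tau>(2) by auto
      \<comment> \<open>Places \<open>b\<close> in two spaces that meet only in \<open>0\<close>;
        then injectivity of \<open>B\<close> gives \<open>v = a\<close>.\<close>
      have "b = B (v - a)" using ab(1) by (simp add: linear_diff[OF B(1)])
      moreover have "v - a \<in> model Q" using vQ aQ' F by (simp add: subspace_diff)
      ultimately have "b \<in> ?K \<inter> B ` model Q" using ab(3) by blast
      then have "b = 0" using B(4) by blast
      then have "v = a" using ab(1) B(3) vQ aQ' by (auto dest: inj_onD)
      then show "v \<in> \<tau>" using ab(2) by simp
    qed
  qed
qed

text \<open>The strata are saturated and \<open>f\<close> is open, so membership in a stratum and in
  its closure can be read off upstairs. Disjointness, local closedness, local finiteness and the
  order all transfer through these two equivalences.\<close>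

lemma stratification_image:
  fixes S :: "'i::order \<Rightarrow> ('a, 'e::euclidean_space) manifold" and T :: "'i \<Rightarrow> ('b, 'h::euclidean_space) manifold"
  assumes strat: "stratification X P S" and f: "continuous_map X Y f" "open_map X Y f" "f ` topspace X = topspace Y"
    and Y: "Hausdorff_space Y"
    and sat: "\<And>i. i \<in> P \<Longrightarrow> {x \<in> topspace X. f x \<in> f ` points (S i)} = points (S i)"
    and T: "\<And>i. i \<in> P \<Longrightarrow> points (T i) = f ` points (S i)" "\<And>i. i \<in> P \<Longrightarrow> smooth_manifold (T i)"
    "\<And>i. i \<in> P \<Longrightarrow> mtop (T i) = subtopology Y (points (T i))"
  shows "stratification Y P T"
proof -
  note st = strat[unfolded stratification_def]
  have X: "separable_space X" "locally_compact_space X" "(\<Union>i\<in>P. points (S i)) = topspace X"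
    "locally_finite_in X ((\<lambda>i. points (S i)) ` P)"
    using st by - (elim conjE, assumption)+
  have "\<forall>i\<in>P. \<forall>j\<in>P. i \<noteq> j \<longrightarrow> points (S i) \<inter> points (S j) = {}"
    using st by (elim conjE)
  then have disj: "points (S i) \<inter> points (S j) = {}" if "i \<in> P" "j \<in> P" "i \<noteq> j" for i j
    using that by simp
  have "\<forall>i\<in>P. points (S i) \<noteq> {} \<and> (\<exists>U C. openin X U \<and> closedin X C \<and> points (S i) = U \<inter> C) \<and>
      mtop (S i) = subtopology X (points (S i))"
    using st by (elim conjE)
  then have ne: "points (S i) \<noteq> {}" and lc: "\<exists>U C. openin X U \<and> closedin X C \<and> points (S i) = U \<inter> C"
    if "i \<in> P" for i
    using that by blast+
  have "\<forall>i\<in>P. \<forall>j\<in>P. (points (S i) \<inter> X closure_of points (S j) \<noteq> {} \<longleftrightarrow> points (S i) \<subseteq> X closure_of points (S j)) \<and>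
      (points (S i) \<subseteq> X closure_of points (S j) \<longleftrightarrow> i \<le> j)"
    using st by (elim conjE)
  then have ord: "points (S i) \<inter> X closure_of points (S j) \<noteq> {} \<longleftrightarrow> points (S i) \<subseteq> X closure_of points (S j)"
    "points (S i) \<subseteq> X closure_of points (S j) \<longleftrightarrow> i \<le> j" if "i \<in> P" "j \<in> P" for i j
    using that by blast+
  have sub: "points (S i) \<subseteq> topspace X" if "i \<in> P" for i using X(3) that by blast
  have mem: "f x \<in> f ` points (S i) \<longleftrightarrow> x \<in> points (S i)" if "i \<in> P" "x \<in> topspace X" for i x
    using sat[OF that(1)] that(2) by blast
  have clo: "f x \<in> Y closure_of (f ` points (S i)) \<longleftrightarrow> x \<in> X closure_of points (S i)" if "i \<in> P" "x \<in> topspace X" for i x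
    by (rule closure_of_saturated_iff[OF f(2,1) sub[OF that(1)] sat[OF that(1)] that(2)])
  show ?thesis
    unfolding stratification_def
  proof (intro conjI ballI impI)
    show "separable_space Y" using separable_space_continuous_map_image[OF X(1) f(1,3)] .
    show "locally_compact_space Y" using locally_compact_space_continuous_open_map_image[OF f X(2)] .
    show "Hausdorff_space Y" by fact
    have "(\<Union>i\<in>P. points (T i)) = f ` (\<Union>i\<in>P. points (S i))" using T(1) by (simp add: image_UN)
    then show "(\<Union>i\<in>P. points (T i)) = topspace Y" unfolding X(3) f(3) .
    show "points (T i) \<inter> points (T j) = {}" if ij: "i \<in> P" "j \<in> P" "i \<noteq> j" for i j
    proof (rule ccontr)
      assume "points (T i) \<inter> points (T j) \<noteq> {}"
      then obtain x where "x \<in> points (S i)" "f x \<in> f ` points (S j)" using T(1) ij by auto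
      then show False using mem[OF ij(2), of x] sub[OF ij(1)] disj[OF ij] by blast
    qed
    show "points (T i) \<noteq> {}" if "i \<in> P" for i using T(1) ne that by simp
    show "\<exists>U C. openin Y U \<and> closedin Y C \<and> points (T i) = U \<inter> C" if i: "i \<in> P" for i
    proof -
      obtain U C where UC: "openin X U" "closedin X C" "points (S i) = U \<inter> C" using lc[OF i] by blast
      \<comment> \<open>\<open>U\<close> and \<open>C\<close> may fail to be saturated, and the
        image of \<open>C\<close> may fail to be closed. The closure of the stratum replaces
        \<open>C\<close>: its preimage is the closure upstairs, which lies in
        \<open>C\<close>.\<close>
      have "points (T i) = f ` U \<inter> Y closure_of (f ` points (S i))"
      proof (intro equalityI subsetI)
        fix q assume "q \<in> points (T i)"
        then obtain x where "x \<in> points (S i)" "q = f x" using T(1)[OF i] by blast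
        then show "q \<in> f ` U \<inter> Y closure_of (f ` points (S i))"
          using UC(3) clo[OF i, of x] sub[OF i] closure_of_subset[OF sub[OF i]] by blast
      next
        fix q assume "q \<in> f ` U \<inter> Y closure_of (f ` points (S i))"
        then obtain u where u: "u \<in> U" "q = f u" "f u \<in> Y closure_of (f ` points (S i))" by blast
        then have "u \<in> X closure_of points (S i)" using clo[OF i, of u] openin_subset[OF UC(1)] by blast
        then have "u \<in> C" using closure_of_minimal[OF _ UC(2), of "points (S i)"] UC(3) by blast
        then show "q \<in> points (T i)" using u UC(3) T(1)[OF i] by blast
      qed
      moreover have "openin Y (f ` U)" using f(2) UC(1) by (auto simp: open_map_def)
      ultimately show ?thesis using closedin_closure_of by blast
    qed
    show "mtop (T i) = subtopology Y (points (T i))" if "i \<in> P" for i using T(3)[OF that] .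
    show "locally_finite_in Y ((\<lambda>i. points (T i)) ` P)"
      unfolding locally_finite_in_def
    proof (intro conjI ballI)
      show "\<Union>((\<lambda>i. points (T i)) ` P) \<subseteq> topspace Y"
        unfolding f(3)[symmetric] using T(1) sub by blast
      fix q assume "q \<in> topspace Y"
      then obtain x where x: "x \<in> topspace X" "q = f x" using f(3) by blast
      then obtain V where V: "openin X V" "x \<in> V" "finite {U \<in> (\<lambda>i. points (S i)) ` P. U \<inter> V \<noteq> {}}"
        using X(4) unfolding locally_finite_in_def by blast
      \<comment> \<open>By saturation, a stratum whose image meets the image of \<open>V\<close>
        meets \<open>V\<close> itself, so a finite family upstairs covers the one
        downstairs.\<close>
      have "{U \<in> (\<lambda>i. points (T i)) ` P. U \<inter> f ` V \<noteq> {}} \<subseteq> (\<lambda>A. f ` A) ` {U \<in> (\<lambda>i. points (S i)) ` P. U \<inter> V \<noteq> {}}"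
      proof
        fix A assume "A \<in> {U \<in> (\<lambda>i. points (T i)) ` P. U \<inter> f ` V \<noteq> {}}"
        then obtain i where i: "i \<in> P" "A = f ` points (S i)" and "A \<inter> f ` V \<noteq> {}" using T(1) by blast
        then obtain v where "v \<in> V" "f v \<in> A" by (metis Int_emptyI imageE)
        then have v: "v \<in> V" "f v \<in> f ` points (S i)" using i(2) by simp_all
        then have "v \<in> points (S i)" using mem[OF i(1), of v] openin_subset[OF V(1)] by blast
        then show "A \<in> (\<lambda>A. f ` A) ` {U \<in> (\<lambda>i. points (S i)) ` P. U \<inter> V \<noteq> {}}" using i v by blast
      qed
      then have "finite {U \<in> (\<lambda>i. points (T i)) ` P. U \<inter> f ` V \<noteq> {}}"
        by (rule finite_subset[OF _ finite_imageI[OF V(3)]])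
      moreover have "openin Y (f ` V)" using f(2) V(1) by (auto simp: open_map_def)
      ultimately show "\<exists>V. openin Y V \<and> q \<in> V \<and> finite {U \<in> (\<lambda>i. points (T i)) ` P. U \<inter> V \<noteq> {}}"
        using V(2) x(2) by (intro exI[of _ "f ` V"]) simp
    qed
    show "smooth_manifold (T i)" if "i \<in> P" for i using T(2)[OF that] .
    fix i j assume ij: "i \<in> P" "j \<in> P"
    have in_clo: "f x \<in> Y closure_of points (T j) \<longleftrightarrow> x \<in> X closure_of points (S j)" if "x \<in> points (S i)" for x
      using clo[OF ij(2), of x] sub[OF ij(1)] that T(1)[OF ij(2)] by auto
    have 1: "points (T i) \<inter> Y closure_of points (T j) \<noteq> {} \<longleftrightarrow> points (S i) \<inter> X closure_of points (S j) \<noteq> {}"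
      using in_clo unfolding T(1)[OF ij(1)] by blast
    have 2: "points (T i) \<subseteq> Y closure_of points (T j) \<longleftrightarrow> points (S i) \<subseteq> X closure_of points (S j)"
      using in_clo unfolding T(1)[OF ij(1)] by blast
    show "points (T i) \<inter> Y closure_of points (T j) \<noteq> {} \<longleftrightarrow> points (T i) \<subseteq> Y closure_of points (T j)"
      "points (T i) \<subseteq> Y closure_of points (T j) \<longleftrightarrow> i \<le> j"
      unfolding 1 2 using ord[OF ij] by blast+
  qed
qed

text \<open>Handles one given choice of \<open>Q\<close> and of all \<open>T i\<close>. Regularity
  upstairs is available only for pairs in the closure relation, so that relation is first lifted
  from the orbit strata by saturation.\<close>

lemma whitney_stratified_quotient:
  fixes M :: "('a, 'e::euclidean_space) manifold"
  assumes M: "free_compact_action G L M \<alpha>" and S: "\<And>i. i \<in> P \<Longrightarrow> free_compact_action G L (S i) \<alpha>"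
    and W: "whitney_stratified_subset M X P S" and inv: "invariant_set G X \<alpha>"
    and Q: "quotient_manifold G \<alpha> M Q" and T: "\<And>i. i \<in> P \<Longrightarrow> quotient_manifold G \<alpha> (S i) (T i)"
  shows "whitney_stratified_subset Q (orbits G X \<alpha>) P T"
proof -
  interpret m: free_compact_action G L M \<alpha> by fact
  let ?pi = "orbit G \<alpha>"
  note W' = W[unfolded whitney_stratified_subset_def]
  have clX: "closedin (mtop M) X" and strat: "stratification (subtopology (mtop M) X) P S"
    and sub: "\<And>i. i \<in> P \<Longrightarrow> submanifold M (S i)"
    and reg: "\<And>i j x. i \<in> P \<Longrightarrow> j \<in> P \<Longrightarrow> i \<noteq> j \<Longrightarrow> points (S i) \<subseteq> mtop M closure_of points (S j) \<Longrightarrow>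
      x \<in> points (S i) \<Longrightarrow> whitney_B_regular_at M (S i) (S j) x"
    using W' by blast+
  have XM: "X \<subseteq> points M" using clX by (rule closedin_subset)
  have orb: "orbits G X \<alpha> = ?pi ` X" by (auto simp: orbits_def)
  have satX: "{x \<in> points M. ?pi x \<in> ?pi ` X} = X"
  proof -
    have "m.saturation X \<subseteq> X" using inv unfolding m.saturation_def invariant_set_def by blast
    then show ?thesis using m.pi_preimage_image[OF XM] m.subset_saturation[OF XM] by blast
  qed
  have qm: "quotient_map (mtop M) (mtop Q) ?pi" by (rule m.quotient_map_pi[OF Q])
  note op = m.quotient_open_map[OF qm]
  note restr = quotient_map_open_restriction[OF qm op XM satX]
  have SX: "points (S i) \<subseteq> X" if "i \<in> P" for i
  proof -
    have "(\<Union>i\<in>P. points (S i)) = topspace (subtopology (mtop M) X)"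
      using strat unfolding stratification_def by (elim conjE)
    then show ?thesis using that by auto
  qed
  have satS: "{x \<in> points M. ?pi x \<in> ?pi ` points (S i)} = points (S i)" if i: "i \<in> P" for i
    using m.pi_preimage_image[OF submanifoldD(2)[OF sub[OF i]]] quotient_subtopology(3)[OF M S[OF i] sub[OF i] Q T[OF i]] by simp
  have pT: "points (T i) = ?pi ` points (S i)" if i: "i \<in> P" for i
    by (rule free_compact_action.points_Q[OF S[OF i] T[OF i]])
  have subT: "submanifold Q (T i)" if i: "i \<in> P" for i
    by (rule quotient_submanifold[OF M S[OF i] sub[OF i] Q T[OF i]])
  have mQ: "smooth_manifold Q" using Q by (simp add: quotient_manifold_def)
  show ?thesis
    unfolding whitney_stratified_subset_def
  proof (intro conjI ballI impI)
    show "smooth_manifold Q" by fact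
    show "closedin (mtop Q) (orbits G X \<alpha>)"
    proof -
      have pX: "?pi ` X \<subseteq> points Q" using XM m.points_Q[OF Q] by blast
      have "{x \<in> points M. ?pi x \<in> points Q - ?pi ` X} = points M - X"
        using satX m.points_Q[OF Q] by blast
      moreover have "openin (mtop M) (points M - X)" using clX by (simp add: closedin_def)
      ultimately have "openin (mtop Q) (points Q - ?pi ` X)"
        using qm unfolding quotient_map_def by (metis Diff_subset)
      then show ?thesis using pX by (simp add: closedin_def orb)
    qed
    show "stratification (subtopology (mtop Q) (orbits G X \<alpha>)) P T"
      unfolding orb
    proof (rule stratification_image[OF strat])
      show "continuous_map (subtopology (mtop M) X) (subtopology (mtop Q) (?pi ` X)) ?pi"
        using restr(1) by (rule quotient_imp_continuous_map)
      show "open_map (subtopology (mtop M) X) (subtopology (mtop Q) (?pi ` X)) ?pi" by (rule restr(2))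
      show "?pi ` topspace (subtopology (mtop M) X) = topspace (subtopology (mtop Q) (?pi ` X))"
        using restr(1) unfolding quotient_map_def by blast
      show "Hausdorff_space (subtopology (mtop Q) (?pi ` X))"
        using mQ by (intro Hausdorff_space_subtopology) (simp add: smooth_manifold_def)
      fix i assume i: "i \<in> P"
      show "{x \<in> topspace (subtopology (mtop M) X). ?pi x \<in> ?pi ` points (S i)} = points (S i)"
        using satS[OF i] SX[OF i] by auto
      show "points (T i) = ?pi ` points (S i)" by (rule pT[OF i])
      show "smooth_manifold (T i)" using T[OF i] by (simp add: quotient_manifold_def)
      have "?pi ` X \<inter> points (T i) = points (T i)" using pT[OF i] SX[OF i] by blast
      then show "mtop (T i) = subtopology (subtopology (mtop Q) (?pi ` X)) (points (T i))"
        using submanifoldD(3)[OF subT[OF i]] by (simp only: subtopology_subtopology)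
    qed
    show "submanifold Q (T i)" if "i \<in> P" for i using subT[OF that] .
    fix i j q assume ij: "i \<in> P" "j \<in> P" "i \<noteq> j \<and> points (T i) \<subseteq> mtop Q closure_of points (T j)"
      and "q \<in> points (T i)"
    then obtain x where x: "x \<in> points (S i)" "q = ?pi x" using pT by blast
    have "points (S i) \<subseteq> mtop M closure_of points (S j)"
    proof
      fix y assume y: "y \<in> points (S i)"
      then have "?pi y \<in> points (T i)" using pT[OF ij(1)] by simp
      then have "?pi y \<in> mtop Q closure_of (?pi ` points (S j))" using ij(3) pT[OF ij(2)] by auto
      moreover have "y \<in> points M" using y submanifoldD(2)[OF sub[OF ij(1)]] by auto
      ultimately show "y \<in> mtop M closure_of points (S j)"
        using closure_of_saturated_iff[OF op quotient_imp_continuous_map[OF qm]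
            submanifoldD(2)[OF sub[OF ij(2)]] satS[OF ij(2)]] by simp
    qed
    then have "whitney_B_regular_at M (S i) (S j) x" using reg[of i j x] ij x(1) by simp
    then show "whitney_B_regular_at Q (T i) (T j) q"
      unfolding x(2)
      by (rule whitney_B_quotient[OF M S[OF ij(1)] S[OF ij(2)] sub[OF ij(1)] sub[OF ij(2)] Q T[OF ij(1)] T[OF ij(2)] x(1)])
  qed
qed

theorem theorem4p3:
  fixes G :: "('g, 'm) monoid_scheme"
    and L :: "('g, 'f::euclidean_space) manifold"
    and M :: "('a, 'e::euclidean_space) manifold"
    and \<alpha> :: "'g \<Rightarrow> 'a \<Rightarrow> 'a"
    and X :: "'a set"
    and P :: "'i::order set"
    and S :: "'i \<Rightarrow> ('a, 'e) manifold"
  assumes "Lie_group G L" and "compact_space (mtop L)"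
    and "smooth_manifold M"
    and "smooth_action G L M \<alpha>" and "free_action G (points M) \<alpha>"
    and "whitney_stratified_subset M X P S"
    and "invariant_set G X \<alpha>"
    and "compatible_action G L P S \<alpha>"
  shows "(\<exists>Q. quotient_manifold G \<alpha> M Q) \<and>
         (\<forall>i\<in>P. \<exists>T. quotient_manifold G \<alpha> (S i) T) \<and>
         (\<forall>Q T. quotient_manifold G \<alpha> M Q \<and> (\<forall>i\<in>P. quotient_manifold G \<alpha> (S i) (T i)) \<longrightarrow>
            whitney_stratified_subset Q (orbits G X \<alpha>) P T)"
proof -
  interpret act: group_action G "points M" \<alpha> using assms(4) by (simp add: smooth_action_def)
  have closed: "\<alpha> g x \<in> points M" if "g \<in> carrier G" "x \<in> points M" for g x
    using act.element_image[OF that refl] .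
  have one: "\<alpha> \<one>\<^bsub>G\<^esub> x = x" if "x \<in> points M" for x
    using act.id_eq_one that by (metis restrict_apply')
  have mult: "\<alpha> (g \<otimes>\<^bsub>G\<^esub> h) x = \<alpha> g (\<alpha> h x)" if "g \<in> carrier G" "h \<in> carrier G" "x \<in> points M" for g h x
    using act.composition_rule that by blast
  have free: "g = \<one>\<^bsub>G\<^esub>" if "g \<in> carrier G" "x \<in> points M" "\<alpha> g x = x" for g x
  proof -
    have "g \<in> stabilizer G \<alpha> x" using that by (simp add: stabilizer_def)
    then show ?thesis using assms(5) that(2) by (simp add: free_action_def)
  qed
  have M: "free_compact_action G L M \<alpha>"
    using assms(1-4) closed one mult free by unfold_locales (auto simp: smooth_action_def)
  have sub: "submanifold M (S i)" if "i \<in> P" for i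
    using assms(6) that by (simp add: whitney_stratified_subset_def)
  \<comment> \<open>Group laws and freeness are inherited from \<open>M\<close>; invariance, and
    smoothness for the stratum's own structure, come from compatibility.\<close>
  have S: "free_compact_action G L (S i) \<alpha>" if i: "i \<in> P" for i
  proof -
    note SM = submanifoldD(1,2)[OF sub[OF i]]
    have inv: "\<alpha> g x \<in> points (S i)" if "g \<in> carrier G" "x \<in> points (S i)" for g x
      using assms(8) i that unfolding compatible_action_def invariant_set_def by blast
    show ?thesis
    proof
      show "smooth_map (product_manifold L (S i)) (S i) (\<lambda>(g, x). \<alpha> g x)"
        using assms(8) i by (simp add: compatible_action_def)
    qed (use assms(1,2) SM inv one mult free in \<open>auto simp: subset_iff\<close>)
  qed
  show ?thesis
    using free_compact_action.quotient_manifold_exists[OF M] free_compact_action.quotient_manifold_exists[OF S]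
      whitney_stratified_quotient[OF M S assms(6,7)] by blast
qed

end
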